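(* Let $D$ be a knot diagram with all-$A$ ribbon graph $\mathbb{G}$. For integers $u,v$ let $\mathcal{C}_v^u(\mathbb{G})$ be the free abelian group generated by the quasi-trees $\mathbb{Q}$ of $\mathbb{G}$ with $u(\mathbb{Q})=u$ and $v(\mathbb{Q})=v$, and $\mathcal{C}(\mathbb{G})=\bigoplus_{u,v}\mathcal{C}_v^u(\mathbb{G})$. Then there is a differential $\partial:\mathcal{C}_v^u\to\mathcal{C}_{v-1}^{u-1}$ making $\mathcal{C}(\mathbb{G})=\{\mathcal{C}_v^u(\mathbb{G}),\partial\}$ a chain complex that is a deformation retract of the reduced Khovanov complex of $D$. In particular, $$\widetilde{H}^{i,j}(D;\mathbb{Z})\cong H_v^u(\mathcal{C}(\mathbb{G});\mathbb{Z})$$ where $u=j-i-w(D)+1$ and $v=j/2-i+(V(\mathbb{G})-c_+(D))/2$, with $w(D)$ the writhe of $D$, $c_+(D)$ the number of positive crossings of $D$, and $V(\mathbb{G})$ the number of vertices of $\mathbb{G}$ (the number of circles in the all-$A$ state of $D$).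
   Context: $\widetilde{H}^{i,j}(D;\mathbb{Z})$ denotes reduced Khovanov homology with homological grading $i$ and quantum grading $j$. Each crossing of $D$ has an $A$-smoothing and a $B$-smoothing (Kauffman's convention); the all-$A$ state smooths every crossing by $A$. Number the crossings $1,\dots,n$. Half-edges and permutations: position crossing $i$ with strands parallel to $y=\pm x$, and mark half-edges $2i-1$ and $2i$ on the all-$A$ state circles near the crossing in the half-planes $y>x$ and $y<x$. Orient each all-$A$ state circle counterclockwise if nested in an even number of other state circles, clockwise otherwise (positive direction). $\sigma_0$ sends each mark to the next mark in the positive direction on its circle; $\sigma_1=\prod_i(2i-1,\,2i)$; $\sigma_2=\sigma_1\circ\sigma_0^{-1}$. The all-$A$ ribbon graph $\mathbb{G}$ has vertices the $\sigma_0$-orbits (all-$A$ state circles), edges the $\sigma_1$-orbits (edge $i=\{2i-1,2i\}$, one per crossing), cyclic orders given by $\sigma_0$; as a surface it is one disk per vertex and one untwisted band per edge, orientable. A spanning subgraph has all vertices of $\mathbb{G}$ and a subset of its edges; its faces are the boundary components of the surface of vertex disks and bands of its edges. A quasi-tree is a spanning subgraph $\mathbb{Q}$ with exactly one face; its genus is $g(\mathbb{Q})=(1-V(\mathbb{Q})+E(\mathbb{Q}))/2$. For a quasi-tree $\mathbb{Q}$, let $\sigma(i)=\sigma_0(i)$ if half-edge $i$ is not in $\mathbb{Q}$ and $\sigma(i)=\sigma_2^{-1}(i)$ if it is; $C_{\mathbb{Q}}$ is the ordered chord diagram: a circle with marks $1,\dots,2n$ placed consecutively in the order given by $\sigma$,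 with chord $i$ joining $2i-1$ and $2i$. Chords are totally ordered by $i$ (i.e. by $\min(2i-1,2i)$); two chords intersect if their endpoints interleave on the circle. A chord (and the corresponding edge of $\mathbb{G}$) is live with respect to $\mathbb{Q}$ if it intersects no lower-ordered chord. Define $u(\mathbb{Q})=\#\{\text{live edges not in }\mathbb{Q}\}-\#\{\text{live edges in }\mathbb{Q}\}$ and $v(\mathbb{Q})=-g(\mathbb{Q})$. *)

theory Defs
  imports Complex_Main "HOL-Algebra.Coset"
begin

text \<open>
  A knot diagram with n crossings (numbered 1..n) is encoded as a planar 4-valent combinatorial
  map.  Darts are pairs (c,k) with crossing c in {1..n} and k in {0,1,2,3}; the four darts at a
  crossing are listed counterclockwise (rotation dg_rot), and the darts (c,0), (c,2) are the ends
  of the over-strand.  The fixed-point free involution al pairs the two ends of each edge of the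
  diagram.  The face on the left of a dart x (traversed from its crossing along its edge) is
  encoded by the orbit of x under dg_rot_inv o al.
\<close>

definition dg_darts :: "nat \<Rightarrow> (nat \<times> nat) set" where
  "dg_darts n = {1..n} \<times> {0..<4}"

definition dg_rot :: "nat \<times> nat \<Rightarrow> nat \<times> nat" where
  "dg_rot d = (fst d, (snd d + 1) mod 4)"

definition dg_rot_inv :: "nat \<times> nat \<Rightarrow> nat \<times> nat" where
  "dg_rot_inv d = (fst d, (snd d + 3) mod 4)"

definition perm_orbit :: "('a \<Rightarrow> 'a) \<Rightarrow> 'a \<Rightarrow> 'a set" where
  "perm_orbit f x = {(f ^^ k) x | k. True}"

definition perm_orbits :: "('a \<Rightarrow> 'a) \<Rightarrow> 'a set \<Rightarrow> 'a set set" where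
  "perm_orbits f A = perm_orbit f ` A"

definition dg_face_perm :: "(nat \<times> nat \<Rightarrow> nat \<times> nat) \<Rightarrow> nat \<times> nat \<Rightarrow> nat \<times> nat" where
  "dg_face_perm al = dg_rot_inv \<circ> al"

definition dg_straight :: "(nat \<times> nat \<Rightarrow> nat \<times> nat) \<Rightarrow> nat \<times> nat \<Rightarrow> nat \<times> nat" where
  "dg_straight al d = (fst (al d), (snd (al d) + 2) mod 4)"

text \<open>Well-formed knot diagram: al is a fixed-point free involution on darts, the map is
  planar (Euler formula V - E + F = 2 with V = n, E = 2n), and the diagram has exactly one
  component (the straight-ahead permutation has exactly two orbits: the knot traversed in its two
  directions; this also gives connectedness).\<close>
definition knot_diagram :: "nat \<Rightarrow> (nat \<times> nat \<Rightarrow> nat \<times> nat) \<Rightarrow> bool" where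
  "knot_diagram n al \<longleftrightarrow> n \<ge> 1
     \<and> (\<forall>x\<in>dg_darts n. al x \<in> dg_darts n \<and> al x \<noteq> x \<and> al (al x) = x)
     \<and> card (perm_orbits (dg_face_perm al) (dg_darts n)) = n + 2
     \<and> card (perm_orbits (dg_straight al) (dg_darts n)) = 2"

text \<open>Parity of the left face of a dart = number of all-A state circles (equivalently of diagram
  edges crossed by a path) separating it from the unbounded face, mod 2.  The dart outer has the
  unbounded face on its left.  (True = odd.)\<close>
definition face_odd :: "nat \<Rightarrow> (nat \<times> nat \<Rightarrow> nat \<times> nat) \<Rightarrow> nat \<times> nat \<Rightarrow> nat \<times> nat \<Rightarrow> bool" where
  "face_odd n al outer = (THE p. (\<forall>x\<in>dg_darts n. p (dg_face_perm al x) = p x \<and> p (al x) = (\<not> p x))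
      \<and> \<not> p outer \<and> (\<forall>x. x \<notin> dg_darts n \<longrightarrow> \<not> p x))"

text \<open>The knot is oriented by traversing it starting along dart (1,0); outgoing darts:\<close>
definition knot_out :: "(nat \<times> nat \<Rightarrow> nat \<times> nat) \<Rightarrow> (nat \<times> nat) set" where
  "knot_out al = perm_orbit (dg_straight al) (1, 0)"

text \<open>Crossing c is positive iff the outgoing under-dart is counterclockwise (by 90 degrees)
  from the outgoing over-dart (right-handed crossing).\<close>
definition positive_crossing :: "(nat \<times> nat \<Rightarrow> nat \<times> nat) \<Rightarrow> nat \<Rightarrow> bool" where
  "positive_crossing al c \<longleftrightarrow>
     (let ov = (if (c, 0) \<in> knot_out al then 0 else 2) in (c, (ov + 1) mod 4) \<in> knot_out al)"

definition c_plus :: "nat \<Rightarrow> (nat \<times> nat \<Rightarrow> nat \<times> nat) \<Rightarrow> nat" where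
  "c_plus n al = card {c \<in> {1..n}. positive_crossing al c}"

definition c_minus :: "nat \<Rightarrow> (nat \<times> nat \<Rightarrow> nat \<times> nat) \<Rightarrow> nat" where
  "c_minus n al = card {c \<in> {1..n}. \<not> positive_crossing al c}"

definition writhe :: "nat \<Rightarrow> (nat \<times> nat \<Rightarrow> nat \<times> nat) \<Rightarrow> int" where
  "writhe n al = int (c_plus n al) - int (c_minus n al)"

text \<open>Smoothing of a state S (S = set of B-smoothed crossings; the others are A-smoothed).
  A-smoothing at c joins dart k with dart 3-k (arcs (c,1)-(c,2) and (c,3)-(c,0));
  B-smoothing joins (c,0)-(c,1) and (c,2)-(c,3).\<close>
definition smooth :: "nat set \<Rightarrow> nat \<times> nat \<Rightarrow> nat \<times> nat" where
  "smooth S d = (if fst d \<in> S then (fst d, if even (snd d) then snd d + 1 else snd d - 1)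
                 else (fst d, 3 - snd d))"

definition state_rel :: "nat \<Rightarrow> (nat \<times> nat \<Rightarrow> nat \<times> nat) \<Rightarrow> nat set \<Rightarrow> ((nat \<times> nat) \<times> (nat \<times> nat)) set" where
  "state_rel n al S = {(x, al x) | x. x \<in> dg_darts n} \<union> {(x, smooth S x) | x. x \<in> dg_darts n}"

definition state_circ :: "nat \<Rightarrow> (nat \<times> nat \<Rightarrow> nat \<times> nat) \<Rightarrow> nat set \<Rightarrow> nat \<times> nat \<Rightarrow> (nat \<times> nat) set" where
  "state_circ n al S x = {y. (x, y) \<in> (state_rel n al S)\<^sup>*}"

definition state_circles :: "nat \<Rightarrow> (nat \<times> nat \<Rightarrow> nat \<times> nat) \<Rightarrow> nat set \<Rightarrow> (nat \<times> nat) set set" where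
  "state_circles n al S = state_circ n al S ` dg_darts n"

type_synonym kh_gen = "nat set \<times> (nat \<times> nat) set set"

text \<open>Generators of the reduced Khovanov complex: enhanced states (S, L), L = set of circles
  labelled x (= v_-), the others labelled 1 (= v_+); the circle through the base point (the edge
  of dart base) is labelled x.\<close>
definition kh_gens :: "nat \<Rightarrow> (nat \<times> nat \<Rightarrow> nat \<times> nat) \<Rightarrow> nat \<times> nat \<Rightarrow> kh_gen set" where
  "kh_gens n al base = {(S, L). S \<subseteq> {1..n} \<and> L \<subseteq> state_circles n al S
       \<and> state_circ n al S base \<in> L}"

definition kh_i :: "nat \<Rightarrow> (nat \<times> nat \<Rightarrow> nat \<times> nat) \<Rightarrow> kh_gen \<Rightarrow> int" where
  "kh_i n al g = int (card (fst g)) - int (c_minus n al)"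

definition kh_j :: "nat \<Rightarrow> (nat \<times> nat \<Rightarrow> nat \<times> nat) \<Rightarrow> kh_gen \<Rightarrow> int" where
  "kh_j n al g = int (card (state_circles n al (fst g))) - 2 * int (card (snd g))
      + int (card (fst g)) + int (c_plus n al) - 2 * int (c_minus n al)"

definition kh_deg :: "nat \<Rightarrow> (nat \<times> nat \<Rightarrow> nat \<times> nat) \<Rightarrow> kh_gen \<Rightarrow> int \<times> int" where
  "kh_deg n al g = (kh_i n al g, kh_j n al g)"

text \<open>Matrix of the Khovanov differential: kh_d g g' is the coefficient of g' in d(g).
  The edge map of the cube at crossing c is the merge m (1*1=1, 1*x=x*1=x, x*x=0) or the split
  Delta (1 -> 1*x + x*1, x -> x*x), with sign (-1)^(number of B-smoothed crossings below c).\<close>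
definition kh_d :: "nat \<Rightarrow> (nat \<times> nat \<Rightarrow> nat \<times> nat) \<Rightarrow> nat \<times> nat \<Rightarrow> kh_gen \<Rightarrow> kh_gen \<Rightarrow> int" where
  "kh_d n al base g g' =
    (if g \<in> kh_gens n al base \<and> g' \<in> kh_gens n al base
        \<and> (\<exists>c\<in>{1..n}. c \<notin> fst g \<and> fst g' = insert c (fst g)) then
      (let S = fst g; L = snd g; S' = fst g'; L' = snd g';
           c = (THE c. c \<notin> S \<and> S' = insert c S);
           sgn = (-1::int) ^ card {c' \<in> S. c' < c};
           old = {C \<in> state_circles n al S. \<exists>k<4. (c, k) \<in> C};
           new = {C \<in> state_circles n al S'. \<exists>k<4. (c, k) \<in> C};
           keep = L - old
       in sgn *
          (if card old = 2 then
             (if old \<subseteq> L then 0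
              else if old \<inter> L \<noteq> {} then of_bool (L' = keep \<union> new)
              else of_bool (L' = keep))
           else
             (if old \<subseteq> L then of_bool (L' = keep \<union> new)
              else int (card {C \<in> new. L' = insert C keep}))))
     else 0)"

text \<open>Half-edge 2c-1 sits on the all-A arc (c,1)-(c,2), half-edge 2c on the arc (c,3)-(c,0).
  (Which arc is called 2c-1 depends on the positioning of the crossing; the construction is
  symmetric under swapping the two labels.)\<close>
definition arc_mark :: "nat \<times> nat \<Rightarrow> nat" where
  "arc_mark d = (if snd d \<in> {1, 2} then 2 * fst d - 1 else 2 * fst d)"

text \<open>The dart through which the all-A circle leaves the arc of half-edge j when traversed in the
  positive direction: the one having an odd face on its left (counterclockwise orientation of
  circles nested in an even number of circles is exactly: the odd regions lie on the left).\<close>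
definition mark_exit :: "nat \<Rightarrow> (nat \<times> nat \<Rightarrow> nat \<times> nat) \<Rightarrow> nat \<times> nat \<Rightarrow> nat \<Rightarrow> nat \<times> nat" where
  "mark_exit n al outer j =
     (let c = (j + 1) div 2;
          a = (if odd j then (c, 1) else (c, 3));
          b = (if odd j then (c, 2) else (c, 0))
      in if face_odd n al outer a then a else b)"

definition sigma0 :: "nat \<Rightarrow> (nat \<times> nat \<Rightarrow> nat \<times> nat) \<Rightarrow> nat \<times> nat \<Rightarrow> nat \<Rightarrow> nat" where
  "sigma0 n al outer j = arc_mark (al (mark_exit n al outer j))"

definition sigma1 :: "nat \<Rightarrow> nat" where
  "sigma1 j = (if odd j then j + 1 else j - 1)"

definition rg_V :: "nat \<Rightarrow> (nat \<times> nat \<Rightarrow> nat \<times> nat) \<Rightarrow> nat \<times> nat \<Rightarrow> nat" where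
  "rg_V n al outer = card (perm_orbits (sigma0 n al outer) {1..2*n})"

text \<open>Face permutation of the spanning subgraph with edge set Q: sigma0 on half-edges of edges not
  in Q, and sigma2^{-1} = sigma0 o sigma1 on half-edges of edges in Q.  Faces of Q = its orbits.\<close>
definition qt_sigma :: "nat \<Rightarrow> (nat \<times> nat \<Rightarrow> nat \<times> nat) \<Rightarrow> nat \<times> nat \<Rightarrow> nat set \<Rightarrow> nat \<Rightarrow> nat" where
  "qt_sigma n al outer Q j =
     (if (j + 1) div 2 \<in> Q then sigma0 n al outer (sigma1 j) else sigma0 n al outer j)"

definition quasi_tree :: "nat \<Rightarrow> (nat \<times> nat \<Rightarrow> nat \<times> nat) \<Rightarrow> nat \<times> nat \<Rightarrow> nat set \<Rightarrow> bool" where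
  "quasi_tree n al outer Q \<longleftrightarrow> Q \<subseteq> {1..n}
     \<and> card (perm_orbits (qt_sigma n al outer Q) {1..2*n}) = 1"

definition chord_pos :: "nat \<Rightarrow> (nat \<times> nat \<Rightarrow> nat \<times> nat) \<Rightarrow> nat \<times> nat \<Rightarrow> nat set \<Rightarrow> nat \<Rightarrow> nat" where
  "chord_pos n al outer Q j = (LEAST k. (qt_sigma n al outer Q ^^ k) 1 = j)"

definition chords_intersect :: "nat \<Rightarrow> (nat \<times> nat \<Rightarrow> nat \<times> nat) \<Rightarrow> nat \<times> nat \<Rightarrow> nat set \<Rightarrow> nat \<Rightarrow> nat \<Rightarrow> bool" where
  "chords_intersect n al outer Q a b \<longleftrightarrow>
     (let p = chord_pos n al outer Q;
          lo = min (p (2*a - 1)) (p (2*a)); hi = max (p (2*a - 1)) (p (2*a))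
      in (lo < p (2*b - 1) \<and> p (2*b - 1) < hi) \<noteq> (lo < p (2*b) \<and> p (2*b) < hi))"

definition live :: "nat \<Rightarrow> (nat \<times> nat \<Rightarrow> nat \<times> nat) \<Rightarrow> nat \<times> nat \<Rightarrow> nat set \<Rightarrow> nat \<Rightarrow> bool" where
  "live n al outer Q i \<longleftrightarrow> (\<forall>k\<in>{1..<i}. \<not> chords_intersect n al outer Q k i)"

definition qt_u :: "nat \<Rightarrow> (nat \<times> nat \<Rightarrow> nat \<times> nat) \<Rightarrow> nat \<times> nat \<Rightarrow> nat set \<Rightarrow> int" where
  "qt_u n al outer Q = int (card {i \<in> {1..n}. live n al outer Q i \<and> i \<notin> Q})
                     - int (card {i \<in> {1..n}. live n al outer Q i \<and> i \<in> Q})"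

definition qt_genus :: "nat \<Rightarrow> (nat \<times> nat \<Rightarrow> nat \<times> nat) \<Rightarrow> nat \<times> nat \<Rightarrow> nat set \<Rightarrow> real" where
  "qt_genus n al outer Q = (1 - real (rg_V n al outer) + real (card Q)) / 2"

definition qt_v :: "nat \<Rightarrow> (nat \<times> nat \<Rightarrow> nat \<times> nat) \<Rightarrow> nat \<times> nat \<Rightarrow> nat set \<Rightarrow> real" where
  "qt_v n al outer Q = - qt_genus n al outer Q"

definition qt_gens :: "nat \<Rightarrow> (nat \<times> nat \<Rightarrow> nat \<times> nat) \<Rightarrow> nat \<times> nat \<Rightarrow> nat set set" where
  "qt_gens n al outer = {Q. quasi_tree n al outer Q}"

definition qt_deg :: "nat \<Rightarrow> (nat \<times> nat \<Rightarrow> nat \<times> nat) \<Rightarrow> nat \<times> nat \<Rightarrow> nat set \<Rightarrow> int \<times> real" where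
  "qt_deg n al outer Q = (qt_u n al outer Q, qt_v n al outer Q)"

definition cx_chains :: "'g set \<Rightarrow> ('g \<Rightarrow> 'k) \<Rightarrow> 'k \<Rightarrow> ('g \<Rightarrow> int) set" where
  "cx_chains G deg k = {f. \<forall>x. f x \<noteq> 0 \<longrightarrow> x \<in> G \<and> deg x = k}"

definition cx_group :: "'g set \<Rightarrow> ('g \<Rightarrow> 'k) \<Rightarrow> 'k \<Rightarrow> ('g \<Rightarrow> int) monoid" where
  "cx_group G deg k = \<lparr>carrier = cx_chains G deg k, mult = (\<lambda>f h x. f x + h x), one = (\<lambda>x. 0)\<rparr>"

definition mat_apply :: "'g set \<Rightarrow> ('g \<Rightarrow> 'h \<Rightarrow> int) \<Rightarrow> ('g \<Rightarrow> int) \<Rightarrow> 'h \<Rightarrow> int" where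
  "mat_apply G M f = (\<lambda>y. \<Sum>x\<in>G. f x * M x y)"

definition mat_comp :: "'h set \<Rightarrow> ('g \<Rightarrow> 'h \<Rightarrow> int) \<Rightarrow> ('h \<Rightarrow> 'l \<Rightarrow> int) \<Rightarrow> 'g \<Rightarrow> 'l \<Rightarrow> int" where
  "mat_comp H M N = (\<lambda>x z. \<Sum>y\<in>H. M x y * N y z)"

definition cx_homology :: "'g set \<Rightarrow> ('g \<Rightarrow> 'k) \<Rightarrow> ('g \<Rightarrow> 'g \<Rightarrow> int) \<Rightarrow> 'k \<Rightarrow> 'k \<Rightarrow> ('g \<Rightarrow> int) set monoid" where
  "cx_homology G deg d k kp =
     (cx_group G deg k)\<lparr>carrier := {f \<in> cx_chains G deg k. mat_apply G d f = (\<lambda>y. 0)}\<rparr>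
       Mod (mat_apply G d ` cx_chains G deg kp)"

definition deformation_retract ::
  "'a set \<Rightarrow> ('a \<Rightarrow> 'k) \<Rightarrow> ('a \<Rightarrow> 'a \<Rightarrow> int) \<Rightarrow> ('k \<Rightarrow> 'k) \<Rightarrow>
   'b set \<Rightarrow> ('b \<Rightarrow> 'l) \<Rightarrow> ('b \<Rightarrow> 'b \<Rightarrow> int) \<Rightarrow> ('k \<Rightarrow> 'l) \<Rightarrow> bool" where
  "deformation_retract GK degK dK hdown GC degC dC phi \<longleftrightarrow>
    (\<exists>f g h.
       (\<forall>x y. f x y \<noteq> 0 \<longrightarrow> x \<in> GK \<and> y \<in> GC \<and> degC y = phi (degK x))
     \<and> (\<forall>y x. g y x \<noteq> 0 \<longrightarrow> y \<in> GC \<and> x \<in> GK \<and> degC y = phi (degK x))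
     \<and> (\<forall>x x'. h x x' \<noteq> 0 \<longrightarrow> x \<in> GK \<and> x' \<in> GK \<and> degK x' = hdown (degK x))
     \<and> (\<forall>x\<in>GK. \<forall>y\<in>GC. mat_comp GK dK f x y = mat_comp GC f dC x y)
     \<and> (\<forall>y\<in>GC. \<forall>x\<in>GK. mat_comp GC dC g y x = mat_comp GK g dK y x)
     \<and> (\<forall>y\<in>GC. \<forall>y'\<in>GC. mat_comp GK g f y y' = of_bool (y = y'))
     \<and> (\<forall>x\<in>GK. \<forall>x'\<in>GK. mat_comp GC f g x x' - of_bool (x = x')
            = mat_comp GK dK h x x' + mat_comp GK h dK x x'))"

end

theory Submission
  imports Defs "HOL-Library.Function_Algebras"
begin

text \<open>
  The circles of a state form a partition of the darts, and changing one smoothing merges two blocks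
  or splits one: a planar diagram has a checkerboard colouring by Euler's formula, so the states are
  the cycles of permutations that differ by a transposition. The retraction uses this property only.

  Resolve the crossings in the order \<open>n, \<dots>, 1\<close>, but leave a crossing unresolved if one of its two
  smoothings would disconnect the diagram. The leaves of this resolution are the quasi-trees, and the
  crossings left open at a quasi-tree are its live chords, which do not cross each other. The enhanced
  states at a leaf therefore form the Khovanov complex of an iterated kink; eliminating one outermost
  kink after the other, as for the first Reidemeister move, leaves a single generator. Each resolved
  crossing presents the complex as a mapping cone, and strong deformation retracts of the two sides
  of a cone glue to a retract of the cone.
\<close>

section \<open>Integer matrices and strong deformation retracts\<close>

text \<open>The order of resolution is what turns the unresolved crossings into the live ones: when
  \<open>i\<close> is treated, exactly the crossings below \<open>i\<close> still hold the diagram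
  together, so switching \<open>i\<close> in a quasi-tree disconnects it precisely if no lower chord
  crosses chord \<open>i\<close>. Cancelling generators normally adds zigzag terms to the
  differential, and these would have to be carried through all later cancellations. At a kink they
  vanish: no other open crossing meets an outermost kink circle, so no other edge map can give it
  the label x. What remains is again a block of the original differential, and the next kink is
  removed from the same description. Since only the units 1 and -1 are cancelled, the signs of the
  cube matter solely for \<open>d d = 0\<close>. The cones, in contrast, do create differentials
  between different quasi-trees. These are never computed: their degrees are forced by the
  retraction, and that their square is zero follows formally from the equations of a
  retract.\<close>

definition idm :: "'g set \<Rightarrow> 'g \<Rightarrow> 'g \<Rightarrow> int" where
  "idm A x y = of_bool (x = y \<and> x \<in> A)"

definition mat_on :: "'g set \<Rightarrow> 'h set \<Rightarrow> ('g \<Rightarrow> 'h \<Rightarrow> int) \<Rightarrow> bool" where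
  "mat_on A B M \<longleftrightarrow> (\<forall>x y. M x y \<noteq> 0 \<longrightarrow> x \<in> A \<and> y \<in> B)"

definition blk :: "'g set \<Rightarrow> 'h set \<Rightarrow> ('g \<Rightarrow> 'h \<Rightarrow> int) \<Rightarrow> 'g \<Rightarrow> 'h \<Rightarrow> int" where
  "blk A B M x y = (if x \<in> A \<and> y \<in> B then M x y else 0)"

lemma mat_onD: "mat_on A B M \<Longrightarrow> x \<notin> A \<or> y \<notin> B \<Longrightarrow> M x y = 0"
  by (auto simp: mat_on_def)

lemma mat_on_mono: "mat_on A B M \<Longrightarrow> A \<subseteq> A' \<Longrightarrow> B \<subseteq> B' \<Longrightarrow> mat_on A' B' M"
  by (auto simp: mat_on_def)

lemma mat_on_blk: "mat_on A B (blk A B M)"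
  by (auto simp: mat_on_def blk_def)

lemma mat_on_idm: "mat_on A A (idm A)"
  by (auto simp: mat_on_def idm_def)

lemma mat_on_add: "mat_on A B M \<Longrightarrow> mat_on A B N \<Longrightarrow> mat_on A B (M + N)"
  unfolding mat_on_def plus_fun_def by (metis add_0_right)

lemma mat_on_mc:
  assumes "mat_on A B M" "mat_on B' C N" shows "mat_on A C (mat_comp H M N)"
proof -
  have "x \<in> A \<and> z \<in> C" if nz: "(\<Sum>y\<in>H. M x y * N y z) \<noteq> 0" for x z
  proof -
    obtain y where "M x y * N y z \<noteq> 0" using sum.not_neutral_contains_not_neutral[OF nz] by blast
    then show ?thesis using assms by (auto simp: mat_on_def)
  qed
  then show ?thesis by (simp add: mat_on_def mat_comp_def)
qed

lemma mc_nonzeroE: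
  assumes "mat_comp H M N x z \<noteq> 0"
  obtains y where "y \<in> H" "M x y \<noteq> 0" "N y z \<noteq> 0"
  using sum.not_neutral_contains_not_neutral[OF assms[unfolded mat_comp_def]] that by fastforce

lemma mc_assoc: "mat_comp K (mat_comp H A B) C = mat_comp H A (mat_comp K B C)"
  unfolding mat_comp_def
  by (intro ext) (simp add: sum_distrib_left sum_distrib_right mult.assoc sum.swap[of _ H K])

text \<open>Rewriting with \<open>mc_assoc\<close> brackets products to the right. A rule for a
  product of two factors then misses that product when a further factor follows; this form covers
  that case.\<close>

lemma mc_assoc_eq: "mat_comp H M N = R \<Longrightarrow> mat_comp H M (mat_comp K N X) = mat_comp K R X"
  by (simp add: mc_assoc[symmetric])

lemma mc_add_left: "mat_comp H (A + B) C = mat_comp H A C + mat_comp H B C"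
  by (intro ext) (simp add: mat_comp_def algebra_simps sum.distrib)
lemma mc_add_right: "mat_comp H A (B + C) = mat_comp H A B + mat_comp H A C"
  by (intro ext) (simp add: mat_comp_def algebra_simps sum.distrib)
lemma mc_minus_left: "mat_comp H (- A) C = - mat_comp H A C"
  by (intro ext) (simp add: mat_comp_def sum_negf)
lemma mc_minus_right: "mat_comp H A (- C) = - mat_comp H A C"
  by (intro ext) (simp add: mat_comp_def sum_negf)
lemma mc_zero_left [simp]: "mat_comp H 0 C = 0"
  by (intro ext) (simp add: mat_comp_def)
lemma mc_zero_right [simp]: "mat_comp H C 0 = 0"
  by (intro ext) (simp add: mat_comp_def)

lemma mc_diff_left: "mat_comp H (A - B) C = mat_comp H A C - mat_comp H B C"
  by (intro ext) (simp add: mat_comp_def algebra_simps sum_subtractf)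
lemma mc_diff_right: "mat_comp H A (B - C) = mat_comp H A B - mat_comp H A C"
  by (intro ext) (simp add: mat_comp_def algebra_simps sum_subtractf)

lemmas mc_bilin = mc_diff_left mc_diff_right mc_add_left mc_add_right mc_minus_left mc_minus_right

lemma mc_id_left: "finite H \<Longrightarrow> B \<subseteq> H \<Longrightarrow> mat_comp H (idm B) M x y = (if x \<in> B then M x y else 0)"
  unfolding mat_comp_def idm_def
  by (subst sum.mono_neutral_right[of _ "{x} \<inter> B"]) auto

lemma mc_id_right: "finite H \<Longrightarrow> B \<subseteq> H \<Longrightarrow> mat_comp H M (idm B) x y = (if y \<in> B then M x y else 0)"
  unfolding mat_comp_def idm_def
  by (subst sum.mono_neutral_right[of _ "{y} \<inter> B"]) auto

lemma mc_id_on_left: "finite H \<Longrightarrow> mat_on A B M \<Longrightarrow> A \<subseteq> H \<Longrightarrow> mat_comp H (idm A) M = M"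
  by (intro ext) (auto simp: mc_id_left mat_on_def)
lemma mc_id_on_right: "finite H \<Longrightarrow> mat_on A B M \<Longrightarrow> B \<subseteq> H \<Longrightarrow> mat_comp H M (idm B) = M"
  by (intro ext) (auto simp: mc_id_right mat_on_def)

lemma mc_id_left': "finite H \<Longrightarrow> mat_on A B M \<Longrightarrow> A \<subseteq> H \<Longrightarrow> mat_comp H (idm H) M = M"
  by (intro ext) (auto simp: mc_id_left mat_on_def)
lemma mc_id_right': "finite H \<Longrightarrow> mat_on A B M \<Longrightarrow> B \<subseteq> H \<Longrightarrow> mat_comp H M (idm H) = M"
  by (intro ext) (auto simp: mc_id_right mat_on_def)

lemma mc_disjoint: "mat_on A B M \<Longrightarrow> mat_on B' C N \<Longrightarrow> B \<inter> B' = {} \<Longrightarrow> mat_comp H M N = 0"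
proof (intro ext)
  fix x z assume *: "mat_on A B M" "mat_on B' C N" "B \<inter> B' = {}"
  have "M x y * N y z = 0" for y
    using mat_onD[OF *(1), of x y] mat_onD[OF *(2), of y z] *(3) by (cases "y \<in> B") auto
  then show "mat_comp H M N x z = 0 x z" by (simp add: mat_comp_def del: mult_eq_0_iff)
qed

lemma mc_shrink_right: "finite H \<Longrightarrow> A \<subseteq> H \<Longrightarrow> mat_on A B N \<Longrightarrow> mat_comp H M N = mat_comp A M N"
  unfolding mat_comp_def by (intro ext sum.mono_neutral_right) (auto simp: mat_on_def)
lemma mc_shrink_left: "finite H \<Longrightarrow> B \<subseteq> H \<Longrightarrow> mat_on A B M \<Longrightarrow> mat_comp H M N = mat_comp B M N"
  unfolding mat_comp_def by (intro ext sum.mono_neutral_right) (auto simp: mat_on_def)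

text \<open>\<open>d x y\<close> is the coefficient of \<open>y\<close> in the image of
  \<open>x\<close>. Matrices thus act on row vectors, and \<open>mat_comp\<close> composes from left
  to right. The degree is the pair of homological and quantum degree.\<close>

definition complex :: "'g set \<Rightarrow> ('g \<Rightarrow> int \<times> int) \<Rightarrow> ('g \<Rightarrow> 'g \<Rightarrow> int) \<Rightarrow> bool" where
  "complex G dg d \<longleftrightarrow> finite G \<and> mat_on G G d
     \<and> (\<forall>x y. d x y \<noteq> 0 \<longrightarrow> dg y = (fst (dg x) + 1, snd (dg x)))
     \<and> mat_comp G d d = 0"

text \<open>The last three equations are the side conditions that make gluing along a cone work.\<close>
definition sdr_by where
  "sdr_by G dg d C dc e f g h \<longleftrightarrow>
     mat_on G C f \<and> (\<forall>x y. f x y \<noteq> 0 \<longrightarrow> dc y = dg x)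
   \<and> mat_on C G g \<and> (\<forall>y x. g y x \<noteq> 0 \<longrightarrow> dc y = dg x)
   \<and> mat_on G G h \<and> (\<forall>x y. h x y \<noteq> 0 \<longrightarrow> dg x = (fst (dg y) + (1::int), snd (dg y) :: int))
   \<and> mat_on C C e
   \<and> mat_comp G d f = mat_comp C f e
   \<and> mat_comp C e g = mat_comp G g d
   \<and> mat_comp G g f = idm C
   \<and> mat_comp C f g = idm G + mat_comp G d h + mat_comp G h d
   \<and> mat_comp G g h = 0 \<and> mat_comp G h f = 0 \<and> mat_comp G h h = 0"

definition sdr where "sdr G dg d C dc e \<longleftrightarrow> (\<exists>f g h. sdr_by G dg d C dc e f g h)"

text \<open>This is the perturbation lemma for the off-diagonal block \<open>ph\<close> from
  \<open>GA\<close> to \<open>GB\<close>. A path can use \<open>ph\<close> only once, so every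
  perturbation series stops after its first correction term.\<close>

lemma sdr_cone:
  assumes fin: "finite GA" "finite GB" "finite CA" "finite CB"
    and dis: "GA \<inter> GB = {}" "CA \<inter> CB = {}"
    and cx: "complex (GA \<union> GB) dg d" and tri: "\<And>x y. x \<in> GB \<Longrightarrow> y \<in> GA \<Longrightarrow> d x y = 0"
    and A: "sdr GA dg (blk GA GA d) CA dc eA" and B: "sdr GB dg (blk GB GB d) CB dc eB"
  shows "\<exists>e. sdr (GA \<union> GB) dg d (CA \<union> CB) dc e"
proof -
  define G where "G = GA \<union> GB"
  define C where "C = CA \<union> CB"
  define dA where "dA = blk GA GA d"
  define dB where "dB = blk GB GB d"
  define ph where "ph = blk GA GB d"
  have fG: "finite G" and fC: "finite C" by (auto simp: G_def C_def fin)
  have sub: "GA \<subseteq> G" "GB \<subseteq> G" "CA \<subseteq> C" "CB \<subseteq> C" by (auto simp: G_def C_def)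
  obtain fA gA hA where A': "sdr_by GA dg dA CA dc eA fA gA hA" using A by (auto simp: sdr_def dA_def)
  obtain fB gB hB where B': "sdr_by GB dg dB CB dc eB fB gB hB" using B by (auto simp: sdr_def dB_def)
  note A' = A'[unfolded sdr_by_def] and B' = B'[unfolded sdr_by_def]
  have onA: "mat_on GA CA fA" "mat_on CA GA gA" "mat_on GA GA hA" "mat_on CA CA eA" "mat_on GA GA dA"
    using A' by (auto simp: dA_def mat_on_blk)
  have onB: "mat_on GB CB fB" "mat_on CB GB gB" "mat_on GB GB hB" "mat_on CB CB eB" "mat_on GB GB dB"
    using B' by (auto simp: dB_def mat_on_blk)
  have onp: "mat_on GA GB ph" by (simp add: ph_def mat_on_blk)
  have dG: "mat_on G G d" and degd: "\<And>x y. d x y \<noteq> 0 \<Longrightarrow> dg y = (fst (dg x) + 1, snd (dg x))"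
    and dd: "mat_comp G d d = 0"
    using cx by (auto simp: complex_def G_def)
  have deq: "d = dA + dB + ph"
    using mat_onD[OF dG] dis(1) tri
    by (intro ext) (simp add: dA_def dB_def ph_def blk_def G_def disjoint_iff, metis)
  have degA: "fA x y \<noteq> 0 \<Longrightarrow> dc y = dg x" "gA y x \<noteq> 0 \<Longrightarrow> dc y = dg x" for x y using A' by blast+
  have degB: "fB x y \<noteq> 0 \<Longrightarrow> dc y = dg x" "gB y x \<noteq> 0 \<Longrightarrow> dc y = dg x" for x y using B' by blast+
  have degh: "hA x z \<noteq> 0 \<Longrightarrow> dg x = (fst (dg z) + 1, snd (dg z))"
    "hB x z \<noteq> 0 \<Longrightarrow> dg x = (fst (dg z) + 1, snd (dg z))" for x z using A' B' by blast+
  have degp: "ph x z \<noteq> 0 \<Longrightarrow> dg z = (fst (dg x) + 1, snd (dg x))" for x z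
    using degd by (auto simp: ph_def blk_def split: if_splits)
  let ?G = "mat_comp G" and ?C = "mat_comp C"
  have zeros: "?G dA dB = 0" "?G dA fB = 0" "?G dA hB = 0" "?G gA dB = 0" "?G gA fB = 0" "?G gA hB = 0" "?G hA dB = 0" "?G hA fB = 0" "?G hA hB = 0" "?C fA gB = 0" "?C fA eB = 0" "?C eA gB = 0" "?C eA eB = 0" "?G dB dA = 0" "?G dB fA = 0" "?G dB hA = 0" "?G dB ph = 0" "?G gB dA = 0" "?G gB fA = 0" "?G gB hA = 0" "?G gB ph = 0" "?G hB dA = 0" "?G hB fA = 0" "?G hB hA = 0" "?G hB ph = 0" "?G ph dA = 0" "?G ph fA = 0" "?G ph hA = 0" "?G ph ph = 0" "?C fB gA = 0" "?C fB eA = 0" "?C eB gA = 0" "?C eB eA = 0"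
    by ((rule mc_disjoint, (rule onA onB onp)+, use dis in blast)+)
  have GA: "mat_comp GA dA M = ?G dA M" "mat_comp GA gA M = ?G gA M" "mat_comp GA hA M = ?G hA M" for M :: "'a \<Rightarrow> 'z \<Rightarrow> int"
    by (simp_all add: mc_shrink_left[OF fG sub(1) onA(5)] mc_shrink_left[OF fG sub(1) onA(2)] mc_shrink_left[OF fG sub(1) onA(3)])
  have CA: "mat_comp CA fA M = ?C fA M" "mat_comp CA eA M = ?C eA M" for M :: "'b \<Rightarrow> 'z \<Rightarrow> int"
    by (simp_all add: mc_shrink_left[OF fC sub(3) onA(1)] mc_shrink_left[OF fC sub(3) onA(4)])
  have RA: "?G dA fA = ?C fA eA" "?C eA gA = ?G gA dA" "?G gA fA = idm CA"
    "?C fA gA = idm GA + ?G dA hA + ?G hA dA" "?G gA hA = 0" "?G hA fA = 0" "?G hA hA = 0"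
    using A' by (auto simp: GA CA)
  have GB: "mat_comp GB dB M = ?G dB M" "mat_comp GB gB M = ?G gB M" "mat_comp GB hB M = ?G hB M" for M :: "'a \<Rightarrow> 'z \<Rightarrow> int"
    by (simp_all add: mc_shrink_left[OF fG sub(2) onB(5)] mc_shrink_left[OF fG sub(2) onB(2)] mc_shrink_left[OF fG sub(2) onB(3)])
  have CB: "mat_comp CB fB M = ?C fB M" "mat_comp CB eB M = ?C eB M" for M :: "'b \<Rightarrow> 'z \<Rightarrow> int"
    by (simp_all add: mc_shrink_left[OF fC sub(4) onB(1)] mc_shrink_left[OF fC sub(4) onB(4)])
  have RB: "?G dB fB = ?C fB eB" "?C eB gB = ?G gB dB" "?G gB fB = idm CB"
    "?C fB gB = idm GB + ?G dB hB + ?G hB dB" "?G gB hB = 0" "?G hB fB = 0" "?G hB hB = 0"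
    using B' by (auto simp: GB CB)
  \<comment> \<open>The blocks of \<open>d d = 0\<close>: both diagonal blocks are differentials,
    and \<open>ph\<close> anticommutes with them.\<close>
  have dd0: "?G dA dA + ?G dB dB + (?G dA ph + ?G ph dB) = 0"
    using dd unfolding deq by (simp add: mc_bilin zeros algebra_simps)
  have onx: "mat_on GA GA (?G dA dA)" "mat_on GB GB (?G dB dB)" "mat_on GA GB (?G dA ph)" "mat_on GA GB (?G ph dB)"
    by (rule mat_on_mc, (rule onA onB onp)+)+
  have dd1: "?G dA dA x y + ?G dB dB x y + (?G dA ph x y + ?G ph dB x y) = 0" for x y
    using fun_cong[OF fun_cong[OF dd0, of x], of y] by simp
  have "?G dA dA x y = 0 \<and> ?G dB dB x y = 0 \<and> ?G dA ph x y = - ?G ph dB x y" for x y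
    using dd1[of x y] onx[THEN mat_onD, of x y] dis(1) by (cases "x \<in> GA"; cases "y \<in> GA") force+
  then have Rd: "?G dA dA = 0" "?G dB dB = 0" "?G dA ph = - ?G ph dB"
    by (auto intro!: ext)
  have ids: "?G (idm GA) ph = ph" "?G ph (idm GB) = ph" "?C (idm CA) gA = gA" "?C (idm CB) gB = gB"
     "?G (idm GA) fA = fA" "?G (idm GB) fB = fB"
    by (rule mc_id_on_left mc_id_on_right, rule fG fC, rule onp onA onB, rule sub)+
  \<comment> \<open>Each correction runs through the \<open>A\<close> side (\<open>gA\<close> or
    \<open>hA\<close>), crosses once by \<open>ph\<close>, and leaves through the \<open>B\<close>
    side (\<open>fB\<close> or \<open>hB\<close>). All signs are positive because the homotopy
    relation reads \<open>f g = id + d h + h d\<close>.\<close>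
  define e where "e = eA + eB + ?G gA (?G ph fB)"
  define f where "f = fA + fB + ?G hA (?G ph fB)"
  define g where "g = gA + gB + ?G gA (?G ph hB)"
  define h where "h = hA + hB + ?G hA (?G ph hB)"
  note rules = mc_bilin mc_assoc zeros zeros[THEN mc_assoc_eq] RA RA[THEN mc_assoc_eq] RB RB[THEN mc_assoc_eq] Rd Rd[THEN mc_assoc_eq] ids ids[THEN mc_assoc_eq]
  have idG: "idm G = idm GA + idm GB" and idC: "idm C = idm CA + idm CB"
    using dis by (auto simp: idm_def G_def C_def intro!: ext)
  have "?G d f = ?C f e" by (simp add: deq e_def f_def rules)
  moreover have "?C e g = ?G g d" by (simp add: deq e_def g_def rules)
  moreover have "?G g f = idm C" by (simp add: f_def g_def idC rules)
  moreover have "?C f g = idm G + ?G d h + ?G h d" by (simp add: deq f_def g_def h_def idG rules)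
  moreover have "?G g h = 0" "?G h f = 0" "?G h h = 0" by (simp_all add: f_def g_def h_def rules)
  moreover have "mat_on G C f" "mat_on C G g" "mat_on G G h" "mat_on C C e"
    unfolding f_def g_def h_def e_def using onA onB onp sub
    by (intro mat_on_add; blast intro: mat_on_mono mat_on_mc)+
  moreover have "dc y = dg x" if nz: "f x y \<noteq> 0" for x y
  proof -
    have "fA x y \<noteq> 0 \<or> fB x y \<noteq> 0 \<or> ?G hA (?G ph fB) x y \<noteq> 0"
      using nz by (auto simp: f_def)
    then show ?thesis by (elim disjE mc_nonzeroE) (auto dest!: degA degB degh degp simp: prod_eq_iff)
  qed
  moreover have "dc y = dg x" if nz: "g y x \<noteq> 0" for x y
  proof -
    have "gA y x \<noteq> 0 \<or> gB y x \<noteq> 0 \<or> ?G gA (?G ph hB) y x \<noteq> 0"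
      using nz by (auto simp: g_def)
    then show ?thesis by (elim disjE mc_nonzeroE) (auto dest!: degA degB degh degp simp: prod_eq_iff)
  qed
  moreover have "dg x = (fst (dg y) + 1, snd (dg y))" if nz: "h x y \<noteq> 0" for x y
  proof -
    have "hA x y \<noteq> 0 \<or> hB x y \<noteq> 0 \<or> ?G hA (?G ph hB) x y \<noteq> 0"
      using nz by (auto simp: h_def)
    then show ?thesis by (elim disjE mc_nonzeroE) (auto dest!: degh degp simp: prod_eq_iff)
  qed
  ultimately have "sdr_by G dg d C dc e f g h" unfolding sdr_by_def by blast
  then show ?thesis unfolding sdr_def G_def C_def by blast
qed


text \<open>Since \<open>g f\<close> is the identity, \<open>e\<close> equals \<open>g d f\<close>,
  and \<open>e e\<close> becomes \<open>g d d f\<close>.\<close>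

lemma complex_target:
  assumes cx: "complex G dg d" and C: "finite C" and s: "sdr G dg d C dc e"
  shows "complex C dc e"
proof -
  obtain f g h where s: "sdr_by G dg d C dc e f g h" using s by (auto simp: sdr_def)
  note s = s[unfolded sdr_by_def]
  have e: "e = mat_comp G g (mat_comp G d f)"
  proof -
    have "mat_comp G g (mat_comp G d f) = mat_comp G g (mat_comp C f e)"
      using s by simp
    also have "\<dots> = mat_comp C (mat_comp G g f) e" by (simp only: mc_assoc)
    also have "\<dots> = e" using s C by (simp add: mc_id_on_left[of C C C e])
    finally show ?thesis ..
  qed
  have "mat_comp C e e = mat_comp G (mat_comp C e g) (mat_comp G d f)"
    by (subst (2) e) (simp add: mc_assoc)
  also have "\<dots> = mat_comp G g (mat_comp G (mat_comp G d d) f)"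
    using s by (simp add: mc_assoc)
  also have "\<dots> = 0" using cx by (simp add: complex_def)
  finally have ee: "mat_comp C e e = 0" .
  have "dc y = (fst (dc x) + 1, snd (dc x))" if nz: "e x y \<noteq> 0" for x y
  proof -
    obtain u v where "g x u \<noteq> 0" "d u v \<noteq> 0" "f v y \<noteq> 0"
      using nz unfolding e by (auto elim!: mc_nonzeroE)
    then show ?thesis using s cx by (auto simp: complex_def)
  qed
  with ee s C show ?thesis by (simp add: complex_def)
qed

text \<open>Gaussian elimination of an invertible block from \<open>P\<close> to \<open>R\<close>.
  The induced differential on \<open>C\<close> is \<open>d\<close> minus the zigzag from
  \<open>C\<close> to \<open>R\<close>, back to \<open>P\<close> and on to \<open>C\<close>; the
  last hypothesis removes the zigzag.\<close>

lemma sdr_eliminate: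
  assumes cx: "complex G dg d" and G: "G = P \<union> R \<union> C"
    and dis: "P \<inter> R = {}" "P \<inter> C = {}" "R \<inter> C = {}"
    and bij: "bij_betw \<pi> P R"
    and off: "\<And>p r. p \<in> P \<Longrightarrow> r \<in> R \<Longrightarrow> r \<noteq> \<pi> p \<Longrightarrow> d p r = 0"
    and unit: "\<And>p. p \<in> P \<Longrightarrow> \<bar>d p (\<pi> p)\<bar> = 1"
    and no_zigzag: "(\<forall>c\<in>C. \<forall>r\<in>R. d c r = 0) \<or> (\<forall>p\<in>P. \<forall>c\<in>C. d p c = 0)"
  shows "sdr G dg d C dg (blk C C d)"
proof -
  \<comment> \<open>The inverse of the block from \<open>P\<close> to \<open>R\<close>. Its entries
    are 1 or -1 and hence their own inverses, so \<open>d p r\<close> itself is reused.\<close>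
  define io where "io r p = (if p \<in> P \<and> r = \<pi> p then d p r else 0)" for r p
  let ?G = "mat_comp G" and ?C = "mat_comp C"
  have fG: "finite G" and dG: "mat_on G G d" and dd: "?G d d = 0"
    and degd: "\<And>x y. d x y \<noteq> 0 \<Longrightarrow> dg y = (fst (dg x) + 1, snd (dg x))"
    using cx by (auto simp: complex_def)
  have sub: "P \<subseteq> G" "R \<subseteq> G" "C \<subseteq> G" by (auto simp: G)
  have pi: "\<And>p. p \<in> P \<Longrightarrow> \<pi> p \<in> R" and inj: "inj_on \<pi> P" and sur: "\<pi> ` P = R"
    using bij by (auto simp: bij_betw_def)
  have iR: "mat_on R P io" using pi by (auto simp: mat_on_def io_def)
  have iG: "mat_on G G io" by (rule mat_on_mono[OF iR]) (auto simp: G)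
  have sq: "d p (\<pi> p) * d p (\<pi> p) = 1" if "p \<in> P" for p
    using unit[OF that] by (metis abs_mult_self_eq mult_1)
  have Pdi: "?G (idm P) (?G d io) = idm P"
  proof (intro ext)
    fix p p'
    have "?G d io p p' = (if p' \<in> P then d p (\<pi> p') * d p' (\<pi> p') else 0)"
      unfolding mat_comp_def io_def using pi sub fG
      by (cases "p' \<in> P") (auto simp: if_distrib[of "\<lambda>t. _ * t"] cong: if_cong)
    then show "?G (idm P) (?G d io) p p' = idm P p p'"
      using off[of p "\<pi> p'"] pi[of p'] inj sq by (auto simp: mc_id_left fG sub idm_def inj_on_def)
  qed
  have idR: "?G io (?G d (idm R)) = idm R"
  proof (intro ext)
    fix r r'
    have *: "?G d (idm R) = blk UNIV R d"
      by (intro ext) (auto simp: mc_id_right fG sub blk_def)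
    show "?G io (?G d (idm R)) r r' = idm R r r'"
    proof (cases "r \<in> R")
      case True
      then obtain p where p: "p \<in> P" "r = \<pi> p" using sur by auto
      have "io r y = (if y = p then d p r else 0)" for y
        using p inj by (auto simp: io_def inj_on_def)
      then have "?G io (blk UNIV R d) r r' = d p r * blk UNIV R d p r'"
        unfolding mat_comp_def using p sub fG by (auto simp: if_distrib[of "\<lambda>t. t * _"] cong: if_cong)
      also have "\<dots> = idm R r r'" using p off[of p r'] sq[of p] pi[of p] by (auto simp: blk_def idm_def)
      finally show ?thesis unfolding * .
    next
      case False
      then show ?thesis using mat_onD[OF iR] by (auto simp: mat_comp_def idm_def)
    qed
  qed
  have ii: "?G io io = 0" by (rule mc_disjoint[OF iR iR]) (use dis in auto)
  have Pi: "?G (idm P) io = 0" by (rule mc_disjoint[OF mat_on_idm iR]) (use dis in auto)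
  have iRz: "?G io (idm R) = 0" by (rule mc_disjoint[OF iR mat_on_idm]) (use dis in auto)
  have Ci: "?G io (idm C) = 0" by (rule mc_disjoint[OF iR mat_on_idm]) (use dis in auto)
  have iP: "?G io (idm P) = io" by (rule mc_id_on_right[OF fG iR sub(1)])
  have idi: "?G io (?G d io) = io"
    by (metis Pdi iP mc_assoc)
  have idi': "?G io (?G d (?G io X)) = ?G io X" for X :: "'a \<Rightarrow> 'a \<Rightarrow> int"
    by (metis idi mc_assoc)
  have idGd: "?G (idm G) d = d" "?G d (idm G) = d" "?G (idm G) io = io" "?G io (idm G) = io" "?G (idm G) (idm G) = idm G"
    by (rule mc_id_left' mc_id_right', rule fG, rule dG iG mat_on_idm, rule order_refl)+
  have idC: "?G (idm C) (idm C) = idm C" "?G (idm G) (idm C) = idm C" "?G (idm C) (idm G) = idm C"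
    by (auto simp: mc_id_left fG sub idm_def intro!: ext) (use sub in auto)
  \<comment> \<open>\<open>q\<close> is the idempotent chain map that splits off the contractible
    part. The equations \<open>Pq\<close> and \<open>qR\<close> below say that it factors through
    \<open>C\<close>.\<close>
  define q where "q = idm G - ?G d io - ?G io d"
  note rules = mc_bilin mc_assoc dd dd[THEN mc_assoc_eq] ii ii[THEN mc_assoc_eq] idi idi' idGd idGd[THEN mc_assoc_eq]
  have qq: "?G q q = q" by (simp add: q_def rules)
  have qd: "?G q d = ?G d q" by (simp add: q_def rules)
  have Pq: "?G (idm P) q = 0"
  proof -
    have "?G (idm P) (idm G) = idm P" by (rule mc_id_right'[OF fG mat_on_idm sub(1)])
    then show ?thesis by (simp add: q_def mc_bilin Pdi Pi[THEN mc_assoc_eq])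
  qed
  have qR: "?G q (idm R) = 0"
  proof -
    have "?G (idm G) (idm R) = idm R" by (rule mc_id_left'[OF fG mat_on_idm sub(2)])
    then show ?thesis by (simp add: q_def mc_bilin mc_assoc idR iRz)
  qed
  define f where "f = ?G q (idm C)"
  define g where "g = ?G (idm C) q"
  have idG: "idm G = idm P + idm R + idm C"
    using dis by (auto simp: idm_def G intro!: ext)
  have onq: "mat_on G G q"
  proof -
    have "mat_on G G (?G d io)" "mat_on G G (?G io d)"
      by (rule mat_on_mc dG iG)+
    then show ?thesis using mat_on_idm[of G] unfolding q_def mat_on_def minus_apply by (metis diff_0_right)
  qed
  have onf: "mat_on G C f" unfolding f_def by (rule mat_on_mc[OF onq mat_on_idm])
  have ong: "mat_on C G g" unfolding g_def by (rule mat_on_mc[OF mat_on_idm onq])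
  have CG: "?C f M = ?G f M" for M :: "'a \<Rightarrow> 'a \<Rightarrow> int"
    by (simp add: mc_shrink_left[OF fG sub(3) onf])
  have CG': "?C M g = ?G M g" for M :: "'a \<Rightarrow> 'a \<Rightarrow> int"
    by (simp add: mc_shrink_right[OF fG sub(3) ong])
  have "?G q (?G (idm G) q) = ?G q (?G (idm C) q)"
    unfolding idG by (simp add: mc_bilin Pq qR[THEN mc_assoc_eq])
  then have qCq: "?G q (?G (idm C) q) = q" using mc_id_left'[OF fG onq order_refl] qq by simp
  have fg: "?G f g = q" unfolding f_def g_def using qCq by (simp add: mc_assoc idC[THEN mc_assoc_eq])
  \<comment> \<open>The zigzag term: \<open>io\<close> starts in \<open>R\<close> and ends in
    \<open>P\<close>, so it sees only the blocks \<open>C\<close> to \<open>R\<close> and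
    \<open>P\<close> to \<open>C\<close>, one of which is zero.\<close>
  have "?G (idm C) (?G d (?G io (?G d (idm C)))) = 0"
  proof -
    have "blk C R d = 0 \<or> blk P C d = 0" using no_zigzag by (auto simp: blk_def fun_eq_iff)
    moreover have "?G (idm C) (?G d (idm R)) = blk C R d" "?G (idm P) (?G d (idm C)) = blk P C d"
      by (auto simp: mc_id_left mc_id_right fG sub blk_def intro!: ext)
    moreover have "?G (idm R) io = io" by (rule mc_id_on_left[OF fG iR sub(2)])
    then have "?G (idm C) (?G d (?G io (?G d (idm C))))
      = ?G (?G (idm C) (?G d (idm R))) (?G io (?G (idm P) (?G d (idm C))))"
      using iP by (simp add: mc_assoc iP[THEN mc_assoc_eq]) (metis mc_assoc)
    ultimately show ?thesis by auto
  qed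
  then have "?G (idm C) (?G q (?G d (idm C))) = ?G (idm C) (?G d (idm C))"
    by (simp add: q_def rules)
  moreover have "?G (idm C) (?G d (idm C)) = blk C C d"
    by (auto simp: mc_id_left mc_id_right fG sub blk_def intro!: ext)
  ultimately have e: "?G (idm C) (?G q (?G d (idm C))) = blk C C d" by simp
  have gdf: "?G g (?G d f) = blk C C d"
  proof -
    have "?G g (?G d f) = ?G (idm C) (?G q (?G (?G d q) (idm C)))"
      by (simp add: f_def g_def mc_assoc)
    also have "\<dots> = ?G (idm C) (?G q (?G d (idm C)))"
      by (simp add: qd[symmetric] mc_assoc qq[THEN mc_assoc_eq])
    finally show ?thesis using e by simp
  qed
  have gf: "?G g f = idm C"
  proof -
    have "?G g f = ?G (idm C) (?G q (idm C))" by (simp add: f_def g_def mc_assoc qq[THEN mc_assoc_eq])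
    also have "\<dots> = idm C"
    proof -
      have "?G (idm C) (?G io X) = ?G (?G (idm C) io) X" for X :: "'a \<Rightarrow> 'a \<Rightarrow> int" by (simp add: mc_assoc)
      moreover have "?G (idm C) io = 0" by (rule mc_disjoint[OF mat_on_idm iR]) (use dis in auto)
      ultimately show ?thesis by (simp add: q_def mc_bilin mc_assoc idC Ci)
    qed
    finally show ?thesis .
  qed
  have 1: "?G d f = ?C f (blk C C d)"
  proof -
    have "?G f (blk C C d) = ?G (?G f g) (?G d f)" by (simp add: gdf[symmetric] mc_assoc)
    also have "\<dots> = ?G d f" unfolding fg unfolding f_def
      by (simp add: mc_assoc qd[symmetric] qd[symmetric, THEN mc_assoc_eq] qq qq[THEN mc_assoc_eq])
    finally show ?thesis by (simp add: CG)
  qed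
  have 2: "?C (blk C C d) g = ?G g d"
  proof -
    have "?G (blk C C d) g = ?G g (?G d (?G f g))" by (simp add: gdf[symmetric] mc_assoc)
    also have "\<dots> = ?G g d" unfolding fg unfolding g_def
      by (simp add: mc_assoc qd[symmetric] qd[symmetric, THEN mc_assoc_eq] qq qq[THEN mc_assoc_eq])
    finally show ?thesis by (simp add: CG')
  qed
  have qi: "?G q io = 0" "?G io q = 0" by (simp_all add: q_def rules)
  \<comment> \<open>The homotopy is \<open>- io\<close>, because \<open>f g = q\<close> and
    \<open>q\<close> subtracts \<open>d io\<close> and \<open>io d\<close> from the
    identity.\<close>
  have "?G g (- io) = 0" "?G (- io) f = 0" "?G (- io) (- io) = 0"
    by (simp_all add: g_def f_def mc_bilin mc_assoc qi qi[THEN mc_assoc_eq] ii)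
  moreover have "?C f g = idm G + ?G d (- io) + ?G (- io) d"
    unfolding CG fg by (simp add: q_def mc_bilin)
  moreover have degio: "dg x = (fst (dg y) + 1, snd (dg y))" if "io x y \<noteq> 0" for x y
    using that degd by (auto simp: io_def split: if_splits)
  moreover have degq: "dg x = dg y" if "q x y \<noteq> 0" for x y
  proof -
    have "idm G x y \<noteq> 0 \<or> ?G d io x y \<noteq> 0 \<or> ?G io d x y \<noteq> 0" using that by (auto simp: q_def)
    then show ?thesis by (elim disjE mc_nonzeroE) (auto dest!: degd degio simp: idm_def prod_eq_iff)
  qed
  moreover have "dg x = dg y" if "f y x \<noteq> 0" for x y
    using that unfolding f_def by (auto elim!: mc_nonzeroE dest!: degq simp: idm_def)
  moreover have "dg x = dg y" if "g x y \<noteq> 0" for x y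
    using that unfolding g_def by (auto elim!: mc_nonzeroE dest!: degq simp: idm_def)
  moreover have "mat_on G G (- io)" using iG by (auto simp: mat_on_def)
  ultimately have "sdr_by G dg d C dg (blk C C d) f g (- io)"
    unfolding sdr_by_def using onf ong 1 2 gf by (auto simp: mat_on_blk)
  then show ?thesis unfolding sdr_def by blast
qed


text \<open>The second homotopy is conjugated into the big complex as \<open>f h' g\<close>. The
  side conditions survive because \<open>g h\<close>, \<open>h f\<close> and the analogous products
  for the second retract vanish.\<close>

lemma sdr_trans:
  assumes fin: "finite C"
    and 1: "sdr G dg d C dc e" and 2: "sdr C dc e B db k"
  shows "sdr G dg d B db k"
proof -
  obtain f g h where s: "sdr_by G dg d C dc e f g h" using 1 by (auto simp: sdr_def)
  obtain f' g' h' where t: "sdr_by C dc e B db k f' g' h'" using 2 by (auto simp: sdr_def)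
  note s = s[unfolded sdr_by_def] and t = t[unfolded sdr_by_def]
  let ?G = "mat_comp G" and ?C = "mat_comp C" and ?B = "mat_comp B"
  have on: "mat_on G C f" "mat_on C G g" "mat_on G G h" "mat_on C B f'" "mat_on B C g'" "mat_on C C h'"
    using s t by blast+
  have deg: "f x y \<noteq> 0 \<Longrightarrow> dc y = dg x" "g y x \<noteq> 0 \<Longrightarrow> dc y = dg x"
     "h x v \<noteq> 0 \<Longrightarrow> dg x = (fst (dg v) + 1, snd (dg v))" for x y v using s by blast+
  have deg': "f' x y \<noteq> 0 \<Longrightarrow> db y = dc x" "g' y x \<noteq> 0 \<Longrightarrow> db y = dc x"
     "h' x v \<noteq> 0 \<Longrightarrow> dc x = (fst (dc v) + 1, snd (dc v))" for x y v using t by blast+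
  have S: "?G d f = ?C f e" "?C e g = ?G g d" "?G g f = idm C" "?C f g = idm G + ?G d h + ?G h d"
    "?G g h = 0" "?G h f = 0" "?G h h = 0" using s by blast+
  have T: "?C e f' = ?B f' k" "?B k g' = ?C g' e" "?C g' f' = idm B" "?B f' g' = idm C + ?C e h' + ?C h' e"
    "?C g' h' = 0" "?C h' f' = 0" "?C h' h' = 0" using t by blast+
  have I: "?C (idm C) f' = f'" "?C (idm C) g = g" "?C (idm C) h' = h'"
    by (rule mc_id_on_left, rule fin, rule on, rule order_refl)+
  note rules = mc_bilin mc_assoc S S[THEN mc_assoc_eq] T T[THEN mc_assoc_eq] I I[THEN mc_assoc_eq]
  define F where "F = ?C f f'"
  define H where "H = ?C g' g"
  define J where "J = h + ?C f (?C h' g)"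
  have "?G d F = ?B F k" "?B k H = ?G H d" "?G H F = idm B" "?G H J = 0" "?G J F = 0" "?G J J = 0"
    by (simp_all add: F_def H_def J_def rules)
  moreover have "?B F H = idm G + ?G d J + ?G J d"
    by (simp add: F_def H_def J_def rules)
  moreover have "mat_on G B F" "mat_on B G H" "mat_on G G J"
    unfolding F_def H_def J_def using on by (blast intro: mat_on_add mat_on_mc)+
  moreover have "db y = dg x" if "F x y \<noteq> 0" for x y
    using that unfolding F_def by (auto elim!: mc_nonzeroE dest!: deg deg')
  moreover have "db y = dg x" if "H y x \<noteq> 0" for x y
    using that unfolding H_def by (auto elim!: mc_nonzeroE dest!: deg deg')
  moreover have "dg x = (fst (dg y) + 1, snd (dg y))" if nz: "J x y \<noteq> 0" for x y
  proof -
    have "h x y \<noteq> 0 \<or> ?C f (?C h' g) x y \<noteq> 0" using nz by (auto simp: J_def)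
    then show ?thesis by (elim disjE mc_nonzeroE) (auto dest!: deg deg' simp: prod_eq_iff)
  qed
  ultimately have "sdr_by G dg d B db k F H J" unfolding sdr_by_def using t by blast
  then show ?thesis unfolding sdr_def by blast
qed

text \<open>A differential on a single generator would have to raise its degree, so it is zero. The
  lemma renames the surviving enhanced state into a quasi-tree.\<close>

lemma sdr_singleton:
  assumes "complex {x} dg e" and "dc y = dg x"
  shows "sdr {x} dg e {y} dc 0"
proof -
  have e: "e = 0"
    using assms(1) by (auto simp: complex_def mat_on_def prod_eq_iff fun_eq_iff) (metis add_cancel_right_right zero_neq_one)
  have "sdr_by {x} dg e {y} dc 0 (\<lambda>u v. of_bool (u = x \<and> v = y)) (\<lambda>v u. of_bool (u = x \<and> v = y)) 0"
    using assms(2) by (auto simp: sdr_by_def e mat_on_def mat_comp_def idm_def fun_eq_iff)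
  then show ?thesis by (auto simp: sdr_def)
qed

lemma sdr_deformation_retract:
  assumes s: "sdr K dk d C dc e" and q: "\<And>y. y \<in> C \<Longrightarrow> dq y = phi (dc y)"
  shows "deformation_retract K dk d (\<lambda>(i, j). (i - 1, j)) C dq e phi"
proof -
  obtain f g h where "sdr_by K dk d C dc e f g h" using s by (auto simp: sdr_def)
  note s = this[unfolded sdr_by_def]
  have S: "mat_comp K d f = mat_comp C f e" "mat_comp C e g = mat_comp K g d" "mat_comp K g f = idm C"
     "mat_comp C f g = idm K + mat_comp K d h + mat_comp K h d" using s by blast+
  show ?thesis unfolding deformation_retract_def
  proof (rule exI[of _ f], rule exI[of _ g], rule exI[of _ h], intro conjI)
    show "\<forall>x y. f x y \<noteq> 0 \<longrightarrow> x \<in> K \<and> y \<in> C \<and> dq y = phi (dk x)" using s q by (fastforce simp: mat_on_def)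
    show "\<forall>y x. g y x \<noteq> 0 \<longrightarrow> y \<in> C \<and> x \<in> K \<and> dq y = phi (dk x)" using s q by (fastforce simp: mat_on_def)
    show "\<forall>x x'. h x x' \<noteq> 0 \<longrightarrow> x \<in> K \<and> x' \<in> K \<and> dk x' = (case dk x of (i, j) \<Rightarrow> (i - 1, j))"
      using s by (auto simp: mat_on_def split_beta)
    show "\<forall>y\<in>C. \<forall>y'\<in>C. mat_comp K g f y y' = of_bool (y = y')" by (simp add: S idm_def)
  qed (auto simp: S idm_def)
qed

section \<open>Maps induced on homology\<close>

lemma mat_apply_comp: "mat_apply H N (mat_apply G M c) = mat_apply G (mat_comp H M N) c"
  by (intro ext) (simp add: mat_apply_def mat_comp_def sum_distrib_left sum_distrib_right mult.assoc sum.swap[of _ G H])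

lemma mat_apply_add: "mat_apply G M (a + b) = mat_apply G M a + mat_apply G M b"
  by (intro ext) (simp add: mat_apply_def algebra_simps sum.distrib)
lemma mat_apply_uminus: "mat_apply G M (- a) = - mat_apply G M a"
  by (intro ext) (simp add: mat_apply_def sum_negf)
lemma mat_apply_diff: "mat_apply G M (a - b) = mat_apply G M a - mat_apply G M b"
  by (intro ext) (simp add: mat_apply_def algebra_simps sum_subtractf)
lemma mat_apply_zero [simp]: "mat_apply G M 0 = 0" "mat_apply G 0 a = 0"
  by (auto simp: mat_apply_def fun_eq_iff)
lemma mat_apply_mat_add: "mat_apply G (M + N) a = mat_apply G M a + mat_apply G N a"
  by (intro ext) (simp add: mat_apply_def algebra_simps sum.distrib)
lemma mat_apply_idm: "finite G \<Longrightarrow> (\<And>x. a x \<noteq> 0 \<Longrightarrow> x \<in> G) \<Longrightarrow> mat_apply G (idm G) a = a"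
proof (intro ext)
  fix y assume *: "finite G" "\<And>x. a x \<noteq> 0 \<Longrightarrow> x \<in> G"
  have "mat_apply G (idm G) a y = (\<Sum>x\<in>{y} \<inter> G. a x)"
    unfolding mat_apply_def idm_def by (subst sum.mono_neutral_right[of _ "{y} \<inter> G"]) (use * in auto)
  then show "mat_apply G (idm G) a y = a y" using * by (cases "y \<in> G") auto
qed

lemma mat_apply_chains:
  assumes "mat_on G H M" "\<And>x y. M x y \<noteq> 0 \<Longrightarrow> x \<in> G \<Longrightarrow> dg x = k \<Longrightarrow> dh y = l" "c \<in> cx_chains G dg k"
  shows "mat_apply G M c \<in> cx_chains H dh l"
  unfolding cx_chains_def
proof (clarify)
  fix y assume "mat_apply G M c y \<noteq> 0"
  then obtain x where "x \<in> G" "c x * M x y \<noteq> 0"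
    unfolding mat_apply_def using sum.not_neutral_contains_not_neutral by blast
  then show "y \<in> H \<and> dh y = l" using assms by (auto simp: mat_on_def cx_chains_def)
qed

lemma cx_chains_closed:
  "a \<in> cx_chains G dg k \<Longrightarrow> b \<in> cx_chains G dg k \<Longrightarrow> a + b \<in> cx_chains G dg k"
  "a \<in> cx_chains G dg k \<Longrightarrow> - a \<in> cx_chains G dg k" "0 \<in> cx_chains G dg k"
proof -
  show "a + b \<in> cx_chains G dg k" if ab: "a \<in> cx_chains G dg k" "b \<in> cx_chains G dg k"
    unfolding cx_chains_def
  proof clarify
    fix x assume "(a + b) x \<noteq> 0"
    then have "a x \<noteq> 0 \<or> b x \<noteq> 0" by auto
    then show "x \<in> G \<and> dg x = k" using ab by (auto simp: cx_chains_def)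
  qed
qed (auto simp: cx_chains_def)

definition cycles where
  "cycles G dg d k = (cx_group G dg k)\<lparr>carrier := {f \<in> cx_chains G dg k. mat_apply G d f = (\<lambda>y. 0)}\<rparr>"

lemma cycles_simps:
  "carrier (cycles G dg d k) = {f \<in> cx_chains G dg k. mat_apply G d f = 0}"
  "a \<otimes>\<^bsub>cycles G dg d k\<^esub> b = a + b" "\<one>\<^bsub>cycles G dg d k\<^esub> = 0"
  by (auto simp: cycles_def cx_group_def zero_fun_def plus_fun_def)

lemma comm_group_cycles: "comm_group (cycles G dg d k)"
proof (rule comm_groupI)
  fix x assume x: "x \<in> carrier (cycles G dg d k)"
  then show "\<exists>y\<in>carrier (cycles G dg d k). y \<otimes>\<^bsub>cycles G dg d k\<^esub> x = \<one>\<^bsub>cycles G dg d k\<^esub>"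
    by (intro bexI[of _ "- x"]) (auto simp: cycles_simps mat_apply_uminus cx_chains_closed)
qed (auto simp: cycles_simps mat_apply_add cx_chains_closed algebra_simps)

lemma boundaries_normal:
  assumes cx: "complex G dg d" and k: "fst k = fst kp + 1" "snd k = snd kp"
  shows "(mat_apply G d ` cx_chains G dg kp) \<lhd> cycles G dg d k"
proof -
  interpret comm_group "cycles G dg d k" by (rule comm_group_cycles)
  have "subgroup (mat_apply G d ` cx_chains G dg kp) (cycles G dg d k)"
  proof (rule subgroupI)
    show "mat_apply G d ` cx_chains G dg kp \<subseteq> carrier (cycles G dg d k)"
    proof clarify
      fix c assume c: "c \<in> cx_chains G dg kp"
      have "mat_apply G d c \<in> cx_chains G dg k"
        by (rule mat_apply_chains[OF _ _ c, of G]) (use cx k in \<open>auto simp: complex_def prod_eq_iff\<close>)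
      then show "mat_apply G d c \<in> carrier (cycles G dg d k)"
        using cx by (simp add: cycles_simps mat_apply_comp complex_def)
    qed
    show "mat_apply G d ` cx_chains G dg kp \<noteq> {}" using cx_chains_closed(3)[of G dg kp] by blast
  next
    fix a assume a: "a \<in> mat_apply G d ` cx_chains G dg kp"
    then obtain c where c: "c \<in> cx_chains G dg kp" "a = mat_apply G d c" by auto
    have "- a \<in> carrier (cycles G dg d k)" "a \<in> carrier (cycles G dg d k)"
    proof -
      have "mat_apply G d c \<in> cx_chains G dg k"
        by (rule mat_apply_chains[OF _ _ c(1), of G]) (use cx k in \<open>auto simp: complex_def prod_eq_iff\<close>)
      then show "- a \<in> carrier (cycles G dg d k)" "a \<in> carrier (cycles G dg d k)"
        using cx c by (auto simp: cycles_simps mat_apply_comp mat_apply_uminus complex_def cx_chains_closed)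
    qed
    then have "inv\<^bsub>cycles G dg d k\<^esub> a = - a" by (intro inv_equality) (auto simp: cycles_simps)
    also have "\<dots> \<in> mat_apply G d ` cx_chains G dg kp"
      using c by (intro image_eqI[of _ _ "- c"]) (auto simp: mat_apply_uminus cx_chains_closed)
    finally show "inv\<^bsub>cycles G dg d k\<^esub> a \<in> mat_apply G d ` cx_chains G dg kp" .
  next
    fix a b assume "a \<in> mat_apply G d ` cx_chains G dg kp" "b \<in> mat_apply G d ` cx_chains G dg kp"
    then obtain c c' where "c \<in> cx_chains G dg kp" "a = mat_apply G d c" "c' \<in> cx_chains G dg kp" "b = mat_apply G d c'" by auto
    then show "a \<otimes>\<^bsub>cycles G dg d k\<^esub> b \<in> mat_apply G d ` cx_chains G dg kp"
      by (intro image_eqI[of _ _ "c + c'"]) (auto simp: mat_apply_add cx_chains_closed cycles_simps)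
  qed
  then show ?thesis by (rule subgroup_imp_normal)
qed

text \<open>First isomorphism theorem for \<open>f\<close> followed by the quotient map:
  \<open>g\<close> gives preimages, so the map is onto, and the homotopy shows that a cycle with
  bounding image bounds.\<close>

lemma sdr_homology_iso:
  assumes cx: "complex G dg d" and C: "finite C" and s: "sdr G dg d C dc e"
    and k: "fst k = fst kp + 1" "snd k = snd kp"
  shows "cx_homology G dg d k kp \<cong> cx_homology C dc e k kp"
proof -
  obtain f g h where "sdr_by G dg d C dc e f g h" using s by (auto simp: sdr_def)
  note s' = this[unfolded sdr_by_def]
  have S: "mat_comp G d f = mat_comp C f e" "mat_comp C e g = mat_comp G g d" "mat_comp G g f = idm C"
     "mat_comp C f g = idm G + mat_comp G d h + mat_comp G h d" using s' by blast+
  have cxC: "complex C dc e" by (rule complex_target[OF cx C s])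
  define ZG where "ZG = cycles G dg d k"
  define ZC where "ZC = cycles C dc e k"
  define BG where "BG = mat_apply G d ` cx_chains G dg kp"
  define BC where "BC = mat_apply C e ` cx_chains C dc kp"
  have nG: "BG \<lhd> ZG" and nC: "BC \<lhd> ZC"
    unfolding BG_def ZG_def BC_def ZC_def by (intro boundaries_normal cx cxC k)+
  interpret ZG: comm_group ZG unfolding ZG_def by (rule comm_group_cycles)
  interpret ZC: comm_group ZC unfolding ZC_def by (rule comm_group_cycles)
  interpret BC: normal BC ZC by (rule nC)
  interpret BG: normal BG ZG by (rule nG)
  have fmap: "mat_apply G f c \<in> cx_chains C dc l" if "c \<in> cx_chains G dg l" for c l
    by (rule mat_apply_chains[OF _ _ that, of C]) (use s' in auto)
  have gmap: "mat_apply C g c \<in> cx_chains G dg l" if "c \<in> cx_chains C dc l" for c l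
    by (rule mat_apply_chains[OF _ _ that, of G]) (use s' in auto)
  have hmap: "mat_apply G h c \<in> cx_chains G dg kp" if "c \<in> cx_chains G dg k" for c
    by (rule mat_apply_chains[OF _ _ that, of G]) (use s' k in \<open>auto simp: prod_eq_iff\<close>)
  have ef: "mat_apply C e (mat_apply G f c) = mat_apply G f (mat_apply G d c)" for c
    by (simp add: mat_apply_comp S)
  have dgc: "mat_apply G d (mat_apply C g c) = mat_apply C g (mat_apply C e c)" for c
    by (simp add: mat_apply_comp S)
  have fg: "mat_apply G f (mat_apply C g c) = c" if "c \<in> cx_chains C dc l" for c l
    using that C by (simp add: mat_apply_comp S) (auto intro!: mat_apply_idm simp: cx_chains_def)
  have gf: "mat_apply C g (mat_apply G f c) = c + mat_apply G d (mat_apply G h c) + mat_apply G h (mat_apply G d c)" if "c \<in> cx_chains G dg l" for c l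
  proof -
    have "mat_apply G (idm G) c = c"
      using that cx by (intro mat_apply_idm) (auto simp: cx_chains_def complex_def)
    then show ?thesis by (simp add: mat_apply_comp S mat_apply_mat_add add_ac)
  qed
  define F where "F c = BC #>\<^bsub>ZC\<^esub> mat_apply G f c" for c
  have fZ: "mat_apply G f c \<in> carrier ZC" if "c \<in> carrier ZG" for c
    using that fmap by (auto simp: ZC_def ZG_def cycles_simps ef)
  have hom: "F \<in> hom ZG (ZC Mod BC)"
  proof (rule homI)
    fix x assume "x \<in> carrier ZG"
    then show "F x \<in> carrier (ZC Mod BC)"
      unfolding F_def FactGroup_def using fZ BC.subset by (auto intro: ZC.rcosetsI)
  next
    fix x y assume "x \<in> carrier ZG" "y \<in> carrier ZG"
    then show "F (x \<otimes>\<^bsub>ZG\<^esub> y) = F x \<otimes>\<^bsub>ZC Mod BC\<^esub> F y"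
      unfolding F_def using BC.rcos_sum[OF fZ fZ, of x y]
      by (simp add: FactGroup_def ZG_def ZC_def cycles_simps mat_apply_add)
  qed
  interpret FH: group_hom ZG "ZC Mod BC" F
    by (intro group_hom.intro ZG.is_group BC.factorgroup_is_group group_hom_axioms.intro hom)
  have surj: "F ` carrier ZG = carrier (ZC Mod BC)"
  proof
    show "F ` carrier ZG \<subseteq> carrier (ZC Mod BC)" using hom by (auto simp: hom_def)
    show "carrier (ZC Mod BC) \<subseteq> F ` carrier ZG"
    proof
      fix X assume "X \<in> carrier (ZC Mod BC)"
      then obtain c where c: "c \<in> carrier ZC" "X = BC #>\<^bsub>ZC\<^esub> c"
        by (auto simp: FactGroup_def RCOSETS_def)
      then have "mat_apply C g c \<in> carrier ZG" "mat_apply G f (mat_apply C g c) = c"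
        using gmap[of c k] fg[of c k] by (auto simp: ZC_def ZG_def cycles_simps dgc)
      then show "X \<in> F ` carrier ZG" using c by (intro image_eqI[of _ _ "mat_apply C g c"]) (auto simp: F_def)
    qed
  qed
  have ker: "kernel ZG (ZC Mod BC) F = BG"
  proof (intro equalityI subsetI)
    fix c assume "c \<in> kernel ZG (ZC Mod BC) F"
    then have c: "c \<in> carrier ZG" and "F c = BC" by (auto simp: kernel_def FactGroup_def)
    then have "mat_apply G f c \<in> BC" unfolding F_def using ZC.rcos_self[OF fZ[OF c] BC.subgroup_axioms] by simp
    then obtain b where b: "b \<in> cx_chains C dc kp" "mat_apply G f c = mat_apply C e b" by (auto simp: BC_def)
    have cc: "c \<in> cx_chains G dg k" "mat_apply G d c = 0" using c by (auto simp: ZG_def cycles_simps)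
    \<comment> \<open>The homotopy relation at a cycle \<open>c\<close>, where the term with
      \<open>d c\<close> drops out, solved for \<open>c\<close>.\<close>
    have "c = mat_apply C g (mat_apply C e b) - mat_apply G d (mat_apply G h c)"
      using gf[OF cc(1)] b cc by simp
    also have "\<dots> = mat_apply G d (mat_apply C g b - mat_apply G h c)"
      by (simp add: dgc mat_apply_diff)
    finally have "c = mat_apply G d (mat_apply C g b + - mat_apply G h c)" by simp
    moreover have "mat_apply C g b + - mat_apply G h c \<in> cx_chains G dg kp"
      by (intro cx_chains_closed gmap[OF b(1)] hmap[OF cc(1)])
    ultimately show "c \<in> BG" unfolding BG_def by (rule image_eqI)
  next
    fix c assume cB: "c \<in> BG"
    then obtain b where b: "b \<in> cx_chains G dg kp" "c = mat_apply G d b" by (auto simp: BG_def)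
    have c: "c \<in> carrier ZG" using cB BG.subset by blast
    have "mat_apply G f c \<in> BC" unfolding BC_def b by (intro image_eqI[of _ _ "mat_apply G f b"]) (auto simp: ef fmap b)
    then have "F c = BC" unfolding F_def by (simp add: BC.rcos_const)
    then show "c \<in> kernel ZG (ZC Mod BC) F" using c by (simp add: kernel_def FactGroup_def)
  qed
  have "(\<lambda>X. the_elem (F ` X)) \<in> iso (ZG Mod BG) (ZC Mod BC)"
    using FH.FactGroup_iso_set[OF surj] unfolding ker .
  then show ?thesis
    unfolding is_iso_def cx_homology_def ZG_def ZC_def BG_def BC_def cycles_def by blast
qed

lemma cx_homology_regrade:
  assumes "inj phi" "\<And>y. y \<in> C \<Longrightarrow> dq y = phi (dc y)"
  shows "cx_homology C dq e (phi k) (phi kp) = cx_homology C dc e k kp"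
proof -
  have "cx_chains C dq (phi l) = cx_chains C dc l" for l
    using assms by (auto simp: cx_chains_def inj_eq)
  then show ?thesis by (simp add: cx_homology_def cx_group_def)
qed

section \<open>The reduced Khovanov complex of a family of smoothings\<close>

definition flip :: "nat \<Rightarrow> nat set \<Rightarrow> nat set" where
  "flip c S = (if c \<in> S then S - {c} else insert c S)"

lemma flip_flip [simp]: "flip c (flip c S) = S" by (auto simp: flip_def)
lemma flip_notin: "c \<notin> S \<Longrightarrow> flip c S = insert c S" by (simp add: flip_def)
lemma flip_insert: "c \<notin> S \<Longrightarrow> flip c (insert c S) = S" by (auto simp: flip_def)
lemma flip_commute: "flip c (flip c' S) = flip c' (flip c S)" by (auto simp: flip_def)
lemma flip_mem: "x \<in> flip c S \<longleftrightarrow> (if x = c then c \<notin> S else x \<in> S)" by (auto simp: flip_def)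

lemma pair_collapse:
  assumes "(if x = p \<or> x = q then u else x) = (if y = p \<or> y = q then u else y)"
    and "x \<noteq> u" "y \<noteq> u" "x \<noteq> y"
  shows "{p, q} = {x, y}"
  using assms by (auto split: if_splits)

text \<open>The points \<open>a c\<close> and \<open>b c\<close> mark the two arcs at crossing
  \<open>c\<close>. \<open>toggle\<close> excludes a change of smoothing that keeps the number of
  circles, as occurs for virtual diagrams. Splitting needs no axiom of its own, since it is gluing
  read backwards. \<open>ci\<close> and \<open>cj\<close> are the degree shifts coming from the
  crossing signs.\<close>

locale circle_system =
  fixes n :: nat and D :: "'d set" and cl :: "nat set \<Rightarrow> 'd \<Rightarrow> 'd set"
    and a b :: "nat \<Rightarrow> 'd" and base :: 'd and ci cj :: int
  assumes finD: "finite D" and baseD: "base \<in> D"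
    and abD: "c \<in> {1..n} \<Longrightarrow> a c \<in> D" "c \<in> {1..n} \<Longrightarrow> b c \<in> D"
    and cl_refl: "x \<in> D \<Longrightarrow> x \<in> cl S x"
    and cl_sub: "x \<in> D \<Longrightarrow> cl S x \<subseteq> D"
    and cl_eqI: "x \<in> D \<Longrightarrow> y \<in> cl S x \<Longrightarrow> cl S y = cl S x"
    and toggle: "c \<in> {1..n} \<Longrightarrow>
      cl (flip c S) (a c) = cl (flip c S) (b c) \<longleftrightarrow> cl S (a c) \<noteq> cl S (b c)"
    and glue: "c \<in> {1..n} \<Longrightarrow> cl S (a c) \<noteq> cl S (b c) \<Longrightarrow> x \<in> D \<Longrightarrow>
      cl (flip c S) x = (if x \<in> cl S (a c) \<union> cl S (b c) then cl S (a c) \<union> cl S (b c) else cl S x)"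
begin

definition "circ S = cl S ` D"

definition "gens = {(S, L). S \<subseteq> {1..n} \<and> L \<subseteq> circ S \<and> cl S base \<in> L}"

definition deg :: "nat set \<times> 'd set set \<Rightarrow> int \<times> int" where
  "deg g = (int (card (fst g)) + ci,
     int (card (circ (fst g))) - 2 * int (card (snd g)) + int (card (fst g)) + cj)"

definition ent :: "nat set \<Rightarrow> nat \<Rightarrow> 'd set set \<Rightarrow> 'd set set \<Rightarrow> int" where
  "ent S c L L' =
    (let old = {cl S (a c), cl S (b c)}; new = {cl (insert c S) (a c), cl (insert c S) (b c)};
         keep = L - old
     in if cl S (a c) \<noteq> cl S (b c) then
          (if old \<subseteq> L then 0
           else if old \<inter> L \<noteq> {} then of_bool (L' = keep \<union> new) else of_bool (L' = keep))
        else (if old \<subseteq> L then of_bool (L' = keep \<union> new)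
              else int (card {C \<in> new. L' = insert C keep})))"

definition sg :: "nat set \<Rightarrow> nat \<Rightarrow> int" where "sg S c = (- 1) ^ card {c' \<in> S. c' < c}"

definition dK :: "nat set \<times> 'd set set \<Rightarrow> nat set \<times> 'd set set \<Rightarrow> int" where
  "dK g g' = (if g \<in> gens \<and> g' \<in> gens \<and> (\<exists>c\<in>{1..n}. c \<notin> fst g \<and> fst g' = insert c (fst g))
     then (let c = (THE c. c \<notin> fst g \<and> fst g' = insert c (fst g)) in
           sg (fst g) c * ent (fst g) c (snd g) (snd g')) else 0)"

lemma dK_eq:
  assumes "c \<in> {1..n}" "c \<notin> S" "(S, L) \<in> gens" "(insert c S, L') \<in> gens"
  shows "dK (S, L) (insert c S, L') = sg S c * ent S c L L'"
proof -
  have "(THE c'. c' \<notin> S \<and> insert c S = insert c' S) = c" using assms by blast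
  then show ?thesis using assms by (auto simp: dK_def Let_def)
qed

lemma dK_nonzeroE:
  assumes "dK g g' \<noteq> 0"
  obtains S c L L' where "g = (S, L)" "g' = (insert c S, L')" "c \<in> {1..n}" "c \<notin> S"
    "(S, L) \<in> gens" "(insert c S, L') \<in> gens" "ent S c L L' \<noteq> 0"
proof -
  obtain S L where g: "g = (S, L)" by force
  obtain T L' where g': "g' = (T, L')" by force
  have *: "g \<in> gens" "g' \<in> gens" "\<exists>c\<in>{1..n}. c \<notin> S \<and> T = insert c S"
    using assms g g' by (auto simp: dK_def split: if_splits)
  then obtain c where c: "c \<in> {1..n}" "c \<notin> S" "T = insert c S" by blast
  then have "dK g g' = sg S c * ent S c L L'" using * g g' dK_eq by auto
  then have "ent S c L L' \<noteq> 0" using assms by auto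
  then show ?thesis using that g g' c * by blast
qed

lemma cl_mem_iff: "x \<in> D \<Longrightarrow> y \<in> D \<Longrightarrow> y \<in> cl S x \<longleftrightarrow> cl S y = cl S x"
  using cl_eqI cl_refl by metis

lemma finite_circ: "finite (circ S)" by (simp add: circ_def finD)

lemma finite_gens: "finite gens"
  by (rule finite_subset[of _ "Sigma (Pow {1..n}) (\<lambda>S. Pow (circ S))"]) (auto simp: gens_def finite_circ)

lemma circ_disjoint: "X \<in> circ S \<Longrightarrow> Y \<in> circ S \<Longrightarrow> x \<in> X \<Longrightarrow> x \<in> Y \<Longrightarrow> X = Y"
  unfolding circ_def using cl_eqI by blast

lemma circ_cl: "X \<in> circ S \<Longrightarrow> x \<in> X \<Longrightarrow> X = cl S x"
  unfolding circ_def using cl_eqI by blast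

lemma cl_in_circ: "x \<in> D \<Longrightarrow> cl S x \<in> circ S" by (simp add: circ_def)


section \<open>Circles and edge maps under one change of smoothing\<close>

definition "gm S c X = (if X = cl S (a c) \<or> X = cl S (b c) then cl S (a c) \<union> cl S (b c) else X)"

lemma glue_gm:
  assumes "c \<in> {1..n}" "cl S (a c) \<noteq> cl S (b c)" "x \<in> D"
  shows "cl (flip c S) x = gm S c (cl S x)"
  using glue[OF assms] assms by (auto simp: gm_def cl_mem_iff abD)

text \<open>A circle of \<open>S\<close> containing both \<open>a c\<close> and \<open>b c\<close>
  would be the class of each of them.\<close>

lemma glue_new:
  assumes "c \<in> {1..n}" "cl S (a c) \<noteq> cl S (b c)"
  shows "cl S (a c) \<union> cl S (b c) \<notin> circ S"
  using assms abD[of c] cl_refl circ_cl by (metis UnI1 UnI2)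

lemma circ_glue:
  assumes "c \<in> {1..n}" "cl S (a c) \<noteq> cl S (b c)"
  shows "circ (flip c S) = insert (cl S (a c) \<union> cl S (b c)) (circ S - {cl S (a c), cl S (b c)})"
    (is "?l = ?r")
proof -
  have "?l = gm S c ` circ S" using glue_gm[OF assms] by (auto simp: circ_def image_image)
  also have "\<dots> = ?r" using abD[OF assms(1)] cl_in_circ by (auto simp: gm_def image_iff)
  finally show ?thesis .
qed

lemma card_circ_glue:
  assumes "c \<in> {1..n}" "cl S (a c) \<noteq> cl S (b c)"
  shows "card (circ S) = Suc (card (circ (flip c S)))"
proof -
  have in2: "{cl S (a c), cl S (b c)} \<subseteq> circ S" using abD[OF assms(1)] cl_in_circ by auto
  have "card (circ S - {cl S (a c), cl S (b c)}) = card (circ S) - 2"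
    using in2 assms finite_circ by (subst card_Diff_subset) auto
  moreover have "card (circ S) \<ge> 2" using card_mono[OF finite_circ in2] assms(2) by simp
  ultimately show ?thesis
    unfolding circ_glue[OF assms] using glue_new[OF assms] finite_circ by (subst card_insert_disjoint) auto
qed

lemma card_circ:
  assumes "c \<in> {1..n}"
  shows "int (card (circ (flip c S))) = int (card (circ S)) + (if cl S (a c) = cl S (b c) then 1 else - 1)"
  using card_circ_glue[OF assms, of S] card_circ_glue[OF assms, of "flip c S"] toggle[OF assms, of S] by auto

text \<open>The product as a map on sets of x-labelled circles: x*x = 0 is the failure of
  \<open>gm\<close> to be injective on the set, and the other rules only push labels
  forward.\<close>

lemma ent_merge:
  assumes c: "c \<in> {1..n}" "c \<notin> S" and ne: "cl S (a c) \<noteq> cl S (b c)" and L: "L \<subseteq> circ S"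
  shows "ent S c L L' = of_bool (inj_on (gm S c) L \<and> gm S c ` L = L')"
proof -
  let ?A = "cl S (a c)" and ?B = "cl S (b c)"
  have new: "cl (insert c S) (a c) = ?A \<union> ?B" "cl (insert c S) (b c) = ?A \<union> ?B"
    using glue_gm[OF c(1) ne, of "a c"] glue_gm[OF c(1) ne, of "b c"] abD[OF c(1)] c(2)
    by (auto simp: gm_def flip_def)
  have nL: "?A \<union> ?B \<notin> L" using glue_new[OF c(1) ne] L by auto
  have u: "ent S c L L' = (if ?A \<in> L \<and> ?B \<in> L then 0 else if ?A \<in> L \<or> ?B \<in> L
        then of_bool (L' = insert (?A \<union> ?B) (L - {?A, ?B})) else of_bool (L' = L - {?A, ?B}))"
    using ne by (auto simp: ent_def new Let_def)
  consider "?A \<in> L" "?B \<in> L" | "?A \<in> L" "?B \<notin> L" | "?A \<notin> L" "?B \<in> L" | "?A \<notin> L" "?B \<notin> L" by blast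
  then show ?thesis
  proof cases
    case 1
    then have "\<not> inj_on (gm S c) L" using ne by (auto simp: inj_on_def gm_def)
    then show ?thesis using u 1 by simp
  next
    case 2
    then have "inj_on (gm S c) L" "gm S c ` L = insert (?A \<union> ?B) (L - {?A, ?B})"
      using nL by (auto simp: inj_on_def gm_def image_iff)
    then show ?thesis using u 2 by auto
  next
    case 3
    then have "inj_on (gm S c) L" "gm S c ` L = insert (?A \<union> ?B) (L - {?A, ?B})"
      using nL by (auto simp: inj_on_def gm_def image_iff)
    then show ?thesis using u 3 by auto
  next
    case 4
    then have "inj_on (gm S c) L" "gm S c ` L = L" "L - {?A, ?B} = L"
      by (auto simp: inj_on_def gm_def image_iff)
    then show ?thesis using u 4 by auto
  qed
qed

lemma split_facts:
  assumes c: "c \<in> {1..n}" "c \<notin> S" and e: "cl S (a c) = cl S (b c)"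
  shows "cl (insert c S) (a c) \<noteq> cl (insert c S) (b c)"
    and "cl S (a c) = cl (insert c S) (a c) \<union> cl (insert c S) (b c)"
    and "x \<in> D \<Longrightarrow> cl S x = gm (insert c S) c (cl (insert c S) x)"
    and "cl (insert c S) (a c) \<notin> circ S" "cl (insert c S) (b c) \<notin> circ S"
    and "cl S (a c) \<notin> circ (insert c S)"
proof -
  let ?A = "cl (insert c S) (a c)" and ?B = "cl (insert c S) (b c)"
  show ne: "?A \<noteq> ?B" using toggle[OF c(1), of S] e c(2) by (simp add: flip_notin)
  show gm: "cl S x = gm (insert c S) c (cl (insert c S) x)" if "x \<in> D" for x
    using glue_gm[OF c(1) ne that] c(2) by (simp add: flip_insert)
  show u: "cl S (a c) = ?A \<union> ?B" using gm[OF abD(1)[OF c(1)]] by (simp add: gm_def)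
  show "cl S (a c) \<notin> circ (insert c S)" using glue_new[OF c(1) ne] u by simp
  show "?A \<notin> circ S"
  proof
    assume "?A \<in> circ S"
    then have "?A = cl S (a c)" using circ_cl cl_refl abD c by blast
    then have "b c \<in> ?A" using u cl_refl[OF abD(2)[OF c(1)]] by auto
    then show False using ne cl_eqI abD c by metis
  qed
  show "?B \<notin> circ S"
  proof
    assume "?B \<in> circ S"
    then have "?B = cl S (b c)" using circ_cl cl_refl abD c by blast
    then have "a c \<in> ?B" using u e cl_refl[OF abD(1)[OF c(1)]] by auto
    then show False using ne cl_eqI abD c by metis
  qed
qed

lemma ent_split:
  assumes c: "c \<in> {1..n}" "c \<notin> S" and e: "cl S (a c) = cl S (b c)"
  defines "A \<equiv> cl (insert c S) (a c)" and "B \<equiv> cl (insert c S) (b c)"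
  shows "ent S c L L' = (if cl S (a c) \<in> L then of_bool (L' = insert A (insert B (L - {cl S (a c)})))
     else of_bool (L' = insert A L) + of_bool (L' = insert B L))"
proof -
  have ne: "A \<noteq> B" using split_facts[OF c e] by (simp add: A_def B_def)
  have u: "ent S c L L' = (if cl S (a c) \<in> L then of_bool (L' = L - {cl S (a c)} \<union> {A, B})
     else int (card {C \<in> {A, B}. L' = insert C (L - {cl S (a c)})}))"
    using e by (auto simp: ent_def Let_def A_def B_def)
  show ?thesis
  proof (cases "cl S (a c) \<in> L")
    case True
    have "L - {cl S (a c)} \<union> {A, B} = insert A (insert B (L - {cl S (a c)}))" by auto
    then show ?thesis using u True by simp
  next
    case False
    have "{C \<in> {A, B}. L' = insert C L} = (if L' = insert A L then {A} else {}) \<union> (if L' = insert B L then {B} else {})"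
      by auto
    then have "card {C \<in> {A, B}. L' = insert C L} = (if L' = insert A L then 1 else 0) + (if L' = insert B L then 1 else 0)"
      using ne by auto
    then show ?thesis using u False by simp
  qed
qed

text \<open>The chain group of a state \<open>S\<close> is \<open>\<int>[x\<^sub>z | z \<in> D]\<close> modulo \<open>x\<^sub>z\<^sup>2\<close> and \<open>x\<^sub>z - x\<^sub>w\<close> for \<open>z, w\<close> on one
  circle; a merge is the quotient map and a split is multiplication by \<open>x\<^bsub>a c\<^esub> + x\<^bsub>b c\<^esub>\<close>. Below this is
  dualised: functionals become functions of square-free monomials \<open>W \<subseteq> D\<close>, with \<open>psi S L\<close> the basis
  dual to the labellings. All the maps then commute because multiplications do.\<close>
definition psi :: "nat set \<Rightarrow> 'd set set \<Rightarrow> 'd set \<Rightarrow> int" where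
  "psi S L W = of_bool (inj_on (cl S) W \<and> cl S ` W = L)"

text \<open>Precomposition with the edge map on monomials: the identity for a merge, multiplication
  by the sum of the variables at \<open>a c\<close> and \<open>b c\<close> for a split. The guards
  express that squares of variables vanish.\<close>

definition op :: "nat set \<Rightarrow> nat \<Rightarrow> ('d set \<Rightarrow> int) \<Rightarrow> 'd set \<Rightarrow> int" where
  "op S c f W = (if cl S (a c) = cl S (b c)
     then of_bool (a c \<notin> W) * f (insert (a c) W) + of_bool (b c \<notin> W) * f (insert (b c) W) else f W)"

lemma insert_psi:
  "of_bool (z \<notin> W) * psi S L (insert z W) =
   of_bool (inj_on (cl S) W \<and> cl S z \<notin> cl S ` W \<and> insert (cl S z) (cl S ` W) = L)"
  by (auto simp: psi_def of_bool_def inj_on_insert insert_absorb)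

text \<open>\<open>W\<close> has one point on each x-labelled circle, so it is a monomial
  representing the labelling; \<open>op\<close> applied to a dual basis vector reads off one
  coefficient of its image.\<close>

lemma ent_op:
  assumes c: "c \<in> {1..n}" "c \<notin> S" and W: "W \<subseteq> D" and inj: "inj_on (cl S) W"
  shows "ent S c (cl S ` W) L' = op S c (psi (insert c S) L') W"
proof (cases "cl S (a c) = cl S (b c)")
  case False
  have "cl (insert c S) x = gm S c (cl S x)" if "x \<in> W" for x
    using glue_gm[OF c(1) False] W that c(2) by (auto simp: flip_notin)
  then have eq: "cl (insert c S) ` W = gm S c ` cl S ` W"
    and "inj_on (cl (insert c S)) W \<longleftrightarrow> inj_on (gm S c \<circ> cl S) W"
    by (auto simp: image_image intro!: inj_on_cong)
  then have "inj_on (cl (insert c S)) W \<longleftrightarrow> inj_on (gm S c) (cl S ` W)"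
    using comp_inj_on_iff[OF inj] by blast
  moreover have "cl S ` W \<subseteq> circ S" using W by (auto simp: circ_def)
  ultimately show ?thesis
    using False eq by (simp add: ent_merge[OF c False] op_def psi_def)
next
  case True
  define S' where "S' = insert c S"
  define C where "C = cl S (a c)"
  define A where "A = cl S' (a c)"
  define B where "B = cl S' (b c)"
  note sf = split_facts[OF c True, folded S'_def A_def B_def]
  have gm: "cl S x = (if cl S' x = A \<or> cl S' x = B then C else cl S' x)" if "x \<in> D" for x
    using sf(3)[OF that] sf(2) by (simp add: gm_def A_def B_def C_def)
  have inj': "inj_on (cl S') W"
    by (rule inj_onI) (use inj gm W in \<open>metis inj_on_def subset_iff\<close>)
  have op: "op S c (psi S' L') W =
     of_bool (A \<notin> cl S' ` W \<and> insert A (cl S' ` W) = L') + of_bool (B \<notin> cl S' ` W \<and> insert B (cl S' ` W) = L')"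
    using True by (simp add: op_def insert_psi inj' A_def B_def)
  show ?thesis
  proof (cases "C \<in> cl S ` W")
    case notin: False
    then have im: "cl S' x = cl S x \<and> cl S' x \<noteq> A \<and> cl S' x \<noteq> B" if "x \<in> W" for x
      using gm[of x] that W notin by (metis imageI subsetD)
    then have "cl S' ` W = cl S ` W" "A \<notin> cl S' ` W" "B \<notin> cl S' ` W" by (auto cong: image_cong_simp)
    then show ?thesis using ent_split[OF c True, of "cl S ` W" L'] notin op
      by (auto simp: C_def A_def B_def S'_def)
  next
    case isin: True
    then obtain w where w: "w \<in> W" "cl S w = C" by auto
    have wAB: "cl S' w = A \<or> cl S' w = B"
    proof (rule ccontr)
      assume nAB: "\<not> ?thesis"
      then have "cl S' w = C" using gm[of w] w W by auto
      then have "a c \<in> cl S' w" using cl_refl[OF abD(1)[OF c(1)], of S] by (simp add: C_def)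
      then have "cl S' w = A" using cl_eqI[of w "a c" S'] w W by (auto simp: A_def)
      then show False using nAB by simp
    qed
    have oth: "cl S' x = cl S x \<and> cl S' x \<noteq> A \<and> cl S' x \<noteq> B \<and> cl S x \<noteq> C" if "x \<in> W" "x \<noteq> w" for x
      using gm[of x] inj w that W by (auto simp: inj_on_def split: if_splits)
    have K: "cl S ` W - {C} = cl S ` (W - {w})" using w oth by auto
    have K': "cl S' ` W = insert (cl S' w) (cl S ` (W - {w}))" using w oth by (auto simp: image_iff)
    have AB: "A \<notin> cl S ` (W - {w})" "B \<notin> cl S ` (W - {w})" using oth by force+
    have "ent S c (cl S ` W) L' = of_bool (L' = insert A (insert B (cl S ` (W - {w}))))"
      using ent_split[OF c True, of "cl S ` W" L'] isin K by (simp add: C_def A_def B_def S'_def)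
    also have "\<dots> = op S c (psi S' L') W"
    proof -
      define M where "M = cl S ` (W - {w})"
      \<comment> \<open>The x-labelled circle is split and its representing point lies on one of the
        two new circles. Multiplication by the sum makes the term with that circle a square, hence
        zero, and the other term labels both.\<close>
      have "of_bool (L' = insert A (insert B M)) = (of_bool (A \<notin> insert X M \<and> insert A (insert X M) = L')
         + of_bool (B \<notin> insert X M \<and> insert B (insert X M) = L') :: int)" if "X = A \<or> X = B" for X
        using that AB sf(1) unfolding M_def[symmetric]
        by (elim disjE) (simp_all add: insert_commute[of A B] eq_commute[of L'] not_sym[OF sf(1)])
      from this[OF wAB] show ?thesis unfolding op K' M_def .
    qed
    finally show ?thesis by (simp add: S'_def)
  qed
qed

text \<open>The edge map respects the relation that two points on one circle multiply to zero. If a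
  split separates the two points, both new circles are already occupied and both summands are
  squares.\<close>

lemma op_psi_noninj:
  assumes c: "c \<in> {1..n}" "c \<notin> S" and W: "W \<subseteq> D" and inj: "\<not> inj_on (cl S) W"
  shows "op S c (psi (insert c S) L') W = 0"
proof (cases "cl S (a c) = cl S (b c)")
  case False
  have "cl (insert c S) x = gm S c (cl S x)" if "x \<in> W" for x
    using glue_gm[OF c(1) False] W that c(2) by (auto simp: flip_notin)
  then have "\<not> inj_on (cl (insert c S)) W" using inj unfolding inj_on_def by metis
  then show ?thesis using False by (simp add: op_def psi_def)
next
  case True
  define S' where "S' = insert c S"
  define C where "C = cl S (a c)"
  define A where "A = cl S' (a c)"
  define B where "B = cl S' (b c)"
  note sf = split_facts[OF c True, folded S'_def A_def B_def]
  have gm: "cl S x = (if cl S' x = A \<or> cl S' x = B then C else cl S' x)" if "x \<in> D" for x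
    using sf(3)[OF that] sf(2) by (simp add: gm_def A_def B_def C_def)
  have op: "op S c (psi S' L') W =
     of_bool (inj_on (cl S') W \<and> A \<notin> cl S' ` W \<and> insert A (cl S' ` W) = L')
      + of_bool (inj_on (cl S') W \<and> B \<notin> cl S' ` W \<and> insert B (cl S' ` W) = L')"
    using True by (simp add: op_def insert_psi A_def B_def)
  obtain x y where xy: "x \<in> W" "y \<in> W" "x \<noteq> y" "cl S x = cl S y" using inj by (auto simp: inj_on_def)
  show ?thesis
  proof (cases "cl S' x = cl S' y")
    case True
    then have "\<not> inj_on (cl S') W" using xy by (auto simp: inj_on_def)
    then show ?thesis using op by (simp add: S'_def)
  next
    case False
    have Cn: "cl S' u \<noteq> C" if "u \<in> W" "cl S' u \<noteq> A" for u
    proof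
      assume "cl S' u = C"
      then have "a c \<in> cl S' u" using cl_refl[OF abD(1)[OF c(1)], of S] by (simp add: C_def)
      then show False using cl_eqI[of u "a c" S'] W that by (auto simp: A_def)
    qed
    have "{cl S' x, cl S' y} = {A, B}"
      using gm[of x] gm[of y] xy False W Cn[of x] Cn[of y] by (smt (verit) insert_commute subset_iff)
    then have "A \<in> cl S' ` W \<and> B \<in> cl S' ` W"
      using xy by (metis imageI insertI1 insert_commute insert_iff singletonD)
    then show ?thesis using op by (simp add: S'_def)
  qed
qed

text \<open>As \<open>psi\<close> is the dual basis, summing over the intermediate labellings
  amounts to composing the two operators on monomials.\<close>

lemma ent_comp:
  assumes c: "c \<in> {1..n}" "c \<notin> S" and c': "c' \<in> {1..n}" "c' \<notin> S" "c \<noteq> c'"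
    and W: "W \<subseteq> D" "inj_on (cl S) W"
  shows "(\<Sum>L'\<in>Pow (circ (insert c S)). ent S c (cl S ` W) L' * ent (insert c S) c' L' L'')
     = op S c (op (insert c S) c' (psi (insert c' (insert c S)) L'')) W"
proof -
  let ?S1 = "insert c S"
  have in': "c' \<notin> ?S1" using c' by auto
  have fin: "finite (Pow (circ ?S1))" by (simp add: finite_circ)
  have inner: "(\<Sum>L'\<in>Pow (circ ?S1). psi ?S1 L' V * ent ?S1 c' L' L'') = op ?S1 c' (psi (insert c' ?S1) L'') V"
    if V: "V \<subseteq> D" for V
  proof (cases "inj_on (cl ?S1) V")
    case True
    have "(\<Sum>L'\<in>Pow (circ ?S1). psi ?S1 L' V * ent ?S1 c' L' L'') =
      (\<Sum>L'\<in>Pow (circ ?S1). if L' = cl ?S1 ` V then ent ?S1 c' L' L'' else 0)"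
      using True by (intro sum.cong) (auto simp: psi_def)
    also have "\<dots> = ent ?S1 c' (cl ?S1 ` V) L''" using V by (subst sum.delta[OF fin]) (auto simp: circ_def)
    finally show ?thesis using ent_op[OF c'(1) in' V True] by simp
  next
    case False
    then show ?thesis using op_psi_noninj[OF c'(1) in' V False] by (simp add: psi_def)
  qed
  have "(\<Sum>L'\<in>Pow (circ ?S1). ent S c (cl S ` W) L' * ent ?S1 c' L' L'') =
        (\<Sum>L'\<in>Pow (circ ?S1). op S c (psi ?S1 L') W * ent ?S1 c' L' L'')"
    by (simp add: ent_op[OF c W])
  also have "\<dots> = op S c (\<lambda>V. \<Sum>L'\<in>Pow (circ ?S1). psi ?S1 L' V * ent ?S1 c' L' L'') W"
    by (simp add: op_def sum.distrib sum_distrib_left algebra_simps)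
  also have "\<dots> = op S c (op ?S1 c' (psi (insert c' ?S1) L'')) W"
    using inner[OF W(1)] inner[of "insert (a c) W"] inner[of "insert (b c) W"] W abD[OF c(1)]
    by (simp add: op_def)
  finally show ?thesis .
qed

section \<open>Commutativity of the squares of the cube\<close>

definition point_op :: "'d \<Rightarrow> ('d set \<Rightarrow> int) \<Rightarrow> 'd set \<Rightarrow> int" where
  "point_op z f W = of_bool (z \<notin> W) * f (insert z W)"

lemma point_op_commute: "point_op z (point_op z' f) W = point_op z' (point_op z f) W"
  by (auto simp: point_op_def of_bool_def insert_commute)

lemma point_op_add: "point_op z (\<lambda>W. f W + g W) W = point_op z f W + point_op z g W"
  by (simp add: point_op_def algebra_simps)

lemma op_point_op: "op S c f = (if cl S (a c) = cl S (b c) then (\<lambda>W. point_op (a c) f W + point_op (b c) f W) else f)"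
  by (rule ext) (simp add: op_def point_op_def)

lemma point_op_psi_cong: "cl S z = cl S z' \<Longrightarrow> point_op z (psi S L) W = point_op z' (psi S L) W"
  unfolding point_op_def insert_psi by simp

text \<open>Gluing at \<open>c\<close> identifies no circles except those of \<open>a c\<close> and
  \<open>b c\<close>. If it joins the ends of \<open>c'\<close>, these must already lie on the same
  two circles.\<close>

lemma same_pair:
  assumes c: "c \<in> {1..n}" "c' \<in> {1..n}"
    and ne: "cl F (a c) \<noteq> cl F (b c)" "cl F (a c') \<noteq> cl F (b c')"
    and e: "cl (flip c F) (a c') = cl (flip c F) (b c')"
  shows "{cl F (a c), cl F (b c)} = {cl F (a c'), cl F (b c')}"
proof -
  have "gm F c (cl F (a c')) = gm F c (cl F (b c'))"
    using e glue_gm[OF c(1) ne(1)] abD[OF c(2)] by simp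
  moreover have "cl F (a c') \<noteq> cl F (a c) \<union> cl F (b c)" "cl F (b c') \<noteq> cl F (a c) \<union> cl F (b c)"
    using glue_new[OF c(1) ne(1)] cl_in_circ abD[OF c(2)] by metis+
  ultimately show ?thesis using ne(2) unfolding gm_def by (rule pair_collapse)
qed

text \<open>Both paths from \<open>S\<close> to \<open>S2\<close> change the number of circles by
  the same amount, so they contain equally many splits. The same crossings split on both paths
  except in the last two cases; there the factors have to be compared on circles of
  \<open>S2\<close>.\<close>

lemma op_commute:
  assumes c: "c \<in> {1..n}" "c \<notin> S" and c': "c' \<in> {1..n}" "c' \<notin> S" "c \<noteq> c'"
  defines "S2 \<equiv> insert c' (insert c S)"
  shows "op S c (op (insert c S) c' (psi S2 L)) W = op S c' (op (insert c' S) c (psi S2 L)) W"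
proof -
  have fl: "insert c S = flip c S" "insert c' S = flip c' S" "S2 = flip c' (flip c S)" "S2 = flip c (flip c' S)"
    using c c' by (auto simp: S2_def flip_def)
  let ?f = "psi S2 L"
  have cnt: "(if cl S (a c) = cl S (b c) then 1 else - 1 :: int)
      + (if cl (insert c S) (a c') = cl (insert c S) (b c') then 1 else - 1)
    = (if cl S (a c') = cl S (b c') then 1 else - 1)
      + (if cl (insert c' S) (a c) = cl (insert c' S) (b c) then 1 else - 1)"
    using card_circ[OF c(1), of S] card_circ[OF c'(1), of "flip c S"]
      card_circ[OF c'(1), of S] card_circ[OF c(1), of "flip c' S"] fl by simp
  have pair_sum: "point_op (a c) ?f W + point_op (b c) ?f W = point_op (a c') ?f W + point_op (b c') ?f W"
    if "{cl S2 (a c), cl S2 (b c)} = {cl S2 (a c'), cl S2 (b c')}"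
  proof -
    have "cl S2 (a c) = cl S2 (a c') \<and> cl S2 (b c) = cl S2 (b c')
       \<or> cl S2 (a c) = cl S2 (b c') \<and> cl S2 (b c) = cl S2 (a c')"
      using that by (auto simp: doubleton_eq_iff)
    then show ?thesis using point_op_psi_cong by (metis add.commute)
  qed
  consider "cl S (a c) = cl S (b c)" "cl (insert c S) (a c') = cl (insert c S) (b c')"
       "cl S (a c') = cl S (b c')" "cl (insert c' S) (a c) = cl (insert c' S) (b c)"
    | "cl S (a c) \<noteq> cl S (b c)" "cl (insert c S) (a c') \<noteq> cl (insert c S) (b c')"
       "cl S (a c') \<noteq> cl S (b c')" "cl (insert c' S) (a c) \<noteq> cl (insert c' S) (b c)"
    | "cl S (a c) \<noteq> cl S (b c)" "cl (insert c S) (a c') = cl (insert c S) (b c')"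
       "cl S (a c') = cl S (b c')" "cl (insert c' S) (a c) \<noteq> cl (insert c' S) (b c)"
    | "cl S (a c) = cl S (b c)" "cl (insert c S) (a c') \<noteq> cl (insert c S) (b c')"
       "cl S (a c') \<noteq> cl S (b c')" "cl (insert c' S) (a c) = cl (insert c' S) (b c)"
    | "cl S (a c) \<noteq> cl S (b c)" "cl (insert c S) (a c') = cl (insert c S) (b c')"
       "cl S (a c') \<noteq> cl S (b c')" "cl (insert c' S) (a c) = cl (insert c' S) (b c)"
    | "cl S (a c) = cl S (b c)" "cl (insert c S) (a c') \<noteq> cl (insert c S) (b c')"
       "cl S (a c') = cl S (b c')" "cl (insert c' S) (a c) \<noteq> cl (insert c' S) (b c)"
    using cnt by (auto split: if_splits)
  then show ?thesis
  proof cases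
    case 1
    then show ?thesis
      by (simp add: op_point_op point_op_add point_op_commute[of "a c'"] point_op_commute[of "b c'"])
  next
    case 2
    then show ?thesis by (simp add: op_point_op)
  next
    case 3
    then show ?thesis by (simp add: op_point_op)
  next
    case 4
    then show ?thesis by (simp add: op_point_op)
  next
    case 5
    \<comment> \<open>Merge, then split at the other crossing: in \<open>S2\<close> both crossings
      touch the same two circles, so the two factors agree.\<close>
    have "cl S2 (a c') \<noteq> cl S2 (b c')" "cl S2 (a c) \<noteq> cl S2 (b c)"
      using 5 toggle[OF c'(1), of "flip c S"] toggle[OF c(1), of "flip c' S"] fl by auto
    moreover have "cl (flip c' S2) (a c) = cl (flip c' S2) (b c)"
      using 5 toggle[OF c(1), of S] fl by simp
    ultimately have "{cl S2 (a c'), cl S2 (b c')} = {cl S2 (a c), cl S2 (b c)}"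
      by (intro same_pair c c')
    then show ?thesis using 5 pair_sum by (simp add: op_point_op)
  next
    case 6
    \<comment> \<open>Split, then merge at the other crossing: the merge reunites the two circles
      just created, so both factors are twice the same variable.\<close>
    let ?F = "flip c S"
    have ne: "cl ?F (a c) \<noteq> cl ?F (b c)" "cl ?F (a c') \<noteq> cl ?F (b c')"
      using 6 toggle[OF c(1), of S] fl by auto
    moreover have "cl (flip c ?F) (a c') = cl (flip c ?F) (b c')" using 6 by simp
    ultimately have p: "{cl ?F (a c), cl ?F (b c)} = {cl ?F (a c'), cl ?F (b c')}"
      by (intro same_pair c c')
    have "cl S2 x = gm ?F c' (cl ?F x)" if "x \<in> D" for x
      using glue_gm[OF c'(1) ne(2) that] fl by simp
    then have "cl S2 (a c) = cl S2 (a c')" "cl S2 (b c) = cl S2 (b c')"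
      using p abD[OF c(1)] abD[OF c'(1)] unfolding gm_def by (auto simp: doubleton_eq_iff)
    then show ?thesis using 6 pair_sum by (simp add: op_point_op)
  qed
qed

text \<open>Every label set is represented by some monomial \<open>W\<close>, choosing one point on
  each of its circles.\<close>

lemma ent_commute:
  assumes c: "c \<in> {1..n}" "c \<notin> S" and c': "c' \<in> {1..n}" "c' \<notin> S" "c \<noteq> c'" and L: "L \<subseteq> circ S"
  shows "(\<Sum>L'\<in>Pow (circ (insert c S)). ent S c L L' * ent (insert c S) c' L' L'')
    = (\<Sum>L'\<in>Pow (circ (insert c' S)). ent S c' L L' * ent (insert c' S) c L' L'')"
proof -
  obtain W where W: "W \<subseteq> D" "inj_on (cl S) W" "L = cl S ` W"
    using L subset_image_inj[of L "cl S" D] by (auto simp: circ_def)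
  show ?thesis
    unfolding W(3) using ent_comp[OF c c' W(1,2)] ent_comp[OF c' (1,2) c not_sym[OF c'(3)] W(1,2)]
      op_commute[OF c c'] by (simp add: insert_commute)
qed

text \<open>The reduced generators span a subcomplex: a product with x is x or 0, and a split of x
  labels both new circles.\<close>

lemma ent_base:
  assumes c: "c \<in> {1..n}" "c \<notin> S" and L: "L \<subseteq> circ S" "cl S base \<in> L" and nz: "ent S c L L' \<noteq> 0"
  shows "cl (insert c S) base \<in> L'"
proof (cases "cl S (a c) = cl S (b c)")
  case False
  then show ?thesis
    using nz ent_merge[OF c False L(1), of L'] glue_gm[OF c(1) False baseD] L(2) c(2)
    by (auto simp: flip_notin split: if_splits)
next
  case e: True
  note sf = split_facts[OF c e]
  have base: "cl S base = (if cl (insert c S) base \<in> {cl (insert c S) (a c), cl (insert c S) (b c)}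
      then cl S (a c) else cl (insert c S) base)"
    using sf(3)[OF baseD] sf(2) by (simp add: gm_def)
  have nb: "cl (insert c S) base \<noteq> cl S (a c)" using sf(6) cl_in_circ[OF baseD] by metis
  show ?thesis
  proof (cases "cl S (a c) \<in> L")
    case True
    then have "L' = insert (cl (insert c S) (a c)) (insert (cl (insert c S) (b c)) (L - {cl S (a c)}))"
      using nz by (simp add: ent_split[OF c e])
    then show ?thesis using base nb L(2) by (cases "cl (insert c S) base \<in> {cl (insert c S) (a c), cl (insert c S) (b c)}") auto
  next
    case False
    then have "cl (insert c S) base \<in> L" using base L(2) by metis
    moreover have "L \<subseteq> L'"
      using nz False by (auto simp: ent_split[OF c e] of_bool_def split: if_splits)
    ultimately show ?thesis by blast
  qed
qed

text \<open>The count behind the quantum grading: a split adds a circle, an x and a B-smoothing,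
  contributing 1 - 2 + 1; a merge contributes -1 + 1.\<close>

lemma ent_card:
  assumes c: "c \<in> {1..n}" "c \<notin> S" and L: "L \<subseteq> circ S" and nz: "ent S c L L' \<noteq> 0"
  shows "card L' = card L + of_bool (cl S (a c) = cl S (b c))"
proof (cases "cl S (a c) = cl S (b c)")
  case False
  then show ?thesis using nz ent_merge[OF c False L, of L'] by (auto simp: card_image)
next
  case e: True
  note sf = split_facts[OF c e]
  have fin: "finite L" using L finite_circ finite_subset by blast
  define A where "A = cl (insert c S) (a c)"
  define B where "B = cl (insert c S) (b c)"
  have n: "A \<noteq> B" "A \<notin> L" "B \<notin> L" using sf L by (auto simp: A_def B_def)
  show ?thesis
  proof (cases "cl S (a c) \<in> L")
    case C: True
    then have "L' = insert A (insert B (L - {cl S (a c)}))"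
      using nz unfolding A_def B_def by (simp add: ent_split[OF c e])
    moreover have "card (L - {cl S (a c)}) = card L - 1" "card L > 0"
      using C fin card_gt_0_iff by (auto simp: card_Diff_singleton)
    ultimately show ?thesis using n fin e by simp
  next
    case False
    then have "L' = insert A L \<or> L' = insert B L"
      using nz False unfolding A_def B_def by (auto simp: ent_split[OF c e] of_bool_def split: if_splits)
    then show ?thesis using n fin e by auto
  qed
qed

section \<open>Degrees, signs and the square of the differential\<close>

lemma dK_deg:
  assumes "dK g g' \<noteq> 0"
  shows "deg g' = (fst (deg g) + 1, snd (deg g))"
  using assms
proof (rule dK_nonzeroE)
  fix S c L L'
  assume h: "g = (S, L)" "g' = (insert c S, L')" "c \<in> {1..n}" "c \<notin> S"
    "(S, L) \<in> gens" "(insert c S, L') \<in> gens" "ent S c L L' \<noteq> 0"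
  have "finite S" "L \<subseteq> circ S" using h finite_subset[of S "{1..n}"] by (auto simp: gens_def)
  then show ?thesis
    using h(1,2) ent_card[OF h(3,4) _ h(7)] card_circ[OF h(3), of S] h(4) by (simp add: deg_def flip_notin)
qed

lemma sg_commute:
  assumes "finite S" "c \<notin> S" "c' \<notin> S" "c \<noteq> c'"
  shows "sg S c * sg (insert c S) c' = - (sg S c' * sg (insert c' S) c)"
proof -
  have *: "sg S c * sg (insert c S) c' = - (sg S c' * sg (insert c' S) c)"
    if "c < c'" "c \<notin> S" "c' \<notin> S" for c c'
  proof -
    have "{x \<in> insert c S. x < c'} = insert c {x \<in> S. x < c'}" "{x \<in> insert c' S. x < c} = {x \<in> S. x < c}"
      using that by auto
    then show ?thesis using that assms(1) by (simp add: sg_def)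
  qed
  show ?thesis
  proof (cases "c < c'")
    case True then show ?thesis using * assms by blast
  next
    case False
    then have "c' < c" using assms(4) by auto
    then show ?thesis using *[of c' c] assms by simp
  qed
qed

lemma dK_square: "mat_comp gens dK dK = 0"
proof (intro ext)
  fix x z
  show "mat_comp gens dK dK x z = 0 x z"
  proof (rule ccontr)
    assume nz: "mat_comp gens dK dK x z \<noteq> 0 x z"
    then have "mat_comp gens dK dK x z \<noteq> 0" by simp
    then obtain y where y: "dK x y \<noteq> 0" "dK y z \<noteq> 0" by (rule mc_nonzeroE)
    from y(1) obtain S c L L1 where h: "x = (S, L)" "y = (insert c S, L1)" "c \<in> {1..n}" "c \<notin> S"
      "(S, L) \<in> gens" "(insert c S, L1) \<in> gens" by (rule dK_nonzeroE)
    from y(2) h(2) obtain c' L2 where h': "z = (insert c' (insert c S), L2)" "c' \<in> {1..n}" "c' \<notin> insert c S"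
      "(insert c' (insert c S), L2) \<in> gens" by (elim dK_nonzeroE) auto
    have L: "L \<subseteq> circ S" "cl S base \<in> L" and S: "S \<subseteq> {1..n}" and fS: "finite S"
      using h(5) finite_subset[of S "{1..n}"] by (auto simp: gens_def)
    have part: "(\<Sum>y\<in>{y\<in>gens. fst y = insert k S}. dK x y * dK y z)
       = sg S k * sg (insert k S) l * (\<Sum>L'\<in>Pow (circ (insert k S)). ent S k L L' * ent (insert k S) l L' L2)"
      if kl: "k \<in> {1..n}" "l \<in> {1..n}" "k \<notin> S" "l \<notin> insert k S" "z = (insert l (insert k S), L2)" for k l
    proof -
      let ?T = "{L' \<in> Pow (circ (insert k S)). cl (insert k S) base \<in> L'}"
      have g: "(insert l (insert k S), L2) \<in> gens" using h' kl by simp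
      have eq: "{y\<in>gens. fst y = insert k S} = Pair (insert k S) ` ?T"
        using S kl by (auto simp: gens_def)
      have "(\<Sum>y\<in>{y\<in>gens. fst y = insert k S}. dK x y * dK y z) =
        (\<Sum>L'\<in>?T. dK x (insert k S, L') * dK (insert k S, L') z)"
        unfolding eq by (subst sum.reindex) (auto simp: inj_on_def)
      also have "\<dots> = (\<Sum>L'\<in>?T. sg S k * sg (insert k S) l * (ent S k L L' * ent (insert k S) l L' L2))"
      proof (rule sum.cong[OF refl])
        fix L' assume "L' \<in> ?T"
        then have "(insert k S, L') \<in> gens" using S kl by (auto simp: gens_def)
        then show "dK x (insert k S, L') * dK (insert k S, L') z
            = sg S k * sg (insert k S) l * (ent S k L L' * ent (insert k S) l L' L2)"
          using dK_eq[OF kl(1,3) h(5)] dK_eq[OF kl(2,4) _ g] kl(5) h(1) by simp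
      qed
      also have "\<dots> = sg S k * sg (insert k S) l * (\<Sum>L'\<in>?T. ent S k L L' * ent (insert k S) l L' L2)"
        by (simp add: sum_distrib_left)
      \<comment> \<open>\<open>ent_commute\<close> sums over all labellings. Those without x on the
        base circle may be added, as \<open>ent_base\<close> gives them coefficient zero.\<close>
      also have "(\<Sum>L'\<in>?T. ent S k L L' * ent (insert k S) l L' L2)
         = (\<Sum>L'\<in>Pow (circ (insert k S)). ent S k L L' * ent (insert k S) l L' L2)"
        using ent_base[OF kl(1,3) L] by (intro sum.mono_neutral_left) (auto simp: finite_circ)
      finally show ?thesis .
    qed
    have off: "dK x y * dK y z = 0" if "y \<in> gens" "fst y \<noteq> insert c S" "fst y \<noteq> insert c' S" for y
    proof (rule ccontr)
      assume "dK x y * dK y z \<noteq> 0"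
      then have nz: "dK x y \<noteq> 0" "dK y z \<noteq> 0" by auto
      from nz(1) h(1) obtain k where k: "fst y = insert k S" "k \<notin> S" by (elim dK_nonzeroE) auto
      from nz(2) h' obtain l where l: "insert c' (insert c S) = insert l (fst y)" by (elim dK_nonzeroE) auto
      then have "k = c \<or> k = c'" using k by auto
      then show False using that k by auto
    qed
    have dj: "{y\<in>gens. fst y = insert c S} \<inter> {y\<in>gens. fst y = insert c' S} = {}"
      using h h' by auto
    have "mat_comp gens dK dK x z = (\<Sum>y\<in>{y\<in>gens. fst y = insert c S} \<union> {y\<in>gens. fst y = insert c' S}. dK x y * dK y z)"
      unfolding mat_comp_def using off by (intro sum.mono_neutral_right) (auto simp: finite_gens)
    also have "\<dots> = (\<Sum>y\<in>{y\<in>gens. fst y = insert c S}. dK x y * dK y z) + (\<Sum>y\<in>{y\<in>gens. fst y = insert c' S}. dK x y * dK y z)"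
      using dj finite_gens by (subst sum.union_disjoint) auto
    also have "\<dots> = 0"
      using part[of c c'] part[of c' c] h h' ent_commute[OF h(3,4) h'(2) _ _ L(1), of L2] sg_commute[OF fS h(4), of c']
      by (simp add: insert_commute)
    finally show False using nz by simp
  qed
qed

lemma complex_dK: "complex gens deg dK"
  using finite_gens dK_deg dK_square by (auto simp: complex_def mat_on_def dK_def split: if_splits)

end

section \<open>Non-crossing chords\<close>

text \<open>A set of generators that no two-arrow path leaves and re-enters spans a subquotient.
  Both sides of a cone are of this kind.\<close>

lemma complex_blk:
  assumes cx: "complex G dg d" and A: "A \<subseteq> G"
    and convex: "\<And>x y z. x \<in> A \<Longrightarrow> y \<in> G - A \<Longrightarrow> z \<in> A \<Longrightarrow> d x y * d y z = 0"
  shows "complex A dg (blk A A d)"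
proof -
  have fin: "finite G" "finite A" and dd: "mat_comp G d d = 0"
    and deg: "\<And>x y. d x y \<noteq> 0 \<Longrightarrow> dg y = (fst (dg x) + 1, snd (dg x))"
    using cx A finite_subset by (auto simp: complex_def)
  have "mat_comp A (blk A A d) (blk A A d) x z = 0" for x z
  proof (cases "x \<in> A \<and> z \<in> A")
    case True
    have "mat_comp A (blk A A d) (blk A A d) x z = (\<Sum>y\<in>A. d x y * d y z)"
      unfolding mat_comp_def using True by (intro sum.cong) (auto simp: blk_def)
    also have "\<dots> = (\<Sum>y\<in>G. d x y * d y z)"
      using fin A convex True by (intro sum.mono_neutral_left) blast+
    also have "\<dots> = 0" using fun_cong[OF fun_cong[OF dd, of x], of z] by (simp add: mat_comp_def)
    finally show ?thesis .
  qed (auto simp: mat_comp_def blk_def)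
  then show ?thesis
    using fin deg by (auto simp: complex_def mat_on_blk blk_def fun_eq_iff split: if_splits)
qed

lemma blk_blk: "A \<subseteq> A' \<Longrightarrow> B \<subseteq> B' \<Longrightarrow> blk A B (blk A' B' M) = blk A B M"
  by (auto simp: blk_def fun_eq_iff)

definition symd :: "nat set \<Rightarrow> nat set \<Rightarrow> nat set" where "symd F S = (S - F) \<union> (F - S)"

lemma symd_empty [simp]: "symd {} S = S" by (simp add: symd_def)
lemma symd_insert: "c \<notin> F \<Longrightarrow> symd (insert c F) S = flip c (symd F S)" by (auto simp: symd_def flip_def)
lemma symd_flip: "c \<in> F \<Longrightarrow> symd (F - {c}) (flip c S) = symd F S" by (auto simp: symd_def flip_def)
lemma flip_subset: "c \<in> N \<Longrightarrow> S \<subseteq> N \<Longrightarrow> flip c S \<subseteq> N" by (auto simp: flip_def)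

context circle_system
begin

lemma cl_flip_away:
  assumes c: "c \<in> {1..n}" and x: "x \<in> D" and aw: "a c \<notin> cl S x" "b c \<notin> cl S x"
  shows "cl (flip c S) x = cl S x"
proof (cases "cl S (a c) = cl S (b c)")
  case False
  have "x \<notin> cl S (a c)" "x \<notin> cl S (b c)"
    using aw cl_mem_iff[OF x abD(1)[OF c]] cl_mem_iff[OF x abD(2)[OF c]]
      cl_mem_iff[OF abD(1)[OF c] x] cl_mem_iff[OF abD(2)[OF c] x] by auto
  then show ?thesis using glue[OF c False x] by simp
next
  case True
  then have ne: "cl (flip c S) (a c) \<noteq> cl (flip c S) (b c)" using toggle[OF c] by simp
  have "cl S x = gm (flip c S) c (cl (flip c S) x)" using glue_gm[OF c ne x] by simp
  moreover have "a c \<in> cl (flip c S) (a c)" using cl_refl abD c by blast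
  ultimately show ?thesis using aw by (auto simp: gm_def split: if_splits)
qed

lemma cl_stable:
  assumes "finite F" "F \<subseteq> {1..n}" "x \<in> D" "\<And>c. c \<in> F \<Longrightarrow> a c \<notin> cl S x \<and> b c \<notin> cl S x"
  shows "cl (symd F S) x = cl S x"
  using assms
proof (induction F rule: finite_induct)
  case (insert c F)
  then show ?case by (simp add: symd_insert cl_flip_away)
qed simp

lemma cl_agree:
  assumes "S \<subseteq> {1..n}" "T \<subseteq> {1..n}" "x \<in> D"
    and "\<And>c. c \<in> {1..n} \<Longrightarrow> (c \<in> S) \<noteq> (c \<in> T) \<Longrightarrow> a c \<notin> cl S x \<and> b c \<notin> cl S x"
  shows "cl T x = cl S x"
proof -
  have "T = symd ((S - T) \<union> (T - S)) S" by (auto simp: symd_def)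
  also have "cl \<dots> x = cl S x"
  proof (rule cl_stable)
    show "finite ((S - T) \<union> (T - S))" using assms(1,2) finite_subset[of _ "{1..n}"] by blast
  qed (use assms in blast)+
  finally show ?thesis .
qed

lemma flip_split:
  assumes c: "c \<in> {1..n}" and e: "cl S (a c) = cl S (b c)"
  shows "cl (flip c S) (a c) \<noteq> cl (flip c S) (b c)"
    and "cl S (a c) = cl (flip c S) (a c) \<union> cl (flip c S) (b c)"
    and "x \<in> D \<Longrightarrow> cl S x = gm (flip c S) c (cl (flip c S) x)"
proof -
  show ne: "cl (flip c S) (a c) \<noteq> cl (flip c S) (b c)" using toggle[OF c] e by simp
  show gm: "cl S x = gm (flip c S) c (cl (flip c S) x)" if "x \<in> D" for x
    using glue_gm[OF c ne that] by simp
  show "cl S (a c) = cl (flip c S) (a c) \<union> cl (flip c S) (b c)"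
    using gm[OF abD(1)[OF c]] by (simp add: gm_def)
qed

text \<open>Only circles through the changed crossing can acquire a label x; zigzags at a kink are
  excluded by this.\<close>

lemma ent_new:
  assumes c: "c \<in> {1..n}" "c \<notin> S" and nz: "ent S c L L' \<noteq> 0"
  shows "L' \<subseteq> L \<union> {cl (insert c S) (a c), cl (insert c S) (b c)}"
proof (cases "cl S (a c) = cl S (b c)")
  case False
  then show ?thesis using nz by (auto simp: ent_def Let_def of_bool_def split: if_splits)
next
  case e: True
  then show ?thesis using nz by (auto simp: ent_split[OF c e] of_bool_def split: if_splits)
qed

definition piece where
  "piece X \<Lambda> Z W = {(S, L) \<in> gens. (\<forall>i\<in>{1..n} - \<Lambda>. i \<in> S \<longleftrightarrow> i \<in> X) \<and> {C \<in> L. C \<subseteq> Z} = W}"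

text \<open>Outside \<open>Z\<close> the state \<open>X\<close> is a single circle, and the chords \<open>\<Lambda>\<close> on it do not cross;
  the circles inside \<open>Z\<close> are finished, with \<open>W\<close> the set of those labelled \<open>x\<close>.\<close>
definition bouquet where
  "bouquet X \<Lambda> Z W \<longleftrightarrow> X \<subseteq> {1..n} \<and> \<Lambda> \<subseteq> {1..n} \<and> Z \<subseteq> D \<and> base \<notin> Z
     \<and> (\<forall>i\<in>\<Lambda>. a i \<notin> Z \<and> b i \<notin> Z)
     \<and> (\<forall>x\<in>Z. cl X x \<subseteq> Z) \<and> W \<subseteq> cl X ` Z \<and> (\<forall>x\<in>D - Z. cl X x = D - Z)
     \<and> (\<forall>i\<in>\<Lambda>. \<forall>j\<in>\<Lambda>. i \<noteq> j \<longrightarrow> cl (flip j X) (a i) = cl (flip j X) (b i))"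

text \<open>Switching \<open>i\<close> cuts the circle \<open>D - Z\<close> in two. The trunk keeps
  the base point, whose label is forced, so the other part can serve as the kink circle, whose label
  is free.\<close>

definition side where
  "side X i = (if base \<in> cl (flip i X) (a i) then cl (flip i X) (b i) else cl (flip i X) (a i))"
definition trunk where
  "trunk X i = (if base \<in> cl (flip i X) (a i) then cl (flip i X) (a i) else cl (flip i X) (b i))"

lemma side_trunk:
  assumes q: "bouquet X \<Lambda> Z W" and i: "i \<in> \<Lambda>"
  shows "cl X (a i) = cl X (b i)" "base \<notin> side X i" "base \<in> trunk X i"
    "side X i \<union> trunk X i = D - Z" "side X i \<inter> trunk X i = {}"
    "{side X i, trunk X i} = {cl (flip i X) (a i), cl (flip i X) (b i)}"
    "x \<in> side X i \<Longrightarrow> cl (flip i X) x = side X i"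
    "x \<in> trunk X i \<Longrightarrow> cl (flip i X) x = trunk X i"
    "(a i \<in> side X i \<and> b i \<in> trunk X i) \<or> (a i \<in> trunk X i \<and> b i \<in> side X i)"
proof -
  have iN: "i \<in> {1..n}" using q i by (auto simp: bouquet_def)
  have ab: "a i \<in> D - Z" "b i \<in> D - Z" using q i abD[OF iN] by (auto simp: bouquet_def)
  then have cl: "cl X (a i) = D - Z" "cl X (b i) = D - Z" using q by (auto simp: bouquet_def)
  then show e: "cl X (a i) = cl X (b i)" by simp
  note fs = flip_split[OF iN e]
  have u: "cl (flip i X) (a i) \<union> cl (flip i X) (b i) = D - Z" using fs(2) cl by simp
  have dj: "cl (flip i X) (a i) \<inter> cl (flip i X) (b i) = {}"
    using fs(1) circ_disjoint[OF cl_in_circ cl_in_circ, of "a i" "b i"] abD[OF iN] by blast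
  have bz: "base \<in> D - Z" using q baseD by (auto simp: bouquet_def)
  show "base \<notin> side X i" "base \<in> trunk X i" using u dj bz by (auto simp: side_def trunk_def)
  show "side X i \<union> trunk X i = D - Z" "side X i \<inter> trunk X i = {}"
     "{side X i, trunk X i} = {cl (flip i X) (a i), cl (flip i X) (b i)}"
    using u dj by (auto simp: side_def trunk_def)
  show "x \<in> side X i \<Longrightarrow> cl (flip i X) x = side X i" "x \<in> trunk X i \<Longrightarrow> cl (flip i X) x = trunk X i"
    unfolding side_def trunk_def by (metis cl_eqI abD[OF iN])+
  show "(a i \<in> side X i \<and> b i \<in> trunk X i) \<or> (a i \<in> trunk X i \<and> b i \<in> side X i)"
    unfolding side_def trunk_def using cl_refl[OF abD(1)[OF iN]] cl_refl[OF abD(2)[OF iN]] by metis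
qed

text \<open>If a chord \<open>j\<close> had its ends on the side cut off by \<open>i\<close>, it would cut off a smaller side.\<close>
lemma leaf_exists:
  assumes q: "bouquet X \<Lambda> Z W" and ne: "\<Lambda> \<noteq> {}"
  obtains i where "i \<in> \<Lambda>" "\<And>j. j \<in> \<Lambda> \<Longrightarrow> j \<noteq> i \<Longrightarrow> a j \<notin> side X i \<and> b j \<notin> side X i"
proof -
  obtain i where i: "i \<in> \<Lambda>" and min: "\<And>j. j \<in> \<Lambda> \<Longrightarrow> card (side X i) \<le> card (side X j)"
    using ex_has_least_nat[of "\<lambda>i. i \<in> \<Lambda>" _ "\<lambda>i. card (side X i)"] ne by blast
  have LN: "\<Lambda> \<subseteq> {1..n}" using q by (simp add: bouquet_def)
  note st = side_trunk[OF q i]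
  have iN: "i \<in> {1..n}" using i LN by blast
  have "a j \<notin> side X i \<and> b j \<notin> side X i" if j: "j \<in> \<Lambda>" "j \<noteq> i" for j
  proof (rule ccontr)
    assume "\<not> ?thesis"
    then have in1: "a j \<in> side X i \<or> b j \<in> side X i" by blast
    have jN: "j \<in> {1..n}" using j LN by blast
    define Y where "Y = flip j (flip i X)"
    have Y': "Y = flip i (flip j X)" by (simp add: Y_def flip_commute)
    have eqj: "cl (flip i X) (a j) = cl (flip i X) (b j)" using q i j by (auto simp: bouquet_def)
    have eqi: "cl (flip j X) (a i) = cl (flip j X) (b i)" using q i j by (auto simp: bouquet_def)
    have sub: "side X i \<subseteq> D" using st(4) by blast
    have sj: "cl (flip i X) (a j) = side X i" using in1 st(7) eqj by metis
    note fj = flip_split[OF jN eqj, folded Y_def]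
    note fi = flip_split[OF iN eqi, folded Y']
    define A where "A = cl Y (a j)"
    define B where "B = cl Y (b j)"
    have AB: "A \<noteq> B" "side X i = A \<union> B" using fj(1,2) sj by (auto simp: A_def B_def)
    have ABd: "A \<inter> B = {}"
      using AB(1) circ_disjoint[OF cl_in_circ cl_in_circ, of "a j" "b j"] abD[OF jN] unfolding A_def B_def by blast
    have nA: "a j \<in> A" "b j \<in> B" using cl_refl abD[OF jN] by (auto simp: A_def B_def)
    have clY: "cl Y x = trunk X i" if "x \<in> trunk X i" for x
    proof -
      have "x \<in> D" using that st(4) by blast
      moreover have "a j \<in> side X i" "b j \<in> side X i" using AB nA by auto
      ultimately show ?thesis unfolding Y_def using st(8)[OF that] st(5)
        by (subst cl_flip_away[OF jN]) auto
    qed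
    have clYs: "cl Y x = (if x \<in> A then A else B)" if "x \<in> side X i" for x
      using that AB cl_eqI[of "a j" x Y] cl_eqI[of "b j" x Y] abD[OF jN] by (auto simp: A_def B_def)
    obtain s r where sr: "s \<in> side X i" "r \<in> trunk X i" "{a i, b i} = {s, r}" using st(9) by blast
    have sr': "(a i = s \<and> b i = r) \<or> (a i = r \<and> b i = s)" using sr(3) by (auto simp: doubleton_eq_iff)
    have glX: "cl (flip j X) x = (if cl Y x = cl Y s \<or> cl Y x = trunk X i then cl Y s \<union> trunk X i else cl Y x)" if "x \<in> D" for x
      using sr'
    proof (elim disjE conjE)
      assume "a i = s" "b i = r"
      then show ?thesis using fi(3)[OF that] clY[OF sr(2)] by (simp add: gm_def)
    next
      assume "a i = r" "b i = s"
      then show ?thesis using fi(3)[OF that] clY[OF sr(2)] by (simp add: gm_def Un_commute disj_commute)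
    qed
    have tAB: "trunk X i \<noteq> A" "trunk X i \<noteq> B" using nA AB st(5) by blast+
    \<comment> \<open>With \<open>i\<close> and \<open>j\<close> both switched the circles outside
      \<open>Z\<close> are \<open>A\<close>, \<open>B\<close> and the trunk of \<open>i\<close>.
      Switching \<open>i\<close> back attaches to that trunk the one of \<open>A\<close>,
      \<open>B\<close> that contains the end \<open>s\<close> of \<open>i\<close>; the other one is
      the side of \<open>j\<close>.\<close>
    have sidej: "side X j = (if s \<in> A then B else A)"
    proof (cases "s \<in> A")
      case True
      then have "cl (flip j X) (a j) = A \<union> trunk X i" "cl (flip j X) (b j) = B"
        using clYs[OF sr(1)] AB(1) tAB
        by (simp_all add: glX[OF abD(1)[OF jN]] glX[OF abD(2)[OF jN]] A_def[symmetric] B_def[symmetric] eq_commute[of B])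
      then show ?thesis using True st(3) by (simp add: side_def)
    next
      case False
      then have "cl (flip j X) (b j) = B \<union> trunk X i" "cl (flip j X) (a j) = A"
        using clYs[OF sr(1)] AB(1) tAB
        by (simp_all add: glX[OF abD(1)[OF jN]] glX[OF abD(2)[OF jN]] A_def[symmetric] B_def[symmetric] eq_commute[of A])
      moreover have "base \<notin> A" using st(2) AB(2) by auto
      ultimately show ?thesis using False by (simp add: side_def)
    qed
    have "side X j \<subset> side X i" unfolding sidej using AB nA ABd by (auto split: if_splits)
    then have "card (side X j) < card (side X i)"
      using finite_subset[OF sub finD] by (rule psubset_card_mono[rotated])
    then show False using min[OF j(1)] by simp
  qed
  then show ?thesis using that i by blast
qed

end

lemma swap_up:
  assumes "cS = insert C (cT - {B, r})" "C \<notin> cT" "B \<noteq> r" "r \<in> cT" "B \<in> cT" "L \<subseteq> cS"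
    and "u = (if C \<in> L then insert r (L - {C}) else L)"
  shows "u \<subseteq> cT \<and> B \<notin> u \<and> (if r \<in> u then insert C (u - {r}) else u) = L"
  using assms by (cases "C \<in> L") auto

lemma swap_down:
  assumes "cS = insert C (cT - {B, r})" "C \<notin> cT" "B \<noteq> r" "M \<subseteq> cT" "B \<notin> M"
    and "d = (if r \<in> M then insert C (M - {r}) else M)"
  shows "d \<subseteq> cS \<and> (if C \<in> d then insert r (d - {C}) else d) = M"
  using assms by (cases "r \<in> M") auto

section \<open>Removal of an outermost kink\<close>

context circle_system
begin

text \<open>With \<open>i\<close> switched, the kink circle \<open>side X i\<close> is attached at
  \<open>i\<close> to the circle \<open>rho X i T\<close>, and merging the two gives
  \<open>joint X i T\<close>. The maps \<open>dn\<close> and \<open>up\<close> rename one into the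
  other in a label set: \<open>dn\<close> is multiplication by a kink labelled 1, and
  \<open>up\<close> its inverse.\<close>

definition "rho X i T = (if a i \<in> side X i then cl T (b i) else cl T (a i))"
definition "joint X i T = side X i \<union> rho X i T"
definition "dn X i T M = (if rho X i T \<in> M then insert (joint X i T) (M - {rho X i T}) else M)"
definition "up X i T L = (if joint X i T \<in> L then insert (rho X i T) (L - {joint X i T}) else L)"

definition leaf where
  "leaf X \<Lambda> Z W i \<longleftrightarrow> bouquet X \<Lambda> Z W \<and> i \<in> \<Lambda> \<and> (\<forall>j\<in>\<Lambda>. j \<noteq> i \<longrightarrow> a j \<notin> side X i \<and> b j \<notin> side X i)"

definition flipped where
  "flipped X \<Lambda> i T \<longleftrightarrow> T \<subseteq> {1..n} \<and> (\<forall>j\<in>{1..n} - \<Lambda>. j \<in> T \<longleftrightarrow> j \<in> X) \<and> (i \<in> T) \<noteq> (i \<in> X)"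

text \<open>No other open chord has an end on the kink circle of a leaf, so the circle persists
  however the open crossings are smoothed.\<close>

lemma flipped_side:
  assumes l: "leaf X \<Lambda> Z W i" and T: "flipped X \<Lambda> i T" and x: "x \<in> side X i"
  shows "cl T x = side X i"
proof -
  have q: "bouquet X \<Lambda> Z W" and i: "i \<in> \<Lambda>" using l by (auto simp: leaf_def)
  note st = side_trunk[OF q i]
  have "cl T x = cl (flip i X) x"
  proof (rule cl_agree)
    show "flip i X \<subseteq> {1..n}" using q i by (auto simp: bouquet_def flip_def)
    show "x \<in> D" using x st(4) by blast
    show "T \<subseteq> {1..n}" using T by (simp add: flipped_def)
    fix c assume "c \<in> {1..n}" "(c \<in> flip i X) \<noteq> (c \<in> T)"
    then have "c \<noteq> i" "(c \<in> X) \<noteq> (c \<in> T)" using T by (auto simp: flipped_def flip_mem split: if_splits)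
    with \<open>c \<in> {1..n}\<close> have "c \<in> \<Lambda>" "c \<noteq> i" using T unfolding flipped_def by blast+
    then show "a c \<notin> cl (flip i X) x \<and> b c \<notin> cl (flip i X) x" using l st(7)[OF x] by (auto simp: leaf_def)
  qed
  then show ?thesis using st(7)[OF x] by simp
qed

lemma flipped_facts:
  assumes l: "leaf X \<Lambda> Z W i" and T: "flipped X \<Lambda> i T"
  defines "B \<equiv> side X i" and "r \<equiv> rho X i T" and "C \<equiv> joint X i T" and "S \<equiv> flip i T"
  shows "{cl T (a i), cl T (b i)} = {B, r}" "B \<noteq> r" "cl T (a i) \<noteq> cl T (b i)"
    "cl S (a i) = C" "cl S (b i) = C"
    "circ S = insert C (circ T - {B, r})" "C \<notin> circ T" "B \<notin> circ S" "r \<notin> circ S" "B \<in> circ T" "r \<in> circ T"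
    "cl S base = (if cl T base = r then C else cl T base)" "cl T base \<noteq> B"
    "\<not> B \<subseteq> Z" "\<not> r \<subseteq> Z" "\<not> C \<subseteq> Z"
proof -
  have q: "bouquet X \<Lambda> Z W" and i: "i \<in> \<Lambda>" using l by (auto simp: leaf_def)
  note st = side_trunk[OF q i]
  have iN: "i \<in> {1..n}" using q i by (auto simp: bouquet_def)
  note fs = flipped_side[OF l T, folded B_def]
  have ab: "(a i \<in> B \<and> b i \<notin> B \<and> r = cl T (b i)) \<or> (b i \<in> B \<and> a i \<notin> B \<and> r = cl T (a i))"
    using st(5,9) by (auto simp: B_def r_def rho_def)
  have nB: "cl T x \<noteq> B" if "x \<notin> B" "x \<in> D" for x using cl_refl[OF that(2), of T] that(1) by auto
  show p: "{cl T (a i), cl T (b i)} = {B, r}" using ab fs by auto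
  show Br: "B \<noteq> r" using ab nB abD[OF iN] by auto
  show ne: "cl T (a i) \<noteq> cl T (b i)" using ab fs Br by auto
  have C: "C = cl T (a i) \<union> cl T (b i)" using ab fs by (auto simp: C_def joint_def B_def[symmetric] r_def[symmetric])
  have gm: "cl S x = gm T i (cl T x)" if "x \<in> D" for x using glue_gm[OF iN ne that] by (simp add: S_def)
  have gm': "gm T i V = (if V = B \<or> V = r then C else V)" for V
    using p unfolding gm_def C[symmetric] by (auto simp: doubleton_eq_iff)
  show Sa: "cl S (a i) = C" and Sb: "cl S (b i) = C"
    using gm abD[OF iN] C by (auto simp: gm_def)
  show cS: "circ S = insert C (circ T - {B, r})"
    using circ_glue[OF iN ne] unfolding p C[symmetric] S_def .
  show CT: "C \<notin> circ T" using glue_new[OF iN ne] C by simp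
  have "cl T (a i) = B \<and> cl T (b i) = r \<or> cl T (a i) = r \<and> cl T (b i) = B" using ab fs by blast
  then show BT: "B \<in> circ T" and rT: "r \<in> circ T"
    using cl_in_circ[OF abD(1)[OF iN], of T] cl_in_circ[OF abD(2)[OF iN], of T] by metis+
  show "B \<notin> circ S" "r \<notin> circ S" using cS CT BT rT by auto
  show bB: "cl T base \<noteq> B" using nB st(2) baseD by (auto simp: B_def)
  show "cl S base = (if cl T base = r then C else cl T base)" using gm[OF baseD] bB by (simp add: gm')
  have nZ: "a i \<notin> Z" "b i \<notin> Z" using q i by (auto simp: bouquet_def)
  have refl: "a i \<in> cl T (a i)" "b i \<in> cl T (b i)" using cl_refl abD[OF iN] by auto
  show "\<not> B \<subseteq> Z" using ab nZ by auto
  show "\<not> r \<subseteq> Z" using ab nZ refl by auto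
  show "\<not> C \<subseteq> Z" using C nZ refl by auto
qed

lemma dn_up:
  assumes l: "leaf X \<Lambda> Z W i" and T: "flipped X \<Lambda> i T"
  defines "B \<equiv> side X i" and "S \<equiv> flip i T"
  shows "L \<subseteq> circ S \<Longrightarrow> up X i T L \<subseteq> circ T \<and> B \<notin> up X i T L \<and> dn X i T (up X i T L) = L"
    and "M \<subseteq> circ T \<Longrightarrow> B \<notin> M \<Longrightarrow> dn X i T M \<subseteq> circ S \<and> up X i T (dn X i T M) = M"
    and "M \<subseteq> circ T \<Longrightarrow> B \<notin> M \<Longrightarrow> cl S base \<in> dn X i T M \<longleftrightarrow> cl T base \<in> M"
    and "{C \<in> dn X i T M. C \<subseteq> Z} = {C \<in> M. C \<subseteq> Z}"
proof -
  define r where "r = rho X i T"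
  define C where "C = joint X i T"
  note ff = flipped_facts[OF l T, folded B_def r_def C_def S_def]
  have dn: "dn X i T M = (if r \<in> M then insert C (M - {r}) else M)" for M by (simp add: dn_def r_def C_def)
  have up: "up X i T L = (if C \<in> L then insert r (L - {C}) else L)" for L by (simp add: up_def r_def C_def)
  show "L \<subseteq> circ S \<Longrightarrow> up X i T L \<subseteq> circ T \<and> B \<notin> up X i T L \<and> dn X i T (up X i T L) = L"
    unfolding dn[of "up X i T L"] by (rule swap_up[OF ff(6,7,2,11,10) _ up])
  show "M \<subseteq> circ T \<Longrightarrow> B \<notin> M \<Longrightarrow> dn X i T M \<subseteq> circ S \<and> up X i T (dn X i T M) = M"
    unfolding up[of "dn X i T M"] by (rule swap_down[OF ff(6,7,2) _ _ dn])
  show "cl S base \<in> dn X i T M \<longleftrightarrow> cl T base \<in> M" if M: "M \<subseteq> circ T" "B \<notin> M"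
  proof -
    have "C \<notin> M" using M(1) ff(7) by blast
    moreover have "cl T base \<noteq> C" using ff(7) cl_in_circ[OF baseD, of T] by metis
    ultimately show ?thesis unfolding dn ff(12) by (metis Diff_iff empty_iff insert_iff)
  qed
  show "{C \<in> dn X i T M. C \<subseteq> Z} = {C \<in> M. C \<subseteq> Z}" using ff(15,16) unfolding dn by auto
qed

lemma piece_memD:
  assumes "(S, L) \<in> piece X \<Lambda> Z W"
  shows "S \<subseteq> {1..n}" "L \<subseteq> circ S" "cl S base \<in> L" "\<And>j. j \<in> {1..n} - \<Lambda> \<Longrightarrow> j \<in> S \<longleftrightarrow> j \<in> X" "(S, L) \<in> gens"
  using assms by (auto simp: piece_def gens_def)

lemma piece_dn:
  assumes l: "leaf X \<Lambda> Z W i" and T: "flipped X \<Lambda> i T" and M: "M \<subseteq> circ T" "side X i \<notin> M"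
  shows "(T, M) \<in> piece X \<Lambda> Z W \<longleftrightarrow> (flip i T, dn X i T M) \<in> piece X \<Lambda> Z W"
    and "(T, insert (side X i) M) \<in> piece X \<Lambda> Z W \<longleftrightarrow> (T, M) \<in> piece X \<Lambda> Z W"
proof -
  have iN: "i \<in> {1..n}" and i: "i \<in> \<Lambda>" using l by (auto simp: leaf_def bouquet_def)
  have Ts: "T \<subseteq> {1..n}" using T by (simp add: flipped_def)
  note d = dn_up[OF l T]
  note ff = flipped_facts[OF l T]
  show "(T, M) \<in> piece X \<Lambda> Z W \<longleftrightarrow> (flip i T, dn X i T M) \<in> piece X \<Lambda> Z W"
  proof -
    have "(\<forall>j\<in>{1..n} - \<Lambda>. j \<in> flip i T \<longleftrightarrow> j \<in> X) \<longleftrightarrow> (\<forall>j\<in>{1..n} - \<Lambda>. j \<in> T \<longleftrightarrow> j \<in> X)"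
      using i by (metis DiffD2 flip_mem)
    then show ?thesis
      unfolding piece_def gens_def mem_Collect_eq prod.case d(4)
      using d(2)[OF M] d(3)[OF M] M(1) Ts flip_subset[OF iN Ts] by blast
  qed
  show "(T, insert (side X i) M) \<in> piece X \<Lambda> Z W \<longleftrightarrow> (T, M) \<in> piece X \<Lambda> Z W"
  proof -
    have "{C \<in> insert (side X i) M. C \<subseteq> Z} = {C \<in> M. C \<subseteq> Z}" using ff(14) by auto
    then show ?thesis using ff(10,13) unfolding piece_def gens_def mem_Collect_eq prod.case by blast
  qed
qed

text \<open>Origin of the surviving label: for \<open>i\<close> in \<open>X\<close> the kink map is
  a merge, invertible on kinks labelled 1, and x is left over. Otherwise it is a split, whose terms
  with kink label x are invertible, and 1 is left over.\<close>

lemma piece_next: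
  assumes l: "leaf X \<Lambda> Z W i"
  defines "B \<equiv> side X i"
  shows "piece (flip i X) (\<Lambda> - {i}) (Z \<union> B) (if i \<in> X then insert B W else W)
    = {g \<in> piece X \<Lambda> Z W. (i \<in> fst g) \<noteq> (i \<in> X) \<and> (B \<in> snd g \<longleftrightarrow> i \<in> X)}" (is "?l = ?r")
proof -
  have q: "bouquet X \<Lambda> Z W" and i: "i \<in> \<Lambda>" and iN: "i \<in> {1..n}" using l by (auto simp: leaf_def bouquet_def)
  note st = side_trunk[OF q i]
  have BZ: "B \<inter> Z = {}" using st(4) by (auto simp: B_def)
  have WZ: "C \<subseteq> Z" if "C \<in> W" for C using that q unfolding bouquet_def by blast
  have main: "{C \<in> L. C \<subseteq> Z \<union> B} = (if i \<in> X then insert B W else W)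
      \<longleftrightarrow> {C \<in> L. C \<subseteq> Z} = W \<and> (B \<in> L \<longleftrightarrow> i \<in> X)"
    if T: "flipped X \<Lambda> i T" and L: "L \<subseteq> circ T" for T L
  proof -
    note ff = flipped_facts[OF l T, folded B_def]
    have "C \<subseteq> Z \<union> B \<longleftrightarrow> C \<subseteq> Z \<or> C = B" if "C \<in> L" for C
      using circ_disjoint[of C T B] that L ff(10) BZ by blast
    then have eq: "{C \<in> L. C \<subseteq> Z \<union> B} = {C \<in> L. C \<subseteq> Z} \<union> (if B \<in> L then {B} else {})" by auto
    have "B \<notin> W" "B \<notin> {C \<in> L. C \<subseteq> Z}" using ff(14) WZ by auto
    then show ?thesis unfolding eq by auto
  qed
  have fl: "S \<subseteq> {1..n} \<and> (\<forall>j\<in>{1..n} - (\<Lambda> - {i}). j \<in> S \<longleftrightarrow> j \<in> flip i X) \<longleftrightarrow> flipped X \<Lambda> i S" for S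
  proof -
    have "{1..n} - (\<Lambda> - {i}) = insert i ({1..n} - \<Lambda>)" using iN by auto
    moreover have "(\<forall>j\<in>{1..n} - \<Lambda>. j \<in> S \<longleftrightarrow> j \<in> flip i X) \<longleftrightarrow> (\<forall>j\<in>{1..n} - \<Lambda>. j \<in> S \<longleftrightarrow> j \<in> X)"
      using i by (metis DiffD2 flip_mem)
    moreover have "i \<in> flip i X \<longleftrightarrow> i \<notin> X" by (simp add: flip_mem)
    ultimately show ?thesis unfolding flipped_def by (simp only: ball_simps) blast
  qed
  have "(S, L) \<in> ?l \<longleftrightarrow> (S, L) \<in> ?r" for S L
  proof -
    have "(S, L) \<in> ?l \<longleftrightarrow> flipped X \<Lambda> i S \<and> L \<subseteq> circ S \<and> cl S base \<in> L
        \<and> {C \<in> L. C \<subseteq> Z \<union> B} = (if i \<in> X then insert B W else W)"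
      using fl[of S] by (auto simp: piece_def gens_def)
    also have "\<dots> \<longleftrightarrow> flipped X \<Lambda> i S \<and> L \<subseteq> circ S \<and> cl S base \<in> L \<and> {C \<in> L. C \<subseteq> Z} = W \<and> (B \<in> L \<longleftrightarrow> i \<in> X)"
      using main by blast
    also have "\<dots> \<longleftrightarrow> (S, L) \<in> ?r" by (auto simp: piece_def gens_def flipped_def)
    finally show ?thesis .
  qed
  then show ?thesis by auto
qed

lemma bouquet_next:
  assumes l: "leaf X \<Lambda> Z W i"
  defines "B \<equiv> side X i"
  shows "bouquet (flip i X) (\<Lambda> - {i}) (Z \<union> B) (if i \<in> X then insert B W else W)"
proof -
  have q: "bouquet X \<Lambda> Z W" and i: "i \<in> \<Lambda>" and iN: "i \<in> {1..n}" using l by (auto simp: leaf_def bouquet_def)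
  note st = side_trunk[OF q i, folded B_def]
  have Z: "cl (flip i X) x = cl X x" if "x \<in> Z" for x
  proof -
    note bD = q[unfolded bouquet_def, THEN conjunct2, THEN conjunct2]
    have Zc: "cl X x \<subseteq> Z" using bD that by simp
    have "Z \<subseteq> D" using bD by simp
    then have "x \<in> D" using that by (rule subsetD)
    moreover have "a i \<notin> Z" "b i \<notin> Z" using bD i by simp_all
    ultimately show ?thesis using Zc by (intro cl_flip_away[OF iN]) auto
  qed
  obtain s where s: "s \<in> B" using st(9) by auto
  have BW: "B \<in> cl (flip i X) ` (Z \<union> B)" using st(7)[OF s] s by blast
  have "W \<subseteq> cl X ` Z" using q by (simp add: bouquet_def)
  also have "cl X ` Z = cl (flip i X) ` Z" using Z by (simp cong: image_cong)
  finally have "W \<subseteq> cl (flip i X) ` Z" .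
  then have 1: "(if i \<in> X then insert B W else W) \<subseteq> cl (flip i X) ` (Z \<union> B)" using BW by auto
  have 2: "\<forall>x\<in>D - (Z \<union> B). cl (flip i X) x = D - (Z \<union> B)"
  proof
    fix x assume "x \<in> D - (Z \<union> B)"
    then have "x \<in> trunk X i" using st(4) by blast
    then have "cl (flip i X) x = trunk X i" by (rule st(8))
    also have "trunk X i = D - (Z \<union> B)" using st(4,5) by blast
    finally show "cl (flip i X) x = D - (Z \<union> B)" .
  qed
  \<comment> \<open>Switching \<open>i\<close> back joins the ends of \<open>j\<close>, so by
    \<open>same_pair\<close> they lie on the circles at \<open>i\<close>. One of these is the kink
    circle \<open>B\<close>, which no other open chord touches.\<close>
  have 3: "cl (flip k (flip i X)) (a j) = cl (flip k (flip i X)) (b j)"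
    if jk: "j \<in> \<Lambda>" "j \<noteq> i" "k \<in> \<Lambda>" "k \<noteq> i" "j \<noteq> k" for j k
  proof (rule ccontr)
    let ?Y = "flip k (flip i X)"
    assume ne: "\<not> ?thesis"
    have jN: "j \<in> {1..n}" using q jk by (auto simp: bouquet_def)
    have kN: "k \<in> {1..n}" using q jk by (auto simp: bouquet_def)
    have T: "flipped X \<Lambda> i ?Y"
      unfolding flipped_def
    proof (intro conjI ballI)
      have "X \<subseteq> {1..n}" using q by (simp add: bouquet_def)
      then show "?Y \<subseteq> {1..n}" by (intro flip_subset kN iN)
      show "(i \<in> ?Y) \<noteq> (i \<in> X)" using jk by (simp add: flip_mem)
      fix m assume "m \<in> {1..n} - \<Lambda>"
      then have "m \<noteq> k" "m \<noteq> i" using jk i by auto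
      then show "m \<in> ?Y \<longleftrightarrow> m \<in> X" by (simp add: flip_mem)
    qed
    note ff = flipped_facts[OF l T, folded B_def]
    have "cl (flip i ?Y) (a j) = cl (flip i ?Y) (b j)"
      using q jk by (auto simp: bouquet_def flip_commute[of i])
    then have "{cl ?Y (a i), cl ?Y (b i)} = {cl ?Y (a j), cl ?Y (b j)}"
      using same_pair[OF iN jN ff(3) ne] by simp
    then have "cl ?Y (a j) = B \<or> cl ?Y (b j) = B" using ff(1) by (auto simp: doubleton_eq_iff)
    then have "a j \<in> B \<or> b j \<in> B" using cl_refl abD[OF jN] by metis
    then show False using l jk by (auto simp: leaf_def B_def)
  qed
  have "Z \<subseteq> D" and Zc: "\<forall>x\<in>Z. cl X x \<subseteq> Z" and XN: "X \<subseteq> {1..n}" and LN: "\<Lambda> \<subseteq> {1..n}" and bZ: "base \<notin> Z"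
    and abZ: "\<forall>j\<in>\<Lambda>. a j \<notin> Z \<and> b j \<notin> Z" using q by (simp_all add: bouquet_def)
  then have ZB: "Z \<union> B \<subseteq> D" using st(4) by blast
  have 4: "\<forall>x\<in>Z \<union> B. cl (flip i X) x \<subseteq> Z \<union> B"
  proof
    fix x assume "x \<in> Z \<union> B"
    then show "cl (flip i X) x \<subseteq> Z \<union> B" using Z[of x] st(7)[of x] Zc by blast
  qed
  have 5: "\<forall>j\<in>\<Lambda> - {i}. a j \<notin> Z \<union> B \<and> b j \<notin> Z \<union> B" using abZ l by (simp add: leaf_def B_def)
  have 6: "\<forall>j\<in>\<Lambda> - {i}. \<forall>k\<in>\<Lambda> - {i}. j \<noteq> k \<longrightarrow> cl (flip k (flip i X)) (a j) = cl (flip k (flip i X)) (b j)"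
    using 3 by simp
  have 7: "flip i X \<subseteq> {1..n}" by (rule flip_subset[OF iN XN])
  have 9: "\<Lambda> - {i} \<subseteq> {1..n}" using LN by blast
  have 8: "base \<notin> Z \<union> B" using bZ st(2) by simp
  show ?thesis
    unfolding bouquet_def by (intro conjI 1 2 4 5 6 7 8 9 ZB)
qed

lemma sgn_unit: "\<bar>sg S c\<bar> = 1" by (simp add: sg_def power_abs)

text \<open>An arrow from \<open>P\<close> to \<open>R\<close> must change \<open>i\<close>, and an
  arrow changes only one crossing. The block is therefore diagonal as soon as the edge map at
  \<open>i\<close> is, and the sign of the cube is a unit.\<close>

lemma crossing_eliminate:
  assumes cx: "complex G deg (blk G G dK)" and i: "i \<in> {1..n}" and gens: "G \<subseteq> gens"
    and G: "G = P \<union> R \<union> G'" and dis: "P \<inter> R = {}" "P \<inter> G' = {}" "R \<inter> G' = {}"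
    and bij: "bij_betw \<pi> P R" and fst: "\<And>p. fst (\<pi> p) = insert i (fst p)"
    and P: "\<And>p. p \<in> P \<Longrightarrow> i \<notin> fst p" and R: "\<And>r. r \<in> R \<Longrightarrow> i \<in> fst r"
    and ent: "\<And>S L L'. (S, L) \<in> P \<Longrightarrow> (insert i S, L') \<in> R \<Longrightarrow> ent S i L L' = of_bool (L' = snd (\<pi> (S, L)))"
    and zig: "(\<forall>c\<in>G'. \<forall>r\<in>R. dK c r = 0) \<or> (\<forall>p\<in>P. \<forall>c\<in>G'. dK p c = 0)"
  shows "sdr G deg (blk G G dK) G' deg (blk G' G' dK)"
proof -
  have dP: "dK p r = (if r = \<pi> p then sg (fst p) i else 0)" if pr: "p \<in> P" "r \<in> R" for p r
  proof -
    obtain S L T M where e: "p = (S, L)" "r = (T, M)" by (metis prod.collapse)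
    have g: "(S, L) \<in> gens" "(T, M) \<in> gens" "i \<notin> S" "i \<in> T"
      using pr gens P R by (auto simp: e G)
    show ?thesis
    proof (cases "T = insert i S")
      case True
      then show ?thesis using dK_eq[OF i g(3,1)] g ent[of S L M] pr fst[of p] by (auto simp: e prod_eq_iff)
    next
      case False
      have "dK p r = 0"
      proof (rule ccontr)
        assume "dK p r \<noteq> 0"
        then obtain c where "T = insert c S" by (elim dK_nonzeroE) (auto simp: e)
        then show False using False g by auto
      qed
      moreover have "r \<noteq> \<pi> p" using False fst[of p] unfolding e by (metis fst_conv)
      ultimately show ?thesis by simp
    qed
  qed
  have "sdr G deg (blk G G dK) G' deg (blk G' G' (blk G G dK))"
  proof (rule sdr_eliminate[OF cx G dis bij])
    show "blk G G dK p r = 0" if "p \<in> P" "r \<in> R" "r \<noteq> \<pi> p" for p r using dP that by (simp add: blk_def)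
    show "\<bar>blk G G dK p (\<pi> p)\<bar> = 1" if "p \<in> P" for p
    proof -
      have "\<pi> p \<in> R" using bij that by (auto simp: bij_betw_def)
      then show ?thesis using dP[OF that] that sgn_unit by (auto simp: blk_def G)
    qed
  qed (use zig in \<open>auto simp: blk_def\<close>)
  then show ?thesis by (simp add: blk_blk G)
qed

text \<open>The first Reidemeister move: all states with \<open>i\<close> smoothed as in
  \<open>X\<close> cancel against those states with \<open>i\<close> switched that carry one of the
  two kink labels.\<close>

lemma leaf_step:
  assumes l: "leaf X \<Lambda> Z W i"
  defines "B \<equiv> side X i" and "G \<equiv> piece X \<Lambda> Z W"
  defines "G' \<equiv> piece (flip i X) (\<Lambda> - {i}) (Z \<union> B) (if i \<in> X then insert B W else W)"
  assumes cx: "complex G deg (blk G G dK)"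
  shows "sdr G deg (blk G G dK) G' deg (blk G' G' dK)"
proof -
  have i: "i \<in> \<Lambda>" and iN: "i \<in> {1..n}" using l by (auto simp: leaf_def bouquet_def)
  have G': "G' = {g \<in> G. (i \<in> fst g) \<noteq> (i \<in> X) \<and> (B \<in> snd g \<longleftrightarrow> i \<in> X)}"
    unfolding G'_def G_def B_def by (rule piece_next[OF l])
  have flT: "flipped X \<Lambda> i T" if "(T, M) \<in> G" "(i \<in> T) \<noteq> (i \<in> X)" for T M
    using that piece_memD[of T M X \<Lambda> Z W] by (auto simp: G_def flipped_def)
  have flS: "flipped X \<Lambda> i (flip i S)" if "(S, L) \<in> G" "(i \<in> S) = (i \<in> X)" for S L
    using that piece_memD[of S L X \<Lambda> Z W] i flip_subset[OF iN, of S] by (auto simp: G_def flipped_def flip_mem)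
  \<comment> \<open>A new label on \<open>B\<close> would need a crossing other than
    \<open>i\<close> with an end on \<open>B\<close>.\<close>
  have no_new: False if d: "dK (S, L) (S', L') \<noteq> 0" and g: "(S, L) \<in> G" "(S', L') \<in> G"
    and f: "(i \<in> S) \<noteq> (i \<in> X)" "(i \<in> S') \<noteq> (i \<in> X)" and B: "B \<in> L'" and nB: "B \<notin> L" for S L S' L'
  proof -
    from d obtain c where c: "S' = insert c S" "c \<in> {1..n}" "c \<notin> S" "ent S c L L' \<noteq> 0" by (elim dK_nonzeroE) auto
    have ci: "c \<noteq> i" using c f by auto
    have cL: "c \<in> \<Lambda>" using c g piece_memD(4)[of S L X \<Lambda> Z W c] piece_memD(4)[of S' L' X \<Lambda> Z W c] by (auto simp: G_def)
    have "B = cl S' (a c) \<or> B = cl S' (b c)" using ent_new[OF c(2,3,4)] B nB c(1) by auto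
    then have "a c \<in> B \<or> b c \<in> B" using cl_refl abD[OF c(2)] by metis
    then show False using l ci cL by (auto simp: leaf_def B_def)
  qed
  have gens: "G \<subseteq> gens" by (auto simp: G_def piece_def)
  show ?thesis
  proof (cases "i \<in> X")
    case iX: False
    \<comment> \<open>Here \<open>i\<close> acts as a split. The single circles in \<open>P\<close>
      map isomorphically onto the states whose kink carries x.\<close>
    define P where "P = {g \<in> G. i \<notin> fst g}"
    define R where "R = {g \<in> G. i \<in> fst g \<and> B \<in> snd g}"
    have G'2: "G' = {g \<in> G. i \<in> fst g \<and> B \<notin> snd g}" using G' iX by auto
    define \<pi> where "\<pi> g = (insert i (fst g), insert B (up X i (insert i (fst g)) (snd g)))" for g
    define \<pi>' where "\<pi>' g = (fst g - {i}, dn X i (fst g) (snd g - {B}))" for g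
    have Pf: "flipped X \<Lambda> i (insert i S)" "flip i (insert i S) = S" if "(S, L) \<in> P" for S L
      using that flS[of S L] iX by (auto simp: P_def flip_notin flip_insert)
    have Rf: "flipped X \<Lambda> i T" "flip i T = T - {i}" "insert i (T - {i}) = T" if "(T, M) \<in> R" for T M
      using that flT[of T M] iX by (auto simp: R_def flip_def)
    have p1: "\<pi> (S, L) \<in> R \<and> \<pi>' (\<pi> (S, L)) = (S, L)" if p: "(S, L) \<in> P" for S L
    proof -
      note f = Pf[OF p]
      have L: "L \<subseteq> circ S" and g: "(S, L) \<in> G" and iS: "i \<notin> S" using p piece_memD[of S L X \<Lambda> Z W] by (auto simp: P_def G_def)
      note du = dn_up(1)[OF l f(1), unfolded f(2), OF L, folded B_def]
      have "(insert i S, up X i (insert i S) L) \<in> G"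
        using piece_dn(1)[OF l f(1)] du g f(2) unfolding G_def B_def by auto
      then have "(insert i S, insert B (up X i (insert i S) L)) \<in> G"
        using piece_dn(2)[OF l f(1)] du unfolding G_def B_def by auto
      then show ?thesis using du iS by (auto simp: \<pi>_def \<pi>'_def R_def)
    qed
    have p2: "\<pi>' (T, M) \<in> P \<and> \<pi> (\<pi>' (T, M)) = (T, M)" if p: "(T, M) \<in> R" for T M
    proof -
      note f = Rf[OF p]
      have M: "M \<subseteq> circ T" "M - {B} \<subseteq> circ T" "side X i \<notin> M - {B}" and g: "(T, M) \<in> G" and B: "B \<in> M"
        using p piece_memD[of T M X \<Lambda> Z W] by (auto simp: R_def G_def B_def)
      note du = dn_up(2)[OF l f(1) M(2) M(3), unfolded f(2)]
      have ins: "insert B (M - {B}) = M" using B by auto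
      have "(T, M - {B}) \<in> G" using piece_dn(2)[OF l f(1) M(2) M(3), folded B_def] g ins by (simp add: G_def)
      then have "(T - {i}, dn X i T (M - {B})) \<in> G"
        using piece_dn(1)[OF l f(1) M(2) M(3), unfolded f(2)] by (simp add: G_def)
      then show ?thesis using du f(3) ins by (simp add: \<pi>_def \<pi>'_def P_def)
    qed
    have bij: "bij_betw \<pi> P R"
      by (rule bij_betw_byWitness[where f' = \<pi>']) (use p1 p2 in auto)
    have entP: "ent S i L L' = of_bool (L' = insert B (up X i (insert i S) L))"
      if p: "(S, L) \<in> P" and B: "B \<in> L'" for S L L'
    proof -
      note f = Pf[OF p]
      have L: "L \<subseteq> circ S" and iS: "i \<notin> S" using p piece_memD[of S L X \<Lambda> Z W] by (auto simp: P_def G_def)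
      define r where "r = rho X i (insert i S)"
      define C where "C = joint X i (insert i S)"
      note ff = flipped_facts[OF l f(1), unfolded f(2), folded B_def r_def C_def]
      have e: "cl S (a i) = cl S (b i)" using ff(4,5) by simp
      have BL: "B \<notin> L" using L ff(8) by auto
      have "ent S i L L' = (if C \<in> L then of_bool (L' = insert B (insert r (L - {C})))
         else of_bool (L' = insert B L) + of_bool (L' = insert r L))"
      proof -
        have "cl (insert i S) (a i) = B \<and> cl (insert i S) (b i) = r \<or> cl (insert i S) (a i) = r \<and> cl (insert i S) (b i) = B"
          using ff(1) by (simp add: doubleton_eq_iff)
        then show ?thesis
          by (elim disjE conjE) (simp_all add: ent_split[OF iN iS e] ff(4) insert_commute[of B r] add.commute)
      qed
      \<comment> \<open>A split of 1 has two terms; the one that labels \<open>r\<close> leaves the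
        kink without x and so does not lie in \<open>R\<close>.\<close>
      moreover have "L' \<noteq> insert r L" using B BL ff(2) by auto
      ultimately show ?thesis by (simp add: up_def r_def[symmetric] C_def[symmetric])
    qed
    have zig: "\<forall>c\<in>G'. \<forall>r\<in>R. dK c r = 0"
      using no_new iX by (force simp: G'2 R_def)
    show ?thesis
      by (rule crossing_eliminate[OF cx iN gens _ _ _ _ bij])
        (use zig entP in \<open>auto simp: P_def R_def G'2 \<pi>_def\<close>)
  next
    case iX: True
    \<comment> \<open>Here \<open>i\<close> acts as a merge, and merging a kink labelled 1 is an
      isomorphism.\<close>
    define P where "P = {g \<in> G. i \<notin> fst g \<and> B \<notin> snd g}"
    define R where "R = {g \<in> G. i \<in> fst g}"
    have G'2: "G' = {g \<in> G. i \<notin> fst g \<and> B \<in> snd g}" using G' iX by auto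
    define \<pi> where "\<pi> g = (insert i (fst g), dn X i (fst g) (snd g))" for g
    define \<pi>' where "\<pi>' g = (fst g - {i}, up X i (fst g - {i}) (snd g))" for g
    have Pf: "flipped X \<Lambda> i T" "flip i T = insert i T" if "(T, M) \<in> P" for T M
      using that flT[of T M] iX by (auto simp: P_def flip_notin)
    have Rf: "flipped X \<Lambda> i (S - {i})" "flip i (S - {i}) = S" "insert i (S - {i}) = S" if "(S, L) \<in> R" for S L
      using that flS[of S L] iX by (auto simp: R_def flip_def)
    have p1: "\<pi> (T, M) \<in> R \<and> \<pi>' (\<pi> (T, M)) = (T, M)" if p: "(T, M) \<in> P" for T M
    proof -
      note f = Pf[OF p]
      have M: "M \<subseteq> circ T" "side X i \<notin> M" and g: "(T, M) \<in> G" and iT: "i \<notin> T" using p piece_memD[of T M X \<Lambda> Z W] by (auto simp: P_def G_def B_def)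
      note du = dn_up(2)[OF l f(1) M, unfolded f(2)]
      have "(insert i T, dn X i T M) \<in> G"
        using piece_dn(1)[OF l f(1) M] g f(2) unfolding G_def by auto
      then show ?thesis using du iT by (auto simp: \<pi>_def \<pi>'_def R_def)
    qed
    have p2: "\<pi>' (S, L) \<in> P \<and> \<pi> (\<pi>' (S, L)) = (S, L)" if p: "(S, L) \<in> R" for S L
    proof -
      note f = Rf[OF p]
      have L: "L \<subseteq> circ S" and g: "(S, L) \<in> G" using p piece_memD[of S L X \<Lambda> Z W] by (auto simp: R_def G_def)
      note du = dn_up(1)[OF l f(1), unfolded f(2), OF L]
      have "(S - {i}, up X i (S - {i}) L) \<in> G"
        using piece_dn(1)[OF l f(1), unfolded f(2)] du g by (simp add: G_def)
      then show ?thesis using du f(3) by (simp add: \<pi>_def \<pi>'_def P_def B_def)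
    qed
    have bij: "bij_betw \<pi> P R"
      by (rule bij_betw_byWitness[where f' = \<pi>']) (use p1 p2 in auto)
    have entP: "ent T i M L' = of_bool (L' = dn X i T M)" if p: "(T, M) \<in> P" for T M L'
    proof -
      note f = Pf[OF p]
      have M: "M \<subseteq> circ T" "B \<notin> M" and iT: "i \<notin> T" using p piece_memD[of T M X \<Lambda> Z W] by (auto simp: P_def G_def)
      define r where "r = rho X i T"
      define C where "C = joint X i T"
      note ff = flipped_facts[OF l f(1), folded B_def r_def C_def]
      have CM: "C \<notin> M" using ff(7) M by auto
      have rc: "cl T (a i) = B \<and> cl T (b i) = r \<or> cl T (a i) = r \<and> cl T (b i) = B"
        using ff(1) by (simp add: doubleton_eq_iff)
      have CU: "cl T (a i) \<union> cl T (b i) = C"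
      proof -
        have "cl T (a i) \<union> cl T (b i) = B \<union> r" using rc by (elim disjE conjE) (simp_all add: Un_commute)
        then show ?thesis by (simp add: C_def joint_def B_def r_def)
      qed
      have gm: "gm T i V = (if V = B \<or> V = r then C else V)" for V
        using rc unfolding gm_def CU by (elim disjE conjE) (simp_all add: disj_commute)
      have "inj_on (gm T i) M" using M(2) CM unfolding inj_on_def gm by auto
      moreover have "gm T i ` M = dn X i T M"
        using M(2) unfolding dn_def r_def[symmetric] C_def[symmetric] by (auto simp: gm image_iff)
      ultimately show ?thesis using ent_merge[OF iN iT ff(3) M(1), of L'] by auto
    qed
    have zig: "\<forall>p\<in>P. \<forall>c\<in>G'. dK p c = 0"
      using no_new iX by (force simp: G'2 P_def)
    show ?thesis
      by (rule crossing_eliminate[OF cx iN gens _ _ _ _ bij])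
        (use zig entP in \<open>auto simp: P_def R_def G'2 \<pi>_def\<close>)
  qed
qed

end

section \<open>Quasi-trees and the skein recursion\<close>

lemma pair_eqI: "x = p \<or> x = q \<Longrightarrow> y = p \<or> y = q \<Longrightarrow> x \<noteq> y \<Longrightarrow> {x, y} = {p, q}"
  by auto

lemma sdr_refl:
  assumes cx: "complex G dg d" shows "sdr G dg d G dg d"
proof -
  have fG: "finite G" and dG: "mat_on G G d" using cx by (auto simp: complex_def)
  have "mat_comp G (idm G) d = d" "mat_comp G d (idm G) = d" "mat_comp G (idm G) (idm G) = idm G"
    using mc_id_left'[OF fG dG order_refl] mc_id_right'[OF fG dG order_refl]
      mc_id_left'[OF fG mat_on_idm order_refl] by auto
  then have "sdr_by G dg d G dg d (idm G) (idm G) 0"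
    using dG by (simp add: sdr_by_def mat_on_idm) (simp add: idm_def mat_on_def)
  then show ?thesis by (auto simp: sdr_def)
qed

context circle_system
begin

text \<open>Without open chords the last circle \<open>D - Z\<close> carries the base point, so its
  label is forced as well.\<close>

lemma piece_empty:
  assumes q: "bouquet X {} Z W"
  shows "piece X {} Z W = {(X, insert (D - Z) W)}" and "D - Z \<notin> W"
proof -
  have XN: "X \<subseteq> {1..n}" and Zc: "\<And>x. x \<in> Z \<Longrightarrow> cl X x \<subseteq> Z" and WZ: "W \<subseteq> cl X ` Z" and ZD: "Z \<subseteq> D"
    and out: "\<And>x. x \<in> D - Z \<Longrightarrow> cl X x = D - Z" and bZ: "base \<in> D - Z"
    using q baseD by (auto simp: bouquet_def)
  have WZ': "C \<subseteq> Z" if "C \<in> W" for C using that WZ Zc by blast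
  have nDZ: "\<not> D - Z \<subseteq> Z" using bZ by blast
  then show "D - Z \<notin> W" using WZ' by blast
  have cb: "cl X base = D - Z" by (rule out[OF bZ])
  have circW: "W \<subseteq> circ X" using WZ ZD unfolding circ_def by (meson image_mono subset_trans)
  have big: "C = D - Z" if C: "C \<in> circ X" "\<not> C \<subseteq> Z" for C
  proof -
    obtain x where x: "x \<in> D" "C = cl X x" using C(1) by (auto simp: circ_def)
    then have "x \<notin> Z" using C(2) Zc by blast
    then show ?thesis using x out by simp
  qed
  have "(S, L) \<in> piece X {} Z W \<longleftrightarrow> S = X \<and> L = insert (D - Z) W" for S L
  proof
    assume "(S, L) \<in> piece X {} Z W"
    then have SN: "S \<subseteq> {1..n}" and "\<forall>i\<in>{1..n}. i \<in> S \<longleftrightarrow> i \<in> X" and L: "L \<subseteq> circ S" "cl S base \<in> L"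
      and W: "{C \<in> L. C \<subseteq> Z} = W" by (simp_all add: piece_def gens_def)
    then have S: "S = X" using XN by blast
    have "L = insert (D - Z) {C \<in> L. C \<subseteq> Z}"
    proof (intro equalityI subsetI)
      fix C assume "C \<in> L"
      then show "C \<in> insert (D - Z) {C \<in> L. C \<subseteq> Z}" using big[of C] L(1) S by (cases "C \<subseteq> Z") auto
    next
      fix C assume "C \<in> insert (D - Z) {C \<in> L. C \<subseteq> Z}"
      then show "C \<in> L" using L(2) cb S by (elim insertE) simp_all
    qed
    then show "S = X \<and> L = insert (D - Z) W" using S W by simp
  next
    assume SL: "S = X \<and> L = insert (D - Z) W"
    have "{C \<in> insert (D - Z) W. C \<subseteq> Z} = W" using WZ' nDZ by blast
    moreover have "insert (D - Z) W \<subseteq> circ X" using circW cl_in_circ[OF baseD, of X] cb by simp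
    ultimately show "(S, L) \<in> piece X {} Z W" using SL XN cb by (simp add: piece_def gens_def)
  qed
  then show "piece X {} Z W = {(X, insert (D - Z) W)}" by auto
qed

text \<open>Every removed kink switches its crossing and adds a circle, labelled x exactly if the
  crossing lay in \<open>X\<close>. The additional 1 in the number of labels is the base
  circle.\<close>

lemma bouquet_sdr:
  assumes "finite \<Lambda>" "bouquet X \<Lambda> Z W" "complex (piece X \<Lambda> Z W) deg (blk (piece X \<Lambda> Z W) (piece X \<Lambda> Z W) dK)"
  shows "\<exists>M e. sdr (piece X \<Lambda> Z W) deg (blk (piece X \<Lambda> Z W) (piece X \<Lambda> Z W) dK) {(symd \<Lambda> X, M)} deg e
     \<and> card (circ (symd \<Lambda> X)) = card (circ X) + card \<Lambda> \<and> card M = 1 + card W + card (\<Lambda> \<inter> X)"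
  using assms
proof (induction "card \<Lambda>" arbitrary: X \<Lambda> Z W)
  case 0
  then have L: "\<Lambda> = {}" by simp
  have q: "bouquet X {} Z W" using 0 L by simp
  have "W \<subseteq> cl X ` Z" "Z \<subseteq> D" using q by (simp_all add: bouquet_def)
  then have "finite W" using finite_subset finD finite_imageI by metis
  then have "card (insert (D - Z) W) = 1 + card W" using piece_empty(2)[OF q] by simp
  then show ?case using sdr_refl[OF 0(4)] unfolding L piece_empty(1)[OF q] by auto
next
  case (Suc m)
  then have "\<Lambda> \<noteq> {}" by auto
  then obtain i where i: "i \<in> \<Lambda>" "\<And>j. j \<in> \<Lambda> \<Longrightarrow> j \<noteq> i \<Longrightarrow> a j \<notin> side X i \<and> b j \<notin> side X i"
    using leaf_exists[OF Suc(4)] by blast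
  have l: "leaf X \<Lambda> Z W i" using Suc(4) i by (simp add: leaf_def)
  have iN: "i \<in> {1..n}" using Suc(4) i(1) by (auto simp: bouquet_def)
  define B where "B = side X i"
  define G where "G = piece X \<Lambda> Z W"
  define W' where "W' = (if i \<in> X then insert B W else W)"
  define G' where "G' = piece (flip i X) (\<Lambda> - {i}) (Z \<union> B) W'"
  have cx: "complex G deg (blk G G dK)" using Suc(5) by (simp add: G_def)
  have sub: "G' \<subseteq> G" unfolding G'_def G_def W'_def B_def using piece_next[OF l] by blast
  have fG: "finite G" using cx by (simp add: complex_def)
  have s1: "sdr G deg (blk G G dK) G' deg (blk G' G' dK)"
    unfolding G'_def G_def W'_def B_def by (rule leaf_step[OF l Suc(5)])
  have fG': "finite G'" using sub fG finite_subset by blast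
  have cx': "complex G' deg (blk G' G' dK)" by (rule complex_target[OF cx fG' s1])
  have q': "bouquet (flip i X) (\<Lambda> - {i}) (Z \<union> B) W'" unfolding W'_def B_def by (rule bouquet_next[OF l])
  have "m = card (\<Lambda> - {i})" using Suc(2,3) i(1) by (simp add: card_Diff_singleton)
  from Suc(1)[OF this _ q'] cx' Suc(3)
  obtain M e where s2: "sdr G' deg (blk G' G' dK) {(symd (\<Lambda> - {i}) (flip i X), M)} deg e"
    and c: "card (circ (symd (\<Lambda> - {i}) (flip i X))) = card (circ (flip i X)) + card (\<Lambda> - {i})"
      "card M = 1 + card W' + card ((\<Lambda> - {i}) \<inter> flip i X)"
    unfolding G'_def by auto
  have s: "sdr G deg (blk G G dK) {(symd \<Lambda> X, M)} deg e"
    using sdr_trans[OF fG' s1 s2] by (simp add: symd_flip[OF i(1)])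
  have "int (card (circ (flip i X))) = int (card (circ X)) + 1"
    using card_circ[OF iN, of X] side_trunk(1)[OF Suc(4) i(1)] by simp
  then have c1: "card (circ (symd \<Lambda> X)) = card (circ X) + card \<Lambda>"
    using c(1) Suc(2,3) i(1) by (simp add: symd_flip card_Diff_singleton)
  have "W \<subseteq> cl X ` Z" "Z \<subseteq> D" "\<forall>x\<in>Z. cl X x \<subseteq> Z" using Suc(4) by (simp_all add: bouquet_def)
  then have fW: "finite W" and WZ: "\<And>C. C \<in> W \<Longrightarrow> C \<subseteq> Z" using finite_subset finD finite_imageI by (metis, blast)
  have "a i \<notin> Z" "b i \<notin> Z" using Suc(4) i(1) by (simp_all add: bouquet_def)
  then have "B \<notin> W" using WZ side_trunk(9)[OF Suc(4) i(1)] unfolding B_def by blast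
  moreover have "(\<Lambda> - {i}) \<inter> flip i X = \<Lambda> \<inter> X - {i}" by (auto simp: flip_def)
  moreover have "card (\<Lambda> \<inter> X - {i}) + of_bool (i \<in> X) = card (\<Lambda> \<inter> X)"
    using card_Suc_Diff1[of "\<Lambda> \<inter> X" i] i(1) Suc(3) by (cases "i \<in> X") simp_all
  ultimately have "card M = 1 + card W + card (\<Lambda> \<inter> X)"
    using c(2) fW unfolding W'_def by (auto split: if_splits)
  then show ?case using s c1 unfolding G_def by blast
qed

section \<open>Connectedness of partial resolutions\<close>

definition sat :: "nat \<Rightarrow> nat set \<Rightarrow> 'd set \<Rightarrow> bool" where
  "sat k S A \<longleftrightarrow> A \<subseteq> D \<and> (\<forall>x\<in>A. cl S x \<subseteq> A) \<and> (\<forall>c\<in>{1..k}. a c \<in> A \<longleftrightarrow> b c \<in> A)"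

text \<open>Connectedness of the diagram in which only the crossings \<open>> k\<close> are smoothed.\<close>
definition conn :: "nat \<Rightarrow> nat set \<Rightarrow> bool" where
  "conn k S \<longleftrightarrow> (\<forall>A. sat k S A \<longrightarrow> A = {} \<or> A = D)"

text \<open>The unresolved crossings up to \<open>k\<close> tie their two arcs together, so a
  saturated set is a union of components of the partial resolution. Switching such a crossing only
  recombines circles that are tied already.\<close>

lemma sat_flip:
  assumes "c \<in> {1..k}" "c \<in> {1..n}" "sat k S A" shows "sat k (flip c S) A"
proof -
  have ab: "a c \<in> A \<longleftrightarrow> b c \<in> A" and cl: "\<And>x. x \<in> A \<Longrightarrow> cl S x \<subseteq> A" and AD: "A \<subseteq> D" using assms by (auto simp: sat_def)
  have "cl (flip c S) x \<subseteq> A" if x: "x \<in> A" for x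
  proof (cases "cl S (a c) = cl S (b c)")
    case False
    have xD: "x \<in> D" using x AD by blast
    have "cl S (a c) \<union> cl S (b c) \<subseteq> A" if "x \<in> cl S (a c) \<union> cl S (b c)"
    proof -
      have "a c \<in> A \<or> b c \<in> A"
        using that cl[OF x] cl_mem_iff[OF _ xD] cl_refl abD[OF assms(2)] by (metis Un_iff subsetD)
      then show ?thesis using ab cl by blast
    qed
    then show ?thesis using glue[OF assms(2) False xD] cl[OF x] by simp
  next
    case True
    have xD: "x \<in> D" using x AD by blast
    have "cl (flip c S) x \<subseteq> cl S x" using flip_split(3)[OF assms(2) True xD] by (auto simp: gm_def split: if_splits)
    then show ?thesis using cl[OF x] by blast
  qed
  then show ?thesis using assms by (simp add: sat_def)
qed

lemma conn_flip: "c \<in> {1..k} \<Longrightarrow> c \<in> {1..n} \<Longrightarrow> conn k (flip c S) \<longleftrightarrow> conn k S"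
  unfolding conn_def using sat_flip[of c k S] sat_flip[of c k "flip c S"] by auto

lemma conn_symd:
  assumes "finite F" "F \<subseteq> {1..k}" "k \<le> n" shows "conn k (symd F S) \<longleftrightarrow> conn k S"
  using assms
proof (induction F rule: finite_induct)
  case (insert c F)
  then show ?case using conn_flip[of c k "symd F S"] by (simp add: symd_insert)
qed simp

lemma conn_agree:
  assumes "S \<subseteq> {1..n}" "T \<subseteq> {1..n}" "k \<le> n" "\<And>i. i \<in> {k<..n} \<Longrightarrow> i \<in> S \<longleftrightarrow> i \<in> T"
  shows "conn k S \<longleftrightarrow> conn k T"
proof -
  have T: "T = symd ((S - T) \<union> (T - S)) S" by (auto simp: symd_def)
  have sub: "(S - T) \<union> (T - S) \<subseteq> {1..k}"
  proof
    fix x assume x: "x \<in> (S - T) \<union> (T - S)"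
    then have "x \<in> {1..n}" "x \<notin> {k<..n}" using assms by blast+
    then show "x \<in> {1..k}" by auto
  qed
  have "conn k (symd ((S - T) \<union> (T - S)) S) \<longleftrightarrow> conn k S"
    by (rule conn_symd[OF _ sub assms(3)]) (rule finite_subset[OF sub], simp)
  then show ?thesis unfolding T[symmetric] by simp
qed

lemma conn_mono: "conn j S \<Longrightarrow> j \<le> k \<Longrightarrow> conn k S"
  unfolding conn_def sat_def by auto

lemma conn_0: "conn 0 S \<longleftrightarrow> (\<forall>x\<in>D. cl S x = D)"
proof
  assume c: "conn 0 S"
  show "\<forall>x\<in>D. cl S x = D"
  proof
    fix x assume x: "x \<in> D"
    have "sat 0 S (cl S x)" using cl_sub[OF x] cl_eqI[OF x] by (auto simp: sat_def)
    then show "cl S x = D" using c cl_refl[OF x, of S] unfolding conn_def by blast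
  qed
next
  assume "\<forall>x\<in>D. cl S x = D"
  then show "conn 0 S" unfolding conn_def sat_def by blast
qed

text \<open>In one of the two smoothings both arcs lie on the same circle by \<open>toggle\<close>.
  There the tie at the crossing is redundant and may be dropped.\<close>

lemma conn_resolve:
  assumes "conn (Suc k) S" "Suc k \<le> n" shows "conn k S \<or> conn k (flip (Suc k) S)"
proof -
  have k: "Suc k \<in> {1..Suc k}" "Suc k \<in> {1..n}" using assms(2) by auto
  have *: "conn k T" if "conn (Suc k) T" "cl T (a (Suc k)) = cl T (b (Suc k))" for T
    unfolding conn_def
  proof (intro allI impI)
    fix A assume A: "sat k T A"
    have "a (Suc k) \<in> A \<longleftrightarrow> b (Suc k) \<in> A"
    proof
      assume "a (Suc k) \<in> A"
      then show "b (Suc k) \<in> A" using A that(2) cl_refl[OF abD(2)[OF k(2)], of T] unfolding sat_def by blast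
    next
      assume "b (Suc k) \<in> A"
      then show "a (Suc k) \<in> A" using A that(2) cl_refl[OF abD(1)[OF k(2)], of T] unfolding sat_def by blast
    qed
    then have "sat (Suc k) T A" using A by (auto simp: sat_def le_Suc_eq)
    then show "A = {} \<or> A = D" using that(1) by (simp add: conn_def)
  qed
  show ?thesis
  proof (cases "cl S (a (Suc k)) = cl S (b (Suc k))")
    case True then show ?thesis using * assms by blast
  next
    case False
    then have "cl (flip (Suc k) S) (a (Suc k)) = cl (flip (Suc k) S) (b (Suc k))" using toggle[OF k(2)] by blast
    then show ?thesis using * conn_flip[OF k] assms(1) by blast
  qed
qed

text \<open>On a single circle, chord \<open>c\<close> crosses chord \<open>i\<close> iff cutting
  along \<open>i\<close> puts the two ends of \<open>c\<close> on different circles.\<close>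

definition lv :: "nat set \<Rightarrow> nat \<Rightarrow> bool" where
  "lv Q i \<longleftrightarrow> (\<forall>c\<in>{1..<i}. cl (flip i Q) (a c) = cl (flip i Q) (b c))"

text \<open>Switching \<open>i\<close> leaves two circles that together make up \<open>D\<close>.
  They are reconnected by the crossings below \<open>i\<close> iff one of these has its ends on
  both, that is, crosses \<open>i\<close>.\<close>

lemma lv_iff:
  assumes Q: "conn 0 Q" and i: "i \<in> {1..n}" shows "lv Q i \<longleftrightarrow> \<not> conn (i - 1) (flip i Q)"
proof -
  have one: "cl Q x = D" if "x \<in> D" for x using Q that by (simp add: conn_0)
  have e: "cl Q (a i) = cl Q (b i)" using one abD[OF i] by simp
  note fs = flip_split[OF i e]
  let ?A = "cl (flip i Q) (a i)" and ?B = "cl (flip i Q) (b i)"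
  have u: "?A \<union> ?B = D" using fs(2) one abD[OF i] by simp
  have cls: "cl (flip i Q) x = ?A \<or> cl (flip i Q) x = ?B" if x: "x \<in> D" for x
    using x u cl_eqI abD[OF i] by (metis Un_iff)
  have dj: "?A \<inter> ?B = {}" using fs(1) circ_disjoint[OF cl_in_circ cl_in_circ, of "a i" "b i"] abD[OF i] by blast
  show ?thesis
  proof
    assume lv: "lv Q i"
    have "sat (i - 1) (flip i Q) ?A"
      unfolding sat_def
    proof (intro conjI ballI)
      show "?A \<subseteq> D" by (rule cl_sub[OF abD(1)[OF i]])
      show "cl (flip i Q) x \<subseteq> ?A" if "x \<in> ?A" for x using cl_eqI[OF abD(1)[OF i] that] by simp
      fix c assume c: "c \<in> {1..i - 1}"
      then have cN: "c \<in> {1..n}" using i by auto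
      have "cl (flip i Q) (a c) = cl (flip i Q) (b c)" using lv c by (auto simp: lv_def)
      then show "a c \<in> ?A \<longleftrightarrow> b c \<in> ?A" using cl_mem_iff abD[OF i] abD[OF cN] by metis
    qed
    moreover have "?A \<noteq> {}" "?A \<noteq> D" using cl_refl abD[OF i] dj by blast+
    ultimately show "\<not> conn (i - 1) (flip i Q)" unfolding conn_def by blast
  next
    assume nc: "\<not> conn (i - 1) (flip i Q)"
    show "lv Q i"
    proof (rule ccontr)
      assume "\<not> lv Q i"
      then obtain c where c: "c \<in> {1..<i}" "cl (flip i Q) (a c) \<noteq> cl (flip i Q) (b c)" unfolding lv_def by blast
      then have cN: "c \<in> {1..n}" using i by auto
      have AB: "{cl (flip i Q) (a c), cl (flip i Q) (b c)} = {?A, ?B}"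
        by (rule pair_eqI[OF cls[OF abD(1)[OF cN]] cls[OF abD(2)[OF cN]] c(2)])
      have "A = {} \<or> A = D" if A: "sat (i - 1) (flip i Q) A" for A
      proof (rule ccontr)
        assume n: "\<not> ?thesis"
        then obtain x where x: "x \<in> A" by blast
        have xD: "x \<in> D" and AD: "A \<subseteq> D" using x A by (auto simp: sat_def)
        have clA: "cl (flip i Q) y \<subseteq> A" if "y \<in> A" for y using A that by (simp add: sat_def)
        have "cl (flip i Q) x = cl (flip i Q) (a c) \<or> cl (flip i Q) x = cl (flip i Q) (b c)"
          using cls[OF xD] AB by (metis insert_iff singletonD)
        then have "a c \<in> A \<or> b c \<in> A" using clA[OF x] cl_refl abD[OF cN] by blast
        then have "a c \<in> A" "b c \<in> A" using A c(1) by (auto simp: sat_def)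
        then have "cl (flip i Q) (a c) \<union> cl (flip i Q) (b c) \<subseteq> A" using clA by blast
        moreover have "cl (flip i Q) (a c) \<union> cl (flip i Q) (b c) = ?A \<union> ?B"
          using AB by (metis Union_insert ccpo_Sup_singleton)
        ultimately have "D \<subseteq> A" using u by simp
        then show False using n AD by blast
      qed
      then show False using nc unfolding conn_def by blast
    qed
  qed
qed

section \<open>The resolution tree and its leaves\<close>

definition "lives Q = {i \<in> {1..n}. lv Q i}"

text \<open>The degree of the generator left by \<open>bouquet_sdr\<close> at the leaf
  \<open>Q\<close>, where one starts from a single circle and all live crossings end up
  switched.\<close>

definition qdeg :: "nat set \<Rightarrow> int \<times> int" where
  "qdeg Q = (int (card (symd (lives Q) Q)) + ci,
     int (1 + card (lives Q)) - 2 * int (1 + card (lives Q \<inter> Q)) + int (card (symd (lives Q) Q)) + cj)"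

text \<open>Data of the node of the resolution tree at which the crossings above \<open>k\<close>
  have been treated and \<open>X\<close> records the choices: the enhanced states below it, the
  crossings left open so far, and the quasi-trees among its leaves. \<open>lam\<close> tests
  connectedness at \<open>i - 1\<close> because only the crossings below \<open>i\<close> are
  untreated once \<open>i\<close> is decided.\<close>

definition "tail k X \<Lambda> = {(S, L) \<in> gens. \<forall>i\<in>{k<..n}. i \<notin> \<Lambda> \<longrightarrow> (i \<in> S \<longleftrightarrow> i \<in> X)}"
definition "lam k X = {i \<in> {k<..n}. \<not> conn (i - 1) (flip i X)}"
definition "qts k X = {Q. Q \<subseteq> {1..n} \<and> conn 0 Q \<and> (\<forall>i\<in>{k<..n}. i \<in> Q \<longleftrightarrow> i \<in> X)}"

text \<open>The number of circles after switching both crossings does not depend on the order: 3 if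
  the chords are disjoint, 1 if they cross.\<close>

lemma noncrossing_sym:
  assumes Q: "conn 0 Q" and N: "i \<in> {1..n}" "j \<in> {1..n}"
    and e: "cl (flip i Q) (a j) = cl (flip i Q) (b j)"
  shows "cl (flip j Q) (a i) = cl (flip j Q) (b i)"
proof (rule ccontr)
  assume ne: "\<not> ?thesis"
  have one: "cl Q x = D" if "x \<in> D" for x using Q that by (simp add: conn_0)
  have "int (card (circ (flip i (flip j Q)))) = int (card (circ Q)) + 0"
    using card_circ[OF N(1), of "flip j Q"] card_circ[OF N(2), of Q] ne one abD[OF N(2)] by simp
  moreover have "int (card (circ (flip j (flip i Q)))) = int (card (circ Q)) + 2"
    using card_circ[OF N(2), of "flip i Q"] card_circ[OF N(1), of Q] e one abD[OF N(1)] by simp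
  ultimately show False by (simp add: flip_commute)
qed

lemma live_noncrossing:
  assumes Q: "conn 0 Q" and ij: "i \<in> lives Q" "j \<in> lives Q" "i \<noteq> j"
  shows "cl (flip j Q) (a i) = cl (flip j Q) (b i)"
proof -
  have N: "i \<in> {1..n}" "j \<in> {1..n}" using ij by (auto simp: lives_def)
  have lt: "cl (flip j Q) (a i) = cl (flip j Q) (b i)" if "i < j" "j \<in> lives Q" "i \<in> {1..n}" for i j
    using that by (auto simp: lives_def lv_def)
  show ?thesis
  proof (cases "i < j")
    case True then show ?thesis using lt ij N by blast
  next
    case False
    then show ?thesis using noncrossing_sym[OF Q N] lt[of j i] ij N by simp
  qed
qed

lemma tail_0:
  assumes Q: "conn 0 Q" "Q \<subseteq> {1..n}"
  shows "lam 0 Q = lives Q" "tail 0 Q (lives Q) = piece Q (lives Q) {} {}" "bouquet Q (lives Q) {} {}" "qts 0 Q = {Q}"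
proof -
  have N: "{0<..n} = {1..n}" by auto
  show "lam 0 Q = lives Q" using lv_iff[OF Q(1)] unfolding lam_def lives_def N by blast
  have "{C \<in> L. C \<subseteq> {}} = {}" if "L \<subseteq> circ S" for S L
    using that cl_refl by (auto simp: circ_def)
  then show "tail 0 Q (lives Q) = piece Q (lives Q) {} {}"
    unfolding tail_def piece_def N gens_def by auto
  show "qts 0 Q = {Q}" using Q unfolding qts_def N by blast
  have "cl Q x = D" if "x \<in> D" for x using Q that by (simp add: conn_0)
  then show "bouquet Q (lives Q) {} {}"
    using Q(2) live_noncrossing[OF Q(1)] by (auto simp: bouquet_def lives_def)
qed

lemma tail_sdr_0:
  assumes Q: "conn 0 Q" "Q \<subseteq> {1..n}" and G: "G = tail 0 Q (lives Q)"
    and cx: "complex G deg (blk G G dK)"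
  shows "\<exists>e. sdr G deg (blk G G dK) {Q} qdeg e"
proof -
  note t = tail_0[OF Q]
  have fin: "finite (lives Q)" by (simp add: lives_def)
  obtain M e where s: "sdr G deg (blk G G dK) {(symd (lives Q) Q, M)} deg e"
    and c: "card (circ (symd (lives Q) Q)) = card (circ Q) + card (lives Q)"
      "card M = 1 + card ({} :: 'd set set) + card (lives Q \<inter> Q)"
    using bouquet_sdr[OF fin t(3)] cx unfolding G t(2) by blast
  have "circ Q = {D}" using Q(1) baseD by (auto simp: conn_0 circ_def)
  then have d: "qdeg Q = deg (symd (lives Q) Q, M)" using c by (simp add: qdeg_def deg_def)
  have cx': "complex {(symd (lives Q) Q, M)} deg e" by (rule complex_target[OF cx _ s]) simp
  from sdr_trans[OF _ s sdr_singleton[where dc = qdeg and y = Q, OF cx' d]] show ?thesis by auto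
qed

text \<open>If both smoothings of the next crossing stay connected, the node is the cone of its two
  children. Otherwise the crossing joins the open ones, and the node has the same generators as its
  only connected child.\<close>

theorem tail_sdr:
  assumes "k \<le> n" "X \<subseteq> {1..n}" "conn k X" "G = tail k X (lam k X)" "complex G deg (blk G G dK)"
  shows "\<exists>e. sdr G deg (blk G G dK) (qts k X) qdeg e"
  using assms
proof (induction k arbitrary: X G)
  case 0
  then show ?case using tail_sdr_0[of X G] tail_0[of X] by simp
next
  case (Suc k)
  let ?c = "Suc k"
  have cN: "?c \<in> {1..n}" using Suc(2) by auto
  have kn: "k \<le> n" using Suc(2) by simp
  have fX: "flip ?c X \<subseteq> {1..n}" by (rule flip_subset[OF cN Suc(3)])
  have split: "{k<..n} = insert ?c {?c<..n}" using Suc(2) by auto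
  \<comment> \<open>For larger \<open>i\<close>, crossing \<open>Suc k\<close> is still tied when
    \<open>i\<close> is tested, so its smoothing does not affect the decision.\<close>
  have lamf: "conn (i - 1) (flip i (flip ?c X)) \<longleftrightarrow> conn (i - 1) (flip i X)" if "i \<in> {?c<..n}" for i
    using conn_flip[of ?c "i - 1" "flip i X"] that cN by (auto simp: flip_commute[of i])
  have lamk: "lam k Y = (if conn k (flip ?c Y) then {} else {?c}) \<union> lam ?c Y" for Y
    unfolding lam_def split by auto
  note lam1 = lamk[of X]
  have lamS: "lam ?c (flip ?c X) = lam ?c X" unfolding lam_def using lamf by blast
  have lam2: "lam k (flip ?c X) = (if conn k X then {} else {?c}) \<union> lam ?c X"
    using lamk[of "flip ?c X"] lamS by simp
  have cl: "?c \<notin> lam ?c X" by (simp add: lam_def)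
  have qsplit: "qts ?c X = qts k X \<union> qts k (flip ?c X)"
    unfolding qts_def split by (auto simp: flip_mem)
  \<comment> \<open>A disconnected partial resolution contains no quasi-tree, as undoing smoothings
    cannot disconnect a single circle.\<close>
  have qempty: "qts k Y = {}" if "\<not> conn k Y" "Y \<subseteq> {1..n}" for Y
  proof -
    have "conn k Y" if "Q \<in> qts k Y" for Q
      using that conn_mono[of 0 Q k] conn_agree[of Q Y k] kn \<open>Y \<subseteq> {1..n}\<close> by (auto simp: qts_def)
    then show ?thesis using that by blast
  qed
  consider "conn k X" "conn k (flip ?c X)" | "conn k X" "\<not> conn k (flip ?c X)" | "\<not> conn k X" "conn k (flip ?c X)"
    using conn_resolve[OF Suc(4) Suc(2)] by blast
  then show ?case
  proof cases
    case 1
    \<comment> \<open>The differential only adds B-smoothings, so the child without the crossing is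
      the source of the cone.\<close>
    define XA where "XA = (if ?c \<in> X then flip ?c X else X)"
    define XB where "XB = (if ?c \<in> X then X else flip ?c X)"
    define \<Lambda> where "\<Lambda> = lam ?c X"
    have XAB: "XA \<subseteq> {1..n}" "XB \<subseteq> {1..n}" "conn k XA" "conn k XB" "?c \<notin> XA" "?c \<in> XB"
      "lam k XA = \<Lambda>" "lam k XB = \<Lambda>" using 1 Suc(3) fX lam1 lam2 by (auto simp: XA_def XB_def \<Lambda>_def flip_mem)
    have XAB': "i \<in> XA \<longleftrightarrow> i \<in> X" "i \<in> XB \<longleftrightarrow> i \<in> X" if "i \<in> {?c<..n}" for i
      using that by (auto simp: XA_def XB_def flip_mem)
    define GA where "GA = tail k XA \<Lambda>"
    define GB where "GB = tail k XB \<Lambda>"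
    have GAm: "(S, L) \<in> GA \<longleftrightarrow> (S, L) \<in> G \<and> ?c \<notin> S" for S L
      using XAB cl XAB' unfolding GA_def Suc(5) tail_def split by (auto simp: \<Lambda>_def)
    have GBm: "(S, L) \<in> GB \<longleftrightarrow> (S, L) \<in> G \<and> ?c \<in> S" for S L
      using XAB cl XAB' unfolding GB_def Suc(5) tail_def split by (auto simp: \<Lambda>_def)
    have GU: "G = GA \<union> GB" and dis: "GA \<inter> GB = {}" using GAm GBm by auto
    have tri: "blk G G dK x y = 0" if "x \<in> GB" "y \<in> GA" for x y
    proof -
      obtain S L T M where "x = (S, L)" "y = (T, M)" by force
      then have "?c \<in> S" "?c \<notin> T" using that GAm GBm by auto
      then have "dK x y = 0" using \<open>x = (S, L)\<close> \<open>y = (T, M)\<close> by (auto simp: dK_def)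
      then show ?thesis by (simp add: blk_def)
    qed
    have cx: "complex (GA \<union> GB) deg (blk G G dK)" using Suc(6) GU by simp
    have bA: "blk GA GA (blk G G dK) = blk GA GA dK" and bB: "blk GB GB (blk G G dK) = blk GB GB dK"
      using GU by (auto intro: blk_blk)
    have parts: "complex GA deg (blk GA GA (blk G G dK))" "complex GB deg (blk GB GB (blk G G dK))"
      by (rule complex_blk[OF cx]; use tri in auto)+
    obtain eA where eA: "sdr GA deg (blk GA GA dK) (qts k XA) qdeg eA"
      using Suc(1)[OF kn XAB(1,3) _ parts(1)[unfolded bA]] XAB(7) GA_def by auto
    obtain eB where eB: "sdr GB deg (blk GB GB dK) (qts k XB) qdeg eB"
      using Suc(1)[OF kn XAB(2,4) _ parts(2)[unfolded bB]] XAB(8) GB_def by auto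
    have q: "qts ?c X = qts k XA \<union> qts k XB" using qsplit by (auto simp: XA_def XB_def)
    have qd: "qts k XA \<inter> qts k XB = {}" using XAB(5,6) unfolding qts_def split by auto
    have qf: "finite (qts k Y)" for Y by (rule finite_subset[of _ "Pow {1..n}"]) (auto simp: qts_def)
    have fin: "finite GA" "finite GB" using parts by (auto simp: complex_def)
    have "\<exists>e. sdr (GA \<union> GB) deg (blk G G dK) (qts k XA \<union> qts k XB) qdeg e"
      by (rule sdr_cone[OF fin qf qf dis qd cx tri eA[folded bA] eB[folded bB]])
    then show ?thesis using GU q by simp
  next
    case 2
    \<comment> \<open>The crossing now belongs to \<open>lam k X\<close>, so \<open>tail\<close>
      puts no condition on it and keeps both smoothings.\<close>
    have "tail ?c X (lam ?c X) = tail k X (lam k X)"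
      using lam1 2 unfolding tail_def split by auto
    moreover have "qts ?c X = qts k X" using qsplit qempty[OF 2(2) fX] by simp
    ultimately show ?thesis using Suc(1)[OF kn Suc(3) 2(1) _ Suc(6)] Suc(5) by simp
  next
    case 3
    have "tail ?c X (lam ?c X) = tail k (flip ?c X) (lam k (flip ?c X))"
      using lam2 3 unfolding tail_def split by (auto simp: flip_mem)
    moreover have "qts ?c X = qts k (flip ?c X)" using qsplit qempty[OF 3(1) Suc(3)] by simp
    ultimately show ?thesis using Suc(1)[OF kn fX 3(2) _ Suc(6)] Suc(5) by simp
  qed
qed

theorem gens_sdr:
  assumes "conn n {}"
  shows "\<exists>e. sdr gens deg dK {Q. Q \<subseteq> {1..n} \<and> conn 0 Q} qdeg e"
proof -
  have t: "tail n {} (lam n {}) = gens" by (auto simp: tail_def)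
  have b: "blk gens gens dK = dK" by (auto simp: blk_def dK_def fun_eq_iff)
  have q: "qts n {} = {Q. Q \<subseteq> {1..n} \<and> conn 0 Q}" by (auto simp: qts_def)
  show ?thesis using tail_sdr[of n "{}" gens] assms complex_dK unfolding t b q by simp
qed

end

section \<open>Transpositions and cycles\<close>

locale fin_perm =
  fixes M :: "'a set" and f :: "'a \<Rightarrow> 'a"
  assumes fin: "finite M" and into: "x \<in> M \<Longrightarrow> f x \<in> M" and inj: "inj_on f M"
begin

lemma pow_in: "x \<in> M \<Longrightarrow> (f ^^ k) x \<in> M"
  by (induction k) (auto simp: into)

lemma pow_inj: "x \<in> M \<Longrightarrow> y \<in> M \<Longrightarrow> (f ^^ k) x = (f ^^ k) y \<Longrightarrow> x = y"
proof (induction k)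
  case (Suc k)
  then show ?case using inj_onD[OF inj, of "(f ^^ k) x" "(f ^^ k) y"] pow_in by auto
qed simp

lemma period: assumes x: "x \<in> M" obtains m where "m > 0" "(f ^^ m) x = x"
proof -
  have "\<not> inj_on (\<lambda>k. (f ^^ k) x) UNIV"
  proof
    assume "inj_on (\<lambda>k. (f ^^ k) x) UNIV"
    moreover have "range (\<lambda>k. (f ^^ k) x) \<subseteq> M" using pow_in[OF x] by auto
    ultimately show False using fin finite_subset finite_imageD infinite_UNIV_nat by metis
  qed
  then obtain i j where ij: "i < j" "(f ^^ i) x = (f ^^ j) x"
    by (auto simp: inj_on_def) (metis linorder_neqE_nat)
  have "(f ^^ i) ((f ^^ (j - i)) x) = (f ^^ i) x"
    using ij by (metis add_diff_inverse_nat comp_apply funpow_add not_less_iff_gr_or_eq)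
  then have "(f ^^ (j - i)) x = x" using pow_inj x pow_in by blast
  then show ?thesis using that[of "j - i"] ij by simp
qed

lemma orbit_self: "x \<in> perm_orbit f x"
  by (auto simp: perm_orbit_def intro!: exI[of _ 0])

lemma orbit_step: "y \<in> perm_orbit f x \<Longrightarrow> f y \<in> perm_orbit f x"
proof -
  assume "y \<in> perm_orbit f x"
  then obtain k where "y = (f ^^ k) x" by (auto simp: perm_orbit_def)
  then have "f y = (f ^^ Suc k) x" by simp
  then show ?thesis unfolding perm_orbit_def by blast
qed

lemma orbit_sub: "x \<in> M \<Longrightarrow> perm_orbit f x \<subseteq> M"
  using pow_in by (auto simp: perm_orbit_def)

lemma orbit_least: "x \<in> A \<Longrightarrow> (\<And>y. y \<in> A \<Longrightarrow> f y \<in> A) \<Longrightarrow> perm_orbit f x \<subseteq> A"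
proof -
  assume "x \<in> A" "\<And>y. y \<in> A \<Longrightarrow> f y \<in> A"
  then have "(f ^^ k) x \<in> A" for k by (induction k) auto
  then show ?thesis by (auto simp: perm_orbit_def)
qed

lemma orbit_back:
  assumes x: "x \<in> M" and y: "y \<in> perm_orbit f x" shows "x \<in> perm_orbit f y"
proof -
  obtain k where k: "y = (f ^^ k) x" using y by (auto simp: perm_orbit_def)
  obtain m where m: "m > 0" "(f ^^ m) x = x" using period[OF x] .
  have mk: "(f ^^ (m * j)) x = x" for j
    by (induction j) (simp_all add: funpow_add m(2))
  have "k \<le> m * k" using m(1) by simp
  then have "(f ^^ (m * k - k)) y = x"
    unfolding k using mk[of k] by (metis comp_apply funpow_add le_add_diff_inverse2)
  then show ?thesis by (auto simp: perm_orbit_def)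
qed

lemma orbit_trans: "y \<in> perm_orbit f x \<Longrightarrow> z \<in> perm_orbit f y \<Longrightarrow> z \<in> perm_orbit f x"
proof -
  assume "y \<in> perm_orbit f x" "z \<in> perm_orbit f y"
  then obtain k j where "y = (f ^^ k) x" "z = (f ^^ j) y" by (auto simp: perm_orbit_def)
  then have "z = (f ^^ (j + k)) x" by (simp add: funpow_add)
  then show ?thesis unfolding perm_orbit_def by blast
qed

lemma orbit_eq_iff: "x \<in> M \<Longrightarrow> y \<in> M \<Longrightarrow> perm_orbit f y = perm_orbit f x \<longleftrightarrow> y \<in> perm_orbit f x"
  using orbit_self orbit_back orbit_trans by (intro iffI equalityI subsetI) blast+

lemma orbit_f: "x \<in> M \<Longrightarrow> perm_orbit f (f x) = perm_orbit f x"
  using orbit_eq_iff[of x "f x"] into orbit_step orbit_self by blast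

end

text \<open>After its first step from \<open>u\<close>, \<open>f'\<close> runs along the old cycle
  of \<open>v\<close>, which avoids \<open>u\<close>, and so arrives at \<open>v\<close>.\<close>

lemma fin_perm_swap_sep:
  assumes p: "fin_perm M f" and uv: "u \<in> M" "v \<in> M" "u \<noteq> v"
    and f': "\<And>x. x \<in> M \<Longrightarrow> f' x = (if x = u then f v else if x = v then f u else f x)"
    and ne: "perm_orbit f u \<noteq> perm_orbit f v"
  shows "v \<in> perm_orbit f' u"
proof -
  interpret f: fin_perm M f by (rule p)
  have un: "u \<notin> perm_orbit f v" using ne f.orbit_eq_iff uv by blast
  define m where "m = (LEAST m. m > 0 \<and> (f ^^ m) v = v)"
  obtain m0 where "m0 > 0 \<and> (f ^^ m0) v = v" using f.period[OF uv(2)] by blast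
  then have m: "m > 0 \<and> (f ^^ m) v = v" unfolding m_def by (rule LeastI)
  have min: "(f ^^ i) v \<noteq> v" if "i > 0" "i < m" for i using that not_less_Least unfolding m_def by blast
  have "0 < i \<Longrightarrow> i \<le> m \<Longrightarrow> (f' ^^ i) u = (f ^^ i) v" for i
  proof (induction i)
    case (Suc i)
    show ?case
    proof (cases "i = 0")
      case True then show ?thesis using f' uv by simp
    next
      case False
      then have "(f' ^^ i) u = (f ^^ i) v" using Suc by simp
      moreover have "(f ^^ i) v \<noteq> v" using min False Suc by simp
      moreover have "(f ^^ i) v \<noteq> u" using un by (auto simp: perm_orbit_def)
      ultimately show ?thesis using f'[OF f.pow_in[OF uv(2)]] by simp
    qed
  qed simp
  then have "(f' ^^ m) u = v" using m by simp
  then show ?thesis by (auto simp: perm_orbit_def)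
qed

text \<open>From \<open>u\<close>, \<open>f'\<close> follows the old path starting at
  \<open>v\<close>. This path meets \<open>u\<close> before it returns to \<open>v\<close>, so the
  new cycle closes up without \<open>v\<close>.\<close>

lemma fin_perm_swap_join:
  assumes p: "fin_perm M f" and uv: "u \<in> M" "v \<in> M" "u \<noteq> v"
    and f': "\<And>x. x \<in> M \<Longrightarrow> f' x = (if x = u then f v else if x = v then f u else f x)"
    and e: "perm_orbit f u = perm_orbit f v"
  shows "v \<notin> perm_orbit f' u"
proof -
  interpret f: fin_perm M f by (rule p)
  have "u \<in> perm_orbit f v" using e f.orbit_self by blast
  then obtain k where k: "u = (f ^^ k) v" by (auto simp: perm_orbit_def)
  then have k0: "k > 0" using uv by (cases k) auto
  define m where "m = (LEAST m. m > 0 \<and> ((f ^^ m) v = u \<or> (f ^^ m) v = v))"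
  have m: "m > 0 \<and> ((f ^^ m) v = u \<or> (f ^^ m) v = v)" unfolding m_def by (rule LeastI[of _ k]) (use k k0 in auto)
  have min: "(f ^^ i) v \<noteq> v \<and> (f ^^ i) v \<noteq> u" if "i > 0" "i < m" for i using that not_less_Least unfolding m_def by blast
  \<comment> \<open>Otherwise the path would return to \<open>v\<close> first and repeat forever
    without reaching \<open>u\<close>.\<close>
  have mu: "(f ^^ m) v = u"
  proof (rule ccontr)
    assume "(f ^^ m) v \<noteq> u"
    then have mv: "(f ^^ m) v = v" using m by auto
    have "(f ^^ k) v = (f ^^ (k mod m)) v" using mv by (simp add: funpow_mod_eq)
    then have "u = (f ^^ (k mod m)) v" using k by simp
    moreover have "k mod m < m" using m by simp
    ultimately show False using min[of "k mod m"] uv by (cases "k mod m = 0") auto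
  qed
  have pw: "0 < i \<Longrightarrow> i \<le> m \<Longrightarrow> (f' ^^ i) u = (f ^^ i) v" for i
  proof (induction i)
    case (Suc i)
    show ?case
    proof (cases "i = 0")
      case True then show ?thesis using f' uv by simp
    next
      case False
      then have "(f' ^^ i) u = (f ^^ i) v" using Suc by simp
      moreover have "(f ^^ i) v \<noteq> v \<and> (f ^^ i) v \<noteq> u" using min False Suc by simp
      ultimately show ?thesis using f'[OF f.pow_in[OF uv(2)]] by simp
    qed
  qed simp
  have mu': "(f' ^^ m) u = u" using pw[of m] m mu by simp
  show ?thesis
  proof
    assume "v \<in> perm_orbit f' u"
    then obtain j where j: "v = (f' ^^ j) u" by (auto simp: perm_orbit_def)
    then have "v = (f' ^^ (j mod m)) u" using mu' by (simp add: funpow_mod_eq)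
    moreover have "j mod m < m" using m by simp
    ultimately show False using pw[of "j mod m"] min[of "j mod m"] uv by (cases "j mod m = 0") auto
  qed
qed

lemma fin_perm_swap_toggle:
  assumes "fin_perm M f" "fin_perm M f'" "u \<in> M" "v \<in> M" "u \<noteq> v"
    and "\<And>x. x \<in> M \<Longrightarrow> f' x = (if x = u then f v else if x = v then f u else f x)"
  shows "perm_orbit f' u = perm_orbit f' v \<longleftrightarrow> perm_orbit f u \<noteq> perm_orbit f v"
  using fin_perm_swap_sep[OF assms(1,3-6)] fin_perm_swap_join[OF assms(1,3-6)]
    fin_perm.orbit_eq_iff[OF assms(2,3,4)] by metis

text \<open>The union of the two cycles is closed under \<open>f'\<close>, and
  \<open>fin_perm_swap_sep\<close> makes it a single cycle. Cycles that miss \<open>u\<close> and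
  \<open>v\<close> are unchanged.\<close>

lemma fin_perm_swap_glue:
  assumes p: "fin_perm M f" and p': "fin_perm M f'" and uv: "u \<in> M" "v \<in> M" "u \<noteq> v"
    and f': "\<And>x. x \<in> M \<Longrightarrow> f' x = (if x = u then f v else if x = v then f u else f x)"
    and ne: "perm_orbit f u \<noteq> perm_orbit f v" and x: "x \<in> M"
  shows "perm_orbit f' x = (if x \<in> perm_orbit f u \<union> perm_orbit f v
     then perm_orbit f u \<union> perm_orbit f v else perm_orbit f x)"
proof -
  interpret f: fin_perm M f by (rule p)
  interpret f': fin_perm M f' by (rule p')
  let ?U = "perm_orbit f u \<union> perm_orbit f v"
  have UM: "?U \<subseteq> M" using f.orbit_sub uv by blast
  have Ucl: "f' y \<in> ?U" if "y \<in> ?U" for y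
  proof -
    have "y \<in> M" using UM that by blast
    then show ?thesis using that f.orbit_step f.orbit_self f'[of y] by (auto split: if_splits)
  qed
  have vu: "v \<in> perm_orbit f' u" by (rule fin_perm_swap_sep[OF p uv f' ne])
  have fu: "f u \<in> perm_orbit f' u" using f'.orbit_step[OF vu] f'[OF uv(2)] uv(3) by simp
  have fv: "f v \<in> perm_orbit f' u" using f'.orbit_step[OF f'.orbit_self, of u] f'[OF uv(1)] by simp
  have step: "f y \<in> perm_orbit f' u" if "y \<in> perm_orbit f' u" for y
  proof -
    have "y \<in> M" using that f'.orbit_sub[OF uv(1)] by blast
    then show ?thesis using f'.orbit_step[OF that] f'[of y] fu fv by (auto split: if_splits)
  qed
  have sub: "?U \<subseteq> perm_orbit f' u"
    using f.orbit_least[of u "perm_orbit f' u"] f.orbit_least[of v "perm_orbit f' u"] step f'.orbit_self vu by blast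
  show ?thesis
  proof (cases "x \<in> ?U")
    case True
    then have "perm_orbit f' x = perm_orbit f' u" using sub f'.orbit_eq_iff[OF uv(1) x] by blast
    moreover have "perm_orbit f' x \<subseteq> ?U" by (rule f'.orbit_least) (use True Ucl in auto)
    ultimately show ?thesis using sub True by simp
  next
    case False
    have "(f ^^ k) x \<notin> {u, v} \<and> (f' ^^ k) x = (f ^^ k) x" for k
    proof (induction k)
      case 0
      then show ?case using False f.orbit_self by auto
    next
      case (Suc k)
      have "(f ^^ Suc k) x \<noteq> u" "(f ^^ Suc k) x \<noteq> v"
        using False f.orbit_back[OF x] by (auto simp: perm_orbit_def simp del: funpow.simps)
      then show ?case using Suc f'[OF f.pow_in[OF x]] by simp
    qed
    then have "perm_orbit f' x = perm_orbit f x" by (auto simp: perm_orbit_def)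
    then show ?thesis using False by simp
  qed
qed

text \<open>Cutting a cycle at two of its points yields the arcs \<open>(lo, hi]\<close> and its complement.\<close>
lemma fin_perm_swap_arcs:
  assumes p: "fin_perm M f" and p': "fin_perm M f'" and uv: "u \<in> M" "v \<in> M" "u \<noteq> v"
    and f': "\<And>x. x \<in> M \<Longrightarrow> f' x = (if x = u then f v else if x = v then f u else f x)"
    and one: "perm_orbit f o1 = M" "o1 \<in> M"
    and xy: "x \<in> M" "y \<in> M" "x \<noteq> u" "x \<noteq> v" "y \<noteq> u" "y \<noteq> v"
  defines "pos \<equiv> \<lambda>j. LEAST k. (f ^^ k) o1 = j"
  defines "lo \<equiv> min (pos u) (pos v)" and "hi \<equiv> max (pos u) (pos v)"
  shows "perm_orbit f' x = perm_orbit f' y \<longleftrightarrow> (lo < pos x \<and> pos x < hi) = (lo < pos y \<and> pos y < hi)"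
proof -
  interpret f: fin_perm M f by (rule p)
  interpret f': fin_perm M f' by (rule p')
  have pos: "(f ^^ pos z) o1 = z" if "z \<in> M" for z
  proof -
    have "z \<in> perm_orbit f o1" using that one(1) by simp
    then obtain k where "(f ^^ k) o1 = z" by (auto simp: perm_orbit_def)
    then show ?thesis unfolding pos_def by (rule LeastI)
  qed
  have pos_le: "pos ((f ^^ k) o1) \<le> k" for k unfolding pos_def by (rule Least_le) simp
  have pos_inj: "z = w" if "z \<in> M" "w \<in> M" "pos z = pos w" for z w using pos that by metis
  have pos_f: "pos (f z) = Suc (pos z) \<or> pos (f z) = 0" if z: "z \<in> M" for z
  proof -
    have fz: "f z = (f ^^ Suc (pos z)) o1" using pos[OF z] by simp
    then have le: "pos (f z) \<le> Suc (pos z)" using pos_le by metis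
    show ?thesis
    proof (cases "pos (f z)")
      case (Suc q)
      have "f ((f ^^ q) o1) = f z" using pos[OF f.into[OF z]] Suc by simp
      then have "(f ^^ q) o1 = z" using inj_onD[OF f.inj] f.pow_in[OF one(2)] z by blast
      then have "pos z \<le> q" using pos_le by blast
      then show ?thesis using le Suc by simp
    qed simp
  qed
  define I where "I = {z \<in> M. lo < pos z \<and> pos z \<le> hi}"
  have "pos u \<noteq> pos v" using pos_inj[OF uv(1,2)] uv(3) by blast
  then have lohi: "lo < hi" unfolding lo_def hi_def by linarith
  have ends: "z = u \<or> z = v" if "z \<in> M" "pos z = lo \<or> pos z = hi" for z
    using that pos_inj uv unfolding lo_def hi_def by (metis max_def min_def)
  obtain s t where st: "s \<in> M" "t \<in> M" "pos s = lo" "pos t = hi" "(u = s \<and> v = t) \<or> (u = t \<and> v = s)"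
    using uv unfolding lo_def hi_def by (metis max_def min_def)
  have f's: "f' s = f t" "f' t = f s" and f'o: "\<And>z. z \<in> M \<Longrightarrow> z \<noteq> s \<Longrightarrow> z \<noteq> t \<Longrightarrow> f' z = f z"
    using f' st uv by (auto split: if_splits)
  \<comment> \<open>The numbering cannot wrap around after \<open>s\<close>: the cycle would then
    have only \<open>Suc lo\<close> positions, too few for the point at \<open>hi\<close>.\<close>
  have fs: "pos (f s) = Suc lo"
  proof -
    have "f s = (f ^^ Suc lo) o1" using pos[OF st(1)] st(3) by simp
    moreover have "pos (f s) \<noteq> 0"
    proof
      assume "pos (f s) = 0"
      then have e: "f s = o1" using pos[OF f.into[OF st(1)]] by simp
      have "(f ^^ Suc lo) o1 = o1" using pos[OF st(1)] st(3) e by simp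
      then have "(f ^^ hi) o1 = (f ^^ (hi mod Suc lo)) o1" by (simp add: funpow_mod_eq)
      then have "t = (f ^^ (hi mod Suc lo)) o1" using pos[OF st(2)] st(4) by simp
      then have "hi \<le> hi mod Suc lo" using pos_le st(4) by metis
      moreover have "hi mod Suc lo < Suc lo" by simp
      ultimately show False using lohi by linarith
    qed
    ultimately show ?thesis using pos_f[OF st(1)] st(3) by auto
  qed
  have ft: "pos (f t) = Suc hi \<or> pos (f t) = 0" using pos_f[OF st(2)] st(4) by simp
  have Icl: "f' z \<in> I" if z: "z \<in> I" for z
  proof -
    have zM: "z \<in> M" and zp: "lo < pos z" "pos z \<le> hi" using z by (auto simp: I_def)
    show ?thesis
    proof (cases "z = t")
      case True
      then show ?thesis using f's fs lohi f.into[OF st(1)] by (auto simp: I_def)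
    next
      case False
      have zs: "z \<noteq> s" using zp st(3) by auto
      have "pos z < hi" using zp ends[OF zM] False zs st(5) by fastforce
      moreover have "pos (f z) \<noteq> 0"
      proof
        assume "pos (f z) = 0"
        then have e: "f z = o1" using pos[OF f.into[OF zM]] by simp
        have "(f ^^ Suc (pos z)) o1 = o1" using pos[OF zM] e by simp
        then have "(f ^^ hi) o1 = (f ^^ (hi mod Suc (pos z))) o1" by (simp add: funpow_mod_eq)
        then have "t = (f ^^ (hi mod Suc (pos z))) o1" using pos[OF st(2)] st(4) by simp
        then have "hi \<le> hi mod Suc (pos z)" using pos_le st(4) by metis
        moreover have "hi mod Suc (pos z) < Suc (pos z)" by simp
        ultimately show False using \<open>pos z < hi\<close> by linarith
      qed
      ultimately show ?thesis using pos_f[OF zM] f'o[OF zM zs False] zp f.into[OF zM] by (auto simp: I_def)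
    qed
  qed
  have Ccl: "f' z \<in> M - I" if z: "z \<in> M - I" for z
  proof -
    have zM: "z \<in> M" and zp: "pos z \<le> lo \<or> pos z > hi" using z by (auto simp: I_def)
    show ?thesis
    proof (cases "z = s")
      case True
      then show ?thesis using f's ft lohi f.into[OF st(2)] by (auto simp: I_def)
    next
      case False
      have zt: "z \<noteq> t" using zp st(4) lohi by auto
      have "pos z < lo \<or> pos z > hi" using zp ends[OF zM] False zt st(5) by fastforce
      then show ?thesis using pos_f[OF zM] f'o[OF zM False zt] f.into[OF zM] lohi by (auto simp: I_def)
    qed
  qed
  have orbI: "perm_orbit f' z \<subseteq> I" if "z \<in> I" for z by (rule f'.orbit_least) (use that Icl in auto)
  have orbC: "perm_orbit f' z \<subseteq> M - I" if "z \<in> M - I" for z by (rule f'.orbit_least) (use that Ccl in auto)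
  have f_eq: "perm_orbit f z = M" if "z \<in> M" for z using f.orbit_eq_iff[OF one(2) that] that one(1) by simp
  have tog: "perm_orbit f' u \<noteq> perm_orbit f' v"
    using fin_perm_swap_toggle[OF p p' uv f'] f_eq uv by simp
  \<comment> \<open>The swap is an involution, so \<open>f\<close> arises by gluing the cycles of
    \<open>f'\<close> at \<open>u\<close> and \<open>v\<close>. Hence these two cycles exhaust
    \<open>M\<close>, and the inclusions in the two arcs become equalities.\<close>
  have f2: "f z = (if z = u then f' v else if z = v then f' u else f' z)" if "z \<in> M" for z
    using f'[OF that] f'[OF uv(1)] f'[OF uv(2)] uv(3) by auto
  have "perm_orbit f u = perm_orbit f' u \<union> perm_orbit f' v"
    using fin_perm_swap_glue[OF p' p uv f2 tog uv(1)] f'.orbit_self by simp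
  then have all: "perm_orbit f' u \<union> perm_orbit f' v = M" using f_eq uv by simp
  have tI: "t \<in> I" and sI: "s \<in> M - I" using st lohi by (auto simp: I_def)
  have "perm_orbit f' s \<union> perm_orbit f' t = M" using all st(5) by auto
  moreover have "I \<subseteq> M" by (auto simp: I_def)
  ultimately have OI: "perm_orbit f' t = I" and OC: "perm_orbit f' s = M - I"
    using orbI[OF tI] orbC[OF sI] by blast+
  have cls: "perm_orbit f' z = (if z \<in> I then I else M - I)" if "z \<in> M" for z
    using that f'.orbit_eq_iff[OF st(2) that] f'.orbit_eq_iff[OF st(1) that] OI OC by auto
  have "I \<noteq> M - I" using tI by blast
  then have "perm_orbit f' x = perm_orbit f' y \<longleftrightarrow> (x \<in> I \<longleftrightarrow> y \<in> I)" using cls xy(1,2) by auto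
  moreover have "z \<in> I \<longleftrightarrow> lo < pos z \<and> pos z < hi" if "z \<in> M" "z \<noteq> u" "z \<noteq> v" for z
    using that ends[of z] by (auto simp: I_def order.order_iff_strict)
  ultimately show ?thesis using xy by auto
qed

section \<open>Planar knot diagrams\<close>

lemma darts_iff: "(c, k) \<in> dg_darts n \<longleftrightarrow> c \<in> {1..n} \<and> k < 4"
  by (auto simp: dg_darts_def)

lemma finite_darts: "finite (dg_darts n)" by (simp add: dg_darts_def)

definition dg_opp :: "nat \<times> nat \<Rightarrow> nat \<times> nat" where "dg_opp d = (fst d, (snd d + 2) mod 4)"

lemma dart_turns:
  assumes "x \<in> dg_darts n"
  shows "dg_opp x \<in> dg_darts n" "dg_rot_inv x \<in> dg_darts n" "dg_opp (dg_opp x) = x" "dg_opp x \<noteq> x"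
    "dg_rot_inv (dg_rot_inv (dg_rot_inv (dg_rot_inv x))) = x" "dg_opp x = dg_rot_inv (dg_rot_inv x)"
proof -
  obtain c k where x: "x = (c, k)" by force
  then have c: "c \<in> {1..n}" and k: "k = 0 \<or> k = 1 \<or> k = 2 \<or> k = 3"
    using assms by (auto simp: darts_iff)
  show "dg_opp x \<in> dg_darts n" "dg_rot_inv x \<in> dg_darts n" "dg_opp (dg_opp x) = x" "dg_opp x \<noteq> x"
    "dg_rot_inv (dg_rot_inv (dg_rot_inv (dg_rot_inv x))) = x" "dg_opp x = dg_rot_inv (dg_rot_inv x)"
    using k c unfolding x by (elim disjE; simp add: darts_iff dg_opp_def dg_rot_inv_def)+
qed

locale knot_dg =
  fixes n :: nat and al :: "nat \<times> nat \<Rightarrow> nat \<times> nat"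
  assumes kd: "knot_diagram n al"
begin

abbreviation "N \<equiv> dg_darts n"

lemma al: "x \<in> N \<Longrightarrow> al x \<in> N" "x \<in> N \<Longrightarrow> al x \<noteq> x" "x \<in> N \<Longrightarrow> al (al x) = x"
  using kd by (auto simp: knot_diagram_def)

lemma n_pos: "n \<ge> 1" using kd by (simp add: knot_diagram_def)

lemma straight: "dg_straight al = dg_opp \<circ> al" by (auto simp: dg_straight_def dg_opp_def)

lemma perm_straight: "fin_perm N (dg_straight al)"
proof
  show "finite N" by (rule finite_darts)
  show "dg_straight al x \<in> N" if "x \<in> N" for x using dart_turns(1)[OF al(1)[OF that]] by (simp add: straight)
  show "inj_on (dg_straight al) N"
    by (rule inj_on_inverseI[of _ "al \<circ> dg_opp"]) (simp add: straight dart_turns(3)[OF al(1)] al)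
qed

lemma perm_face: "fin_perm N (dg_face_perm al)"
proof
  show "finite N" by (rule finite_darts)
  show "dg_face_perm al x \<in> N" if "x \<in> N" for x using dart_turns(2)[OF al(1)[OF that]] by (simp add: dg_face_perm_def)
  show "inj_on (dg_face_perm al) N"
    by (rule inj_on_inverseI[of _ "al \<circ> dg_rot_inv \<circ> dg_rot_inv \<circ> dg_rot_inv"])
      (simp add: dg_face_perm_def dart_turns(5)[OF al(1)] al)
qed

interpretation st: fin_perm N "dg_straight al" by (rule perm_straight)
interpretation fc: fin_perm N "dg_face_perm al" by (rule perm_face)

text \<open>The edge flip and the passage through a crossing both reverse the direction of travel;
  such a reflection of a cycle would have a fixed point.\<close>
lemma reversed_orbit:
  assumes x: "x \<in> N" shows "al x \<notin> perm_orbit (dg_straight al) x"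
proof
  let ?s = "dg_straight al"
  assume "al x \<in> perm_orbit ?s x"
  then obtain k where k: "al x = (?s ^^ k) x" by (auto simp: perm_orbit_def)
  have sal: "?s (al (?s y)) = al y" if "y \<in> N" for y
    using al that dart_turns(1,3)[OF al(1)[OF that]] by (simp add: straight)
  have conj: "(?s ^^ i) (al ((?s ^^ i) x)) = al x" for i
  proof (induction i)
    case (Suc i)
    have "(?s ^^ Suc i) (al ((?s ^^ Suc i) x)) = (?s ^^ i) (?s (al (?s ((?s ^^ i) x))))"
      by (simp add: funpow_swap1)
    also have "\<dots> = al x" using sal[OF st.pow_in[OF x]] Suc by simp
    finally show ?case .
  qed simp
  \<comment> \<open>The fixed point sits halfway between \<open>x\<close> and \<open>al x\<close>:
    it is fixed by \<open>al\<close> if \<open>k\<close> is even and by \<open>dg_opp\<close> if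
    \<open>k\<close> is odd.\<close>
  show False
  proof (cases "even k")
    case True
    then obtain i where i: "k = i + i" by (metis evenE mult_2)
    have "(?s ^^ i) (al ((?s ^^ i) x)) = (?s ^^ i) ((?s ^^ i) x)"
      using conj[of i] k i by (simp add: funpow_add)
    then have "al ((?s ^^ i) x) = (?s ^^ i) x" using st.pow_inj st.pow_in al x by blast
    then show False using al(2) st.pow_in[OF x] by blast
  next
    case False
    then obtain i where i: "k = Suc (i + i)" by (metis oddE Suc_eq_plus1 mult_2)
    let ?y = "(?s ^^ Suc i) x"
    have "(?s ^^ Suc i) (al ?y) = (?s ^^ i) ?y"
      using conj[of "Suc i"] k i by (simp add: funpow_add[symmetric, THEN fun_cong, unfolded comp_apply] funpow_swap1 flip: funpow.simps)
    then have "(?s ^^ i) (?s (al ?y)) = (?s ^^ i) ?y" by (simp add: funpow_swap1)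
    then have "?s (al ?y) = ?y" using st.pow_inj st.into st.pow_in al x by meson
    then have "dg_opp ?y = ?y" using al(3)[OF st.pow_in[OF x, of "Suc i"]] by (simp add: straight del: funpow.simps)
    then show False using dart_turns(4)[OF st.pow_in[OF x, of "Suc i"]] by blast
  qed
qed

text \<open>The two directions of travel have distinct orbits by \<open>reversed_orbit\<close>, and
  a knot diagram has only two orbits.\<close>

lemma two_strands:
  assumes x: "x \<in> N" shows "N = perm_orbit (dg_straight al) x \<union> perm_orbit (dg_straight al) (al x)"
proof -
  let ?O = "perm_orbit (dg_straight al)"
  have ne: "?O x \<noteq> ?O (al x)" using reversed_orbit[OF x] st.orbit_self by blast
  have "card (?O ` N) = 2" using kd by (simp add: knot_diagram_def perm_orbits_def)
  moreover have "{?O x, ?O (al x)} \<subseteq> ?O ` N" using x al by blast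
  ultimately have "?O ` N = {?O x, ?O (al x)}" using ne
    by (metis card_2_iff card_subset_eq finite_darts finite_imageI)
  then have "y \<in> ?O x \<union> ?O (al x)" if "y \<in> N" for y
    using that st.orbit_self[of y] by (metis UnI1 UnI2 image_eqI insertE singletonD)
  then show ?thesis using st.orbit_sub x al by blast
qed

lemma connected_darts:
  assumes A: "A \<subseteq> N" and a: "\<And>x. x \<in> A \<Longrightarrow> al x \<in> A" and r: "\<And>x. x \<in> A \<Longrightarrow> dg_opp x \<in> A"
  shows "A = {} \<or> A = N"
proof (cases "A = {}")
  case False
  then obtain x where x: "x \<in> A" by blast
  have s: "dg_straight al y \<in> A" if "y \<in> A" for y using a r that by (simp add: straight)
  have "perm_orbit (dg_straight al) x \<subseteq> A" "perm_orbit (dg_straight al) (al x) \<subseteq> A"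
    using st.orbit_least s x a by blast+
  then show ?thesis using two_strands[of x] x A by blast
qed simp

section \<open>Checkerboard colouring from a count of mod 2 cycles\<close>

definition face_sets :: "(nat \<times> nat) set set" where
  "face_sets = {A. A \<subseteq> N \<and> (\<forall>x\<in>N. dg_face_perm al x \<in> A \<longleftrightarrow> x \<in> A) \<and> (1, 0) \<notin> A}"

definition cob :: "(nat \<times> nat) set \<Rightarrow> (nat \<times> nat) set" where
  "cob A = {x \<in> N. (x \<in> A) \<noteq> (al x \<in> A)}"

text \<open>The mod 2 cycle space of the underlying graph: sets of edges that contain an even number
  of the four darts at every crossing.\<close>

definition even_sets :: "(nat \<times> nat) set set" where
  "even_sets = {E. E \<subseteq> N \<and> (\<forall>x\<in>N. al x \<in> E \<longleftrightarrow> x \<in> E)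
     \<and> (\<forall>c\<in>{1..n}. ((c, 0) \<in> E) \<noteq> ((c, 2) \<in> E) \<longleftrightarrow> ((c, 1) \<in> E) \<noteq> ((c, 3) \<in> E))}"

lemma base_dart: "(1, 0) \<in> N" using n_pos by (simp add: darts_iff)

text \<open>There are \<open>n + 2\<close> faces by planarity, and only the face of
  \<open>(1, 0)\<close> is excluded from the unions.\<close>

lemma card_face_sets: "card face_sets \<ge> 2 ^ (n + 1)"
proof -
  let ?O = "perm_orbit (dg_face_perm al)"
  let ?Os = "?O ` N - {?O (1, 0)}"
  have "card (?O ` N) = n + 2" using kd by (simp add: knot_diagram_def perm_orbits_def)
  then have "card ?Os = n + 1" using base_dart finite_darts by (simp add: card_Diff_singleton)
  then have cP: "card (Pow ?Os) = 2 ^ (n + 1)" using finite_darts by (simp add: card_Pow)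
  have mem: "x \<in> \<Union>U \<longleftrightarrow> ?O x \<in> U" if U: "U \<subseteq> ?O ` N" "x \<in> N" for U x
  proof
    assume "x \<in> \<Union>U"
    then obtain Y where "Y \<in> U" "x \<in> Y" by blast
    moreover from this obtain y where "Y = ?O y" "y \<in> N" using U(1) by blast
    ultimately show "?O x \<in> U" using fc.orbit_eq_iff U by metis
  qed (use fc.orbit_self in blast)
  have inj: "inj_on Union (Pow ?Os)"
  proof (rule inj_onI)
    fix U V assume U: "U \<in> Pow ?Os" "V \<in> Pow ?Os" "\<Union>U = \<Union>V"
    have iff: "X \<in> U \<longleftrightarrow> X \<in> V" if X: "X \<in> ?O ` N" for X
    proof -
      obtain x where x: "X = ?O x" "x \<in> N" using X by blast
      have "U \<subseteq> ?O ` N" "V \<subseteq> ?O ` N" using U by blast+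
      then show ?thesis using mem[OF _ x(2), of U] mem[OF _ x(2), of V] U(3) x(1) by simp
    qed
    have sub: "U \<subseteq> ?O ` N" "V \<subseteq> ?O ` N" using U by blast+
    show "U = V"
    proof (rule Set.set_eqI)
      show "X \<in> U \<longleftrightarrow> X \<in> V" for X
        using iff[of X] subsetD[OF sub(1), of X] subsetD[OF sub(2), of X] by argo
    qed
  qed
  have sub: "Union ` Pow ?Os \<subseteq> face_sets"
  proof
    fix A assume "A \<in> Union ` Pow ?Os"
    then obtain U where U: "U \<subseteq> ?Os" "A = \<Union>U" by auto
    have UO: "U \<subseteq> ?O ` N" and nU: "?O (1, 0) \<notin> U" using U by auto
    have "A \<subseteq> N"
    proof
      fix x assume "x \<in> A"
      then obtain X where X: "X \<in> U" "x \<in> X" using U(2) by blast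
      then obtain y where "X = ?O y" "y \<in> N" using UO by blast
      then show "x \<in> N" using X(2) fc.orbit_sub by blast
    qed
    moreover have "dg_face_perm al x \<in> A \<longleftrightarrow> x \<in> A" if "x \<in> N" for x
      using mem[OF UO that] mem[OF UO fc.into[OF that]] fc.orbit_f[OF that] U(2) by simp
    moreover have "(1, 0) \<notin> A" using mem[OF UO base_dart] nU U(2) by simp
    ultimately show "A \<in> face_sets" by (simp add: face_sets_def)
  qed
  have "finite face_sets" by (rule finite_subset[of _ "Pow N"]) (auto simp: face_sets_def finite_darts)
  then have "card (Union ` Pow ?Os) \<le> card face_sets" using sub by (rule card_mono)
  then show ?thesis using card_image[OF inj] cP by simp
qed

text \<open>Two face sets with the same coboundary differ by a set closed under edges and rotation,
  hence by nothing or by everything; the excluded dart rules out the latter.\<close>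

lemma inj_cob: "inj_on cob face_sets"
proof (rule inj_onI)
  fix A B assume A: "A \<in> face_sets" and B: "B \<in> face_sets" and e: "cob A = cob B"
  define T where "T = {x \<in> N. (x \<in> A) \<noteq> (x \<in> B)}"
  have Tal: "al x \<in> T" if "x \<in> T" for x
  proof -
    have x: "x \<in> N" "(x \<in> A) \<noteq> (x \<in> B)" using that by (auto simp: T_def)
    have "x \<in> cob A \<longleftrightarrow> x \<in> cob B" using e by simp
    then have "((x \<in> A) \<noteq> (al x \<in> A)) = ((x \<in> B) \<noteq> (al x \<in> B))" using x by (simp add: cob_def)
    then show ?thesis using x al by (auto simp: T_def)
  qed
  have Tr: "dg_rot_inv x \<in> T" if "x \<in> T" for x
  proof -
    have ax: "al x \<in> T" by (rule Tal[OF that])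
    then have N: "al x \<in> N" "x \<in> N" using that by (auto simp: T_def)
    have "dg_face_perm al (al x) \<in> T" using ax N(1) A B fc.into[OF N(1)] by (auto simp: T_def face_sets_def)
    then show ?thesis using al(3)[OF N(2)] by (simp add: dg_face_perm_def)
  qed
  have "dg_opp x \<in> T" if "x \<in> T" for x
  proof -
    have "x \<in> N" using that by (simp add: T_def)
    then show ?thesis using Tr[OF Tr[OF that]] dart_turns(6) by simp
  qed
  then have "T = {} \<or> T = N" using Tal by (intro connected_darts) (auto simp: T_def)
  moreover have "(1, 0) \<notin> T" using A B by (simp add: T_def face_sets_def)
  ultimately have "T = {}" using base_dart by blast
  then show "A = B" using A B by (auto simp: T_def face_sets_def)
qed

text \<open>Around a crossing, \<open>cob A\<close> records the changes of membership in
  \<open>A\<close> between neighbouring faces, and a closed tour has an even number of them.\<close>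

lemma cob_even: assumes A: "A \<in> face_sets" shows "cob A \<in> even_sets"
proof -
  have m: "x \<in> cob A \<longleftrightarrow> (x \<in> A) \<noteq> (dg_rot_inv x \<in> A)" if x: "x \<in> N" for x
  proof -
    have "dg_face_perm al (al x) \<in> A \<longleftrightarrow> al x \<in> A" using A al(1)[OF x] by (simp add: face_sets_def)
    then show ?thesis using al(3)[OF x] x by (simp add: cob_def dg_face_perm_def)
  qed
  have "((c, 0) \<in> cob A) \<noteq> ((c, 2) \<in> cob A) \<longleftrightarrow> ((c, 1) \<in> cob A) \<noteq> ((c, 3) \<in> cob A)" if "c \<in> {1..n}" for c
    using that m[of "(c, 0)"] m[of "(c, 1)"] m[of "(c, 2)"] m[of "(c, 3)"]
    by (auto simp: darts_iff dg_rot_inv_def)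
  then show ?thesis using al by (auto simp: even_sets_def cob_def)
qed

text \<open>Travelling along the knot, an even set is determined by its value at one dart and by the
  crossings at which the value changes. Evenness makes both strands of a crossing change together,
  which leaves \<open>n + 1\<close> bits.\<close>

lemma card_even_sets: "card even_sets \<le> 2 ^ (n + 1)" and finite_even_sets: "finite even_sets"
proof -
  show fin: "finite even_sets" by (rule finite_subset[of _ "Pow N"]) (auto simp: even_sets_def finite_darts)
  define ka where "ka E = ({c \<in> {1..n}. ((c, 0) \<in> E) \<noteq> ((c, 2) \<in> E)}, ((1::nat, 0::nat) \<in> E))" for E :: "(nat \<times> nat) set"
  have "inj_on ka even_sets"
  proof (rule inj_onI)
    fix E F assume E: "E \<in> even_sets" and F: "F \<in> even_sets" and e: "ka E = ka F"
    have b: "(1, 0) \<in> E \<longleftrightarrow> (1, 0) \<in> F" using e by (simp add: ka_def)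
    have ch: "((c, 0) \<in> E) \<noteq> ((c, 2) \<in> E) \<longleftrightarrow> ((c, 0) \<in> F) \<noteq> ((c, 2) \<in> F)" if "c \<in> {1..n}" for c
      using e that unfolding ka_def by blast
    have opp: "dg_opp x \<in> E \<longleftrightarrow> dg_opp x \<in> F" if x: "x \<in> N" "x \<in> E \<longleftrightarrow> x \<in> F" for x
    proof -
      obtain c k where ck: "x = (c, k)" "c \<in> {1..n}" "k < 4" using x(1) by (cases x) (auto simp: darts_iff)
      have k4: "k = 0 \<or> k = 1 \<or> k = 2 \<or> k = 3" using ck(3) by auto
      have "((c, 1) \<in> E) \<noteq> ((c, 3) \<in> E) \<longleftrightarrow> ((c, 1) \<in> F) \<noteq> ((c, 3) \<in> F)"
        using ch[OF ck(2)] E F ck(2) by (simp add: even_sets_def)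
      note odd = this
      have o: "dg_opp (c, 0) = (c, 2)" "dg_opp (c, 1) = (c, 3)" "dg_opp (c, 2) = (c, 0)" "dg_opp (c, 3) = (c, 1)"
        by (simp_all add: dg_opp_def)
      from k4 show ?thesis
      proof (elim disjE)
        assume "k = 0" then show ?thesis using ch[OF ck(2)] x(2) ck(1) o(1) by metis
      next
        assume "k = 1" then show ?thesis using odd x(2) ck(1) o(2) by metis
      next
        assume "k = 2" then show ?thesis using ch[OF ck(2)] x(2) ck(1) o(3) by metis
      next
        assume "k = 3" then show ?thesis using odd x(2) ck(1) o(4) by metis
      qed
    qed
    have alE: "al x \<in> E \<longleftrightarrow> x \<in> E" "al x \<in> F \<longleftrightarrow> x \<in> F" if "x \<in> N" for x using E F that by (auto simp: even_sets_def)
    define T where "T = {x \<in> N. x \<in> E \<longleftrightarrow> x \<in> F}"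
    have "T = {} \<or> T = N" using opp alE al dart_turns(1) by (intro connected_darts) (auto simp: T_def)
    moreover have "(1, 0) \<in> T" using b base_dart by (simp add: T_def)
    ultimately have "T = N" by blast
    then show "E = F" using E F by (auto simp: T_def even_sets_def)
  qed
  moreover have "ka ` even_sets \<subseteq> Pow {1..n} \<times> UNIV" by (auto simp: ka_def)
  ultimately have "card even_sets \<le> card (Pow {1..n} \<times> (UNIV :: bool set))"
    by (metis card_inj_on_le finite_Pow_iff finite_SigmaI finite_UNIV finite_atLeastAtMost)
  then show "card even_sets \<le> 2 ^ (n + 1)" by (simp add: card_cartesian_product card_Pow)
qed

text \<open>Euler's formula makes the coboundary map from faces onto the even edge sets surjective,
  and the set of all edges is even.\<close>
lemma colouring_exists: "\<exists>A. \<forall>x\<in>N. (dg_face_perm al x \<in> A \<longleftrightarrow> x \<in> A) \<and> (al x \<in> A \<longleftrightarrow> x \<notin> A)"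
proof -
  have "cob ` face_sets = even_sets"
  proof (rule card_subset_eq[OF finite_even_sets])
    show sub: "cob ` face_sets \<subseteq> even_sets" using cob_even by blast
    have "card even_sets \<le> card (cob ` face_sets)"
      using card_even_sets card_face_sets card_image[OF inj_cob] by simp
    then show "card (cob ` face_sets) = card even_sets"
      using card_mono[OF finite_even_sets sub] by simp
  qed
  moreover have "N \<in> even_sets" using al by (auto simp: even_sets_def darts_iff)
  ultimately have "N \<in> cob ` face_sets" by simp
  then obtain A where A: "A \<in> face_sets" "N = cob A" by (metis imageE)
  have "al x \<in> A \<longleftrightarrow> x \<notin> A" if "x \<in> N" for x
  proof -
    have "x \<in> cob A" using that A(2) by simp
    then show ?thesis by (simp add: cob_def)
  qed
  moreover have "dg_face_perm al x \<in> A \<longleftrightarrow> x \<in> A" if "x \<in> N" for x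
    using A(1) that by (simp add: face_sets_def)
  ultimately show ?thesis by metis
qed

text \<open>The description in \<open>face_odd\<close> has a unique solution: any colouring can be
  normalised at \<open>outer\<close>, and two solutions differ on a set closed under edges and
  rotation.\<close>

lemma face_odd_props:
  assumes o: "outer \<in> N"
  defines "p \<equiv> face_odd n al outer"
  shows "x \<in> N \<Longrightarrow> p (al x) \<longleftrightarrow> \<not> p x" "x \<in> N \<Longrightarrow> p (dg_rot_inv x) \<longleftrightarrow> \<not> p x"
proof -
  let ?P = "\<lambda>p. (\<forall>x\<in>N. p (dg_face_perm al x) = p x \<and> p (al x) = (\<not> p x)) \<and> \<not> p outer \<and> (\<forall>x. x \<notin> N \<longrightarrow> \<not> p x)"
  obtain A where A: "\<And>x. x \<in> N \<Longrightarrow> (dg_face_perm al x \<in> A \<longleftrightarrow> x \<in> A) \<and> (al x \<in> A \<longleftrightarrow> x \<notin> A)"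
    using colouring_exists by blast
  define p0 where "p0 x \<longleftrightarrow> x \<in> N \<and> ((x \<in> A) \<noteq> (outer \<in> A))" for x
  have P0: "?P p0" using A al(1) fc.into by (auto simp: p0_def)
  have uniq: "p1 = p2" if P: "?P p1" "?P p2" for p1 p2
  proof -
    define T where "T = {x \<in> N. p1 x \<noteq> p2 x}"
    have Tal: "al x \<in> T" if "x \<in> T" for x using that P al(1) by (auto simp: T_def)
    have Tr: "dg_rot_inv x \<in> T" if "x \<in> T" for x
    proof -
      have "al x \<in> T" "x \<in> N" using Tal that by (auto simp: T_def)
      then have "dg_face_perm al (al x) \<in> T" using P fc.into by (auto simp: T_def)
      then show ?thesis using al(3)[OF \<open>x \<in> N\<close>] by (simp add: dg_face_perm_def)
    qed
    have "dg_opp x \<in> T" if "x \<in> T" for x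
    proof -
      have "x \<in> N" using that by (simp add: T_def)
      then show ?thesis using Tr[OF Tr[OF that]] dart_turns(6) by simp
    qed
    then have "T = {} \<or> T = N" using Tal by (intro connected_darts) (auto simp: T_def)
    moreover have "outer \<notin> T" using P by (simp add: T_def)
    ultimately have "T = {}" using o by blast
    then show ?thesis using P unfolding T_def by (intro ext) blast
  qed
  have Pp: "?P p" unfolding p_def face_odd_def by (rule theI[of ?P, OF P0]) (rule uniq[OF _ P0])
  then show 1: "x \<in> N \<Longrightarrow> p (al x) \<longleftrightarrow> \<not> p x" for x by blast
  show "p (dg_rot_inv x) \<longleftrightarrow> \<not> p x" if x: "x \<in> N"
  proof -
    have "p (dg_face_perm al (al x)) = p (al x)" using Pp al(1)[OF x] by blast
    then show ?thesis using al(3)[OF x] 1[OF x] by (simp add: dg_face_perm_def)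
  qed
qed

end

declare One_nat_def [simp del]

lemma smooth_cases:
  "smooth S (c, 0) = (c, if c \<in> S then 1 else 3)" "smooth S (c, 1) = (c, if c \<in> S then 0 else 2)"
  "smooth S (c, 2) = (c, if c \<in> S then 3 else 1)" "smooth S (c, 3) = (c, if c \<in> S then 2 else 0)"
  by (simp_all add: smooth_def)

lemma dart_cases:
  assumes "x \<in> dg_darts n"
  obtains c where "c \<in> {1..n}" "x = (c, 0)" | c where "c \<in> {1..n}" "x = (c, 1)"
    | c where "c \<in> {1..n}" "x = (c, 2)" | c where "c \<in> {1..n}" "x = (c, 3)"
proof -
  obtain c k where x: "x = (c, k)" by force
  then have "c \<in> {1..n}" "k = 0 \<or> k = 1 \<or> k = 2 \<or> k = 3" using assms by (auto simp: darts_iff)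
  then show ?thesis using that x by blast
qed

lemma smooth_in: "x \<in> dg_darts n \<Longrightarrow> smooth S x \<in> dg_darts n"
  and smooth_smooth: "x \<in> dg_darts n \<Longrightarrow> smooth S (smooth S x) = x"
  by (erule dart_cases; simp add: smooth_cases darts_iff)+

section \<open>State circles as cycles of a permutation\<close>

context knot_dg
begin

abbreviation (input) "sc \<equiv> state_circ n al"

definition alt :: "(nat \<times> nat \<Rightarrow> bool) \<Rightarrow> bool" where
  "alt q \<longleftrightarrow> (\<forall>x\<in>N. q (al x) = (\<not> q x) \<and> q (dg_rot_inv x) = (\<not> q x))"

lemma alt_al: "alt q \<Longrightarrow> x \<in> N \<Longrightarrow> q (al x) \<longleftrightarrow> \<not> q x" by (simp add: alt_def)

lemma alt_crossing:
  assumes "alt q" "c \<in> {1..n}"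
  shows "q (c, 1) \<longleftrightarrow> \<not> q (c, 0)" "q (c, 2) \<longleftrightarrow> q (c, 0)" "q (c, 3) \<longleftrightarrow> \<not> q (c, 0)"
proof -
  have r: "q (dg_rot_inv x) = (\<not> q x)" if "x \<in> N" for x using assms(1) that by (simp add: alt_def)
  show "q (c, 1) \<longleftrightarrow> \<not> q (c, 0)" "q (c, 2) \<longleftrightarrow> q (c, 0)" "q (c, 3) \<longleftrightarrow> \<not> q (c, 0)"
    using r[of "(c, 1)"] r[of "(c, 2)"] r[of "(c, 3)"] assms(2) by (auto simp: darts_iff dg_rot_inv_def)
qed

lemma alt_smooth: "alt q \<Longrightarrow> x \<in> N \<Longrightarrow> q (smooth S x) \<longleftrightarrow> \<not> q x"
  by (erule dart_cases) (auto simp: smooth_cases alt_crossing)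

text \<open>A smoothing arc and an edge each reverse the colour of a dart, so \<open>rho\<close>
  preserves the colour classes of a checkerboard colouring. Each edge has one dart of either colour,
  selected by \<open>rep\<close>. In this way the colouring orients all state circles
  coherently.\<close>

definition rho :: "nat set \<Rightarrow> nat \<times> nat \<Rightarrow> nat \<times> nat" where "rho S x = al (smooth S x)"
definition rep :: "(nat \<times> nat \<Rightarrow> bool) \<Rightarrow> nat \<times> nat \<Rightarrow> nat \<times> nat" where
  "rep q x = (if q x then x else al x)"

lemma rep_in: "alt q \<Longrightarrow> x \<in> N \<Longrightarrow> rep q x \<in> {x \<in> N. q x}"
  using al(1) alt_al by (auto simp: rep_def)

lemma perm_rho: assumes q: "alt q" shows "fin_perm {x \<in> N. q x} (rho S)"
proof
  show "finite {x \<in> N. q x}" using finite_darts by simp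
  show "rho S x \<in> {x \<in> N. q x}" if "x \<in> {x \<in> N. q x}" for x
    using that al(1)[OF smooth_in] alt_al[OF q smooth_in] alt_smooth[OF q] by (simp add: rho_def)
  show "inj_on (rho S) {x \<in> N. q x}"
    by (rule inj_on_inverseI[of _ "smooth S \<circ> al"]) (simp add: rho_def al(3)[OF smooth_in] smooth_smooth[of _ n])
qed

lemma rel_al: "x \<in> N \<Longrightarrow> (x, al x) \<in> state_rel n al S"
  and rel_smooth: "x \<in> N \<Longrightarrow> (x, smooth S x) \<in> state_rel n al S"
  unfolding state_rel_def by blast+

text \<open>Along an edge the representative does not move; along a smoothing arc it moves one step
  of \<open>rho\<close>, forwards or backwards.\<close>

lemma state_circ_rho:
  assumes q: "alt q" and x: "x \<in> N"
  shows "y \<in> sc S x \<longleftrightarrow> y \<in> N \<and> rep q y \<in> perm_orbit (rho S) (rep q x)"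
proof -
  interpret fin_perm "{x \<in> N. q x}" "rho S" by (rule perm_rho[OF q])
  let ?O = "perm_orbit (rho S)" and ?R = "state_rel n al S"
  have edge: "v \<in> N \<and> ?O (rep q v) = ?O (rep q u)" if uv: "(u, v) \<in> ?R" for u v
  proof -
    have u: "u \<in> N" and v: "v = al u \<or> v = smooth S u" using uv by (auto simp: state_rel_def)
    show ?thesis
    proof (cases "v = al u")
      case True
      then have "rep q v = rep q u" using alt_al[OF q u] al(3)[OF u] by (simp add: rep_def)
      then show ?thesis using True al(1)[OF u] by simp
    next
      case False
      then have vs: "v = smooth S u" using v by simp
      have vN: "v \<in> N" using smooth_in[OF u] vs by simp
      have qv: "q v \<longleftrightarrow> \<not> q u" using alt_smooth[OF q u] vs by simp
      show ?thesis
      proof (cases "q u")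
        case True
        then have "rep q v = rho S (rep q u)" using qv vs by (simp add: rep_def rho_def)
        then show ?thesis using orbit_f[OF rep_in[OF q u]] vN by simp
      next
        case False
        then have "rep q u = rho S (rep q v)" using qv vs smooth_smooth[OF u] by (simp add: rep_def rho_def)
        then show ?thesis using orbit_f[OF rep_in[OF q vN]] vN by simp
      qed
    qed
  qed
  have 1: "y \<in> N \<and> ?O (rep q y) = ?O (rep q x)" if "(x, y) \<in> ?R\<^sup>*" for y
    using that
  proof (induction rule: rtrancl_induct)
    case base then show ?case using x by simp
  next
    case (step u v)
    then show ?case using edge by metis
  qed
  have to_rep: "(u, rep q u) \<in> ?R\<^sup>*" "(rep q u, u) \<in> ?R\<^sup>*" if "u \<in> N" for u
    using rel_al[OF that, of S] rel_al[OF al(1)[OF that], of S] al(3)[OF that] by (simp_all add: rep_def r_into_rtrancl)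
  have pow: "(u, (rho S ^^ k) u) \<in> ?R\<^sup>*" if "u \<in> {x \<in> N. q x}" for u k
  proof (induction k)
    case (Suc k)
    have w: "(rho S ^^ k) u \<in> N" using pow_in[OF that] by blast
    have "((rho S ^^ k) u, rho S ((rho S ^^ k) u)) \<in> ?R\<^sup>*"
      using rel_smooth[OF w, of S] rel_al[OF smooth_in[OF w, of S], of S] unfolding rho_def by (meson rtrancl.simps)
    then show ?case using Suc by simp
  qed simp
  have 2: "(x, y) \<in> ?R\<^sup>*" if y: "y \<in> N" "rep q y \<in> ?O (rep q x)" for y
  proof -
    have "(rep q x, rep q y) \<in> ?R\<^sup>*" using y(2) pow[OF rep_in[OF q x]] by (auto simp: perm_orbit_def)
    then show ?thesis using to_rep[OF x] to_rep[OF y(1)] by (meson rtrancl_trans)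
  qed
  show ?thesis unfolding state_circ_def mem_Collect_eq
    using 1 2 orbit_eq_iff[OF rep_in[OF q x] rep_in[OF q]] by metis
qed

end

locale knot_pt = knot_dg +
  fixes outer base :: "nat \<times> nat"
  assumes outerN: "outer \<in> N" and baseN: "base \<in> N"
begin

abbreviation "fo \<equiv> face_odd n al outer"

lemma alt_fo: "alt fo" using face_odd_props[OF outerN] by (simp add: alt_def)

lemma alt_iff: "alt q \<Longrightarrow> alt (\<lambda>x. q x \<longleftrightarrow> b)" by (auto simp: alt_def)

lemma sc_refl: "x \<in> N \<Longrightarrow> x \<in> sc S x" by (simp add: state_circ_def)
lemma sc_sub: "x \<in> N \<Longrightarrow> sc S x \<subseteq> N" using state_circ_rho[OF alt_fo] by blast
lemma sc_eqI: assumes "x \<in> N" "y \<in> sc S x" shows "sc S y = sc S x"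
proof -
  interpret fin_perm "{x \<in> N. fo x}" "rho S" by (rule perm_rho[OF alt_fo])
  have y: "y \<in> N" "rep fo y \<in> perm_orbit (rho S) (rep fo x)" using state_circ_rho[OF alt_fo assms(1)] assms(2) by blast+
  then have "perm_orbit (rho S) (rep fo y) = perm_orbit (rho S) (rep fo x)"
    using orbit_eq_iff[OF rep_in[OF alt_fo assms(1)] rep_in[OF alt_fo y(1)]] by simp
  then show ?thesis
    by (intro Set.set_eqI) (simp only: state_circ_rho[OF alt_fo assms(1)] state_circ_rho[OF alt_fo y(1)])
qed

lemma sc_eq_iff: assumes q: "alt q" and x: "x \<in> N" "y \<in> N"
  shows "sc S x = sc S y \<longleftrightarrow> perm_orbit (rho S) (rep q x) = perm_orbit (rho S) (rep q y)"
proof -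
  interpret fin_perm "{x \<in> N. q x}" "rho S" by (rule perm_rho[OF q])
  have "sc S x = sc S y \<longleftrightarrow> x \<in> sc S y" using sc_eqI[OF x(2)] sc_refl[OF x(1)] by blast
  also have "\<dots> \<longleftrightarrow> rep q x \<in> perm_orbit (rho S) (rep q y)" using state_circ_rho[OF q x(2)] x(1) by blast
  also have "\<dots> \<longleftrightarrow> perm_orbit (rho S) (rep q x) = perm_orbit (rho S) (rep q y)"
    using orbit_eq_iff[OF rep_in[OF q x(2)] rep_in[OF q x(1)]] by blast
  finally show ?thesis .
qed

lemma sc_smooth: "x \<in> N \<Longrightarrow> sc S (smooth S x) = sc S x"
  by (rule sc_eqI) (simp_all add: state_circ_def r_into_rtrancl rel_smooth)
lemma sc_al: "x \<in> N \<Longrightarrow> sc S (al x) = sc S x"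
  by (rule sc_eqI) (simp_all add: state_circ_def r_into_rtrancl rel_al)

lemma surgery:
  assumes c: "c \<in> {1..n}"
  shows "sc (flip c S) (c, 0) = sc (flip c S) (c, 2) \<longleftrightarrow> sc S (c, 0) \<noteq> sc S (c, 2)"
    and "sc S (c, 0) \<noteq> sc S (c, 2) \<Longrightarrow> x \<in> N \<Longrightarrow> sc (flip c S) x =
      (if x \<in> sc S (c, 0) \<union> sc S (c, 2) then sc S (c, 0) \<union> sc S (c, 2) else sc S x)"
proof -
  \<comment> \<open>The colouring is normalised so that \<open>(c, 0)\<close> is selected. Then
    \<open>(c, 2)\<close> is selected too, \<open>(c, 1)\<close> and \<open>(c, 3)\<close> are not,
    and the two smoothings of \<open>c\<close> differ by exchanging the images of
    \<open>(c, 0)\<close> and \<open>(c, 2)\<close>.\<close>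
  define q where "q x \<longleftrightarrow> (fo x \<longleftrightarrow> fo (c, 0))" for x
  have q: "alt q" unfolding q_def by (rule alt_iff[OF alt_fo])
  let ?O = "{x \<in> N. q x}"
  have u: "(c, 0) \<in> ?O" and v: "(c, 2) \<in> ?O" and uN: "(c, 0) \<in> N" and vN: "(c, 2) \<in> N"
    using c alt_crossing[OF q c] by (auto simp: darts_iff q_def)
  have ru: "rep q (c, 0) = (c, 0)" "rep q (c, 2) = (c, 2)" using u v by (simp_all add: rep_def)
  have f': "rho (flip c S) x = (if x = (c, 0) then rho S (c, 2) else if x = (c, 2) then rho S (c, 0) else rho S x)"
    if x: "x \<in> ?O" for x
  proof -
    have "x \<in> N" using x by simp
    then show ?thesis
    proof (cases x rule: dart_cases)
      case (2 d)
      then show ?thesis using x alt_crossing[OF q 2(1)] u by (cases "d = c") (auto simp: rho_def smooth_cases flip_mem)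
    next
      case (4 d)
      then show ?thesis using x alt_crossing[OF q 4(1)] u by (cases "d = c") (auto simp: rho_def smooth_cases flip_mem)
    qed (auto simp: rho_def smooth_cases flip_mem)
  qed
  note pp = perm_rho[OF q, of S] perm_rho[OF q, of "flip c S"] u v
  have ne: "(c, 0) \<noteq> (c, 2 :: nat)" by simp
  show "sc (flip c S) (c, 0) = sc (flip c S) (c, 2) \<longleftrightarrow> sc S (c, 0) \<noteq> sc S (c, 2)"
    using fin_perm_swap_toggle[OF pp ne f'] sc_eq_iff[OF q uN vN] ru by simp
  show "sc (flip c S) x = (if x \<in> sc S (c, 0) \<union> sc S (c, 2) then sc S (c, 0) \<union> sc S (c, 2) else sc S x)"
    if h: "sc S (c, 0) \<noteq> sc S (c, 2)" and x: "x \<in> N"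
  proof -
    have h': "perm_orbit (rho S) (c, 0) \<noteq> perm_orbit (rho S) (c, 2)" using h sc_eq_iff[OF q uN vN] ru by simp
    note g = fin_perm_swap_glue[OF pp ne f' h' rep_in[OF q x]]
    note m = state_circ_rho[OF q]
    have "y \<in> sc (flip c S) x \<longleftrightarrow> y \<in> (if x \<in> sc S (c, 0) \<union> sc S (c, 2) then sc S (c, 0) \<union> sc S (c, 2) else sc S x)" for y
    proof -
      let ?u = "perm_orbit (rho S) (c, 0)" and ?v = "perm_orbit (rho S) (c, 2)"
      have mu: "z \<in> sc S (c, 0) \<longleftrightarrow> z \<in> N \<and> rep q z \<in> ?u" and mv: "z \<in> sc S (c, 2) \<longleftrightarrow> z \<in> N \<and> rep q z \<in> ?v" for z
        using m[OF uN, of z S] m[OF vN, of z S] ru by simp_all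
      note mx = m[OF x, of y S] m[OF x, of y "flip c S"]
      show ?thesis
      proof (cases "rep q x \<in> ?u \<union> ?v")
        case True
        then have mem: "x \<in> sc S (c, 0) \<union> sc S (c, 2)" using mu mv x by blast
        have "perm_orbit (rho (flip c S)) (rep q x) = ?u \<union> ?v" using g True by (simp only: if_True)
        then have "y \<in> sc (flip c S) x \<longleftrightarrow> y \<in> sc S (c, 0) \<union> sc S (c, 2)"
          unfolding mx(2) Un_iff mu mv by blast
        then show ?thesis by (simp only: mem if_True)
      next
        case False
        then have mem: "x \<notin> sc S (c, 0) \<union> sc S (c, 2)" using mu mv by blast
        have "perm_orbit (rho (flip c S)) (rep q x) = perm_orbit (rho S) (rep q x)" using g False by (simp only: if_False)
        then have "y \<in> sc (flip c S) x \<longleftrightarrow> y \<in> sc S x" unfolding mx by (simp only:)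
        then show ?thesis by (simp only: mem if_False)
      qed
    qed
    then show ?thesis by (rule Set.set_eqI)
  qed
qed

text \<open>The opposite darts \<open>(c, 0)\<close> and \<open>(c, 2)\<close> lie on different arcs
  of \<open>c\<close> in either smoothing, so one pair of marks serves all states.\<close>

sublocale cs: circle_system n N "state_circ n al" "\<lambda>c. (c, 0)" "\<lambda>c. (c, 2)" base
    "- int (c_minus n al)" "int (c_plus n al) - 2 * int (c_minus n al)"
proof
  show "finite N" by (rule finite_darts)
  show "base \<in> N" by (rule baseN)
  show "(c, 0) \<in> N" "(c, 2) \<in> N" if "c \<in> {1..n}" for c using that by (simp_all add: darts_iff)
qed (fact sc_refl sc_sub sc_eqI surgery)+

section \<open>Identification with the Khovanov complex\<close>

lemma kh_gens_eq: "kh_gens n al base = cs.gens"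
  by (simp add: kh_gens_def cs.gens_def state_circles_def cs.circ_def)

lemma kh_deg_eq: "kh_deg n al = cs.deg"
  by (intro ext) (simp add: kh_deg_def kh_i_def kh_j_def cs.deg_def state_circles_def cs.circ_def)

lemma touching:
  assumes c: "c \<in> {1..n}"
  shows "{C \<in> state_circles n al S. \<exists>k<4. (c, k) \<in> C} = {sc S (c, 0), sc S (c, 2)}" (is "?l = ?r")
proof
  have N: "(c, k) \<in> N" if "k < 4" for k using c that by (simp add: darts_iff)
  have k: "sc S (c, k) \<in> ?r" if "k < 4" for k
  proof -
    have "k = 0 \<or> k = 1 \<or> k = 2 \<or> k = 3" using that by auto
    then show ?thesis using sc_smooth[OF N[of 1], of S] sc_smooth[OF N[of 3], of S]
      by (auto simp: smooth_cases split: if_splits)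
  qed
  show "?l \<subseteq> ?r"
  proof
    fix C assume "C \<in> ?l"
    then obtain x k where x: "x \<in> N" "C = sc S x" "k < 4" "(c, k) \<in> C" by (auto simp: state_circles_def)
    then have "C = sc S (c, k)" using sc_eqI by metis
    then show "C \<in> ?r" using k[OF x(3)] by simp
  qed
  show "?r \<subseteq> ?l" using sc_refl N[of 0] N[of 2] unfolding state_circles_def by force
qed

lemma kh_d_eq: "kh_d n al base = cs.dK"
proof (intro ext)
  fix g g' :: kh_gen
  show "kh_d n al base g g' = cs.dK g g'"
  proof (cases "g \<in> cs.gens \<and> g' \<in> cs.gens \<and> (\<exists>c\<in>{1..n}. c \<notin> fst g \<and> fst g' = insert c (fst g))")
    case False
    then show ?thesis unfolding kh_d_def cs.dK_def kh_gens_eq if_not_P[OF False] by simp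
  next
    case True
    obtain S L where g: "g = (S, L)" by force
    obtain S' L' where g': "g' = (S', L')" by force
    obtain c where c: "c \<in> {1..n}" "c \<notin> S" "S' = insert c S" using True g g' by auto
    have the: "(THE x. x \<notin> S \<and> S' = insert x S) = c" using c by blast
    have "(card {sc S (c, 0), sc S (c, 2)} = 2) = (sc S (c, 0) \<noteq> sc S (c, 2))" by (cases "sc S (c, 0) = sc S (c, 2)") auto
    then have "kh_d n al base g g' = cs.sg S c * cs.ent S c L L'"
      using True unfolding kh_d_def kh_gens_eq g g' fst_conv snd_conv Let_def the touching[OF c(1)] cs.sg_def cs.ent_def
      by (simp add: c(3))
    also have "\<dots> = cs.dK g g'" using cs.dK_eq[OF c(1,2)] True unfolding g g' c(3) by simp
    finally show ?thesis .
  qed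
qed

lemma dg_opp_cases:
  "dg_opp (c, 0) = (c, 2)" "dg_opp (c, 1) = (c, 3)" "dg_opp (c, 2) = (c, 0)" "dg_opp (c, 3) = (c, 1)"
  by (simp_all add: dg_opp_def)

text \<open>While all crossings are tied, a saturated set is closed under going straight on, so the
  knot sweeps out everything from any of its darts.\<close>

lemma conn_start: "cs.conn n {}"
  unfolding cs.conn_def
proof (intro allI impI)
  fix A assume A: "cs.sat n {} A"
  have AN: "A \<subseteq> N" and cl: "\<And>x. x \<in> A \<Longrightarrow> sc {} x \<subseteq> A" and ab: "\<And>c. c \<in> {1..n} \<Longrightarrow> (c, 0) \<in> A \<longleftrightarrow> (c, 2) \<in> A"
    using A by (auto simp: cs.sat_def)
  have sm: "smooth {} x \<in> A" if "x \<in> A" for x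
    using cl[OF that] sc_smooth[of x "{}"] sc_refl[OF smooth_in] that AN by blast
  have ala: "al x \<in> A" if "x \<in> A" for x
    using cl[OF that] sc_al[of x "{}"] sc_refl[OF al(1)] that AN by blast
  have "dg_opp x \<in> A" if x: "x \<in> A" for x
  proof -
    have "x \<in> N" using x AN by blast
    then show ?thesis
    proof (cases x rule: dart_cases)
      case (1 c)
      then show ?thesis using ab[OF 1(1)] x by (simp add: dg_opp_cases)
    next
      case (2 c)
      have "(c, 2) \<in> A" using sm[OF x] 2 by (simp add: smooth_cases)
      then have "smooth {} (c, 0) \<in> A" using ab[OF 2(1)] sm by blast
      then show ?thesis using 2 by (simp add: smooth_cases dg_opp_cases)
    next
      case (3 c)
      then show ?thesis using ab[OF 3(1)] x by (simp add: dg_opp_cases)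
    next
      case (4 c)
      have "(c, 0) \<in> A" using sm[OF x] 4 by (simp add: smooth_cases)
      then have "smooth {} (c, 2) \<in> A" using ab[OF 4(1)] sm by blast
      then show ?thesis using 4 by (simp add: smooth_cases dg_opp_cases)
    qed
  qed
  then show "A = {} \<or> A = N" using ala AN by (intro connected_darts)
qed

section \<open>Half-edges, quasi-trees and chord diagrams\<close>

abbreviation "M \<equiv> {1..2 * n}"
abbreviation "qs \<equiv> qt_sigma n al outer"

text \<open>The dart by which the oriented all-A circle enters the arc of half-edge
  \<open>j\<close>. These are the darts with an even face on their left, one for each half-edge;
  under this bijection the face permutation \<open>qs\<close> becomes \<open>rho\<close>.\<close>

definition entry :: "nat \<Rightarrow> nat \<times> nat" where "entry j = smooth {} (mark_exit n al outer j)"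

lemma mark_cases:
  assumes "j \<in> M" obtains c where "c \<in> {1..n}" "j = 2 * c - 1" | c where "c \<in> {1..n}" "j = 2 * c"
proof (cases "even j")
  case True
  then obtain c where "j = 2 * c" by blast
  then show ?thesis using that assms by auto
next
  case False
  then obtain c where "j = 2 * c + 1" by (elim oddE)
  then show ?thesis using that(1)[of "c + 1"] assms by auto
qed

lemma mark_arith:
  assumes "c \<in> {1..n}"
  shows "odd (2 * c - 1)" "(2 * c - 1 + 1) div 2 = c" "(2 * c + 1) div 2 = c" "2 * c - 1 \<in> M" "2 * c \<in> M"
    "sigma1 (2 * c - 1) = 2 * c" "sigma1 (2 * c) = 2 * c - 1"
  using assms by (auto simp: sigma1_def)

lemma exits:
  assumes c: "c \<in> {1..n}"
  shows "mark_exit n al outer (2 * c - 1) = (c, if fo (c, 0) then 2 else 1)"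
    and "mark_exit n al outer (2 * c) = (c, if fo (c, 0) then 0 else 3)"
    and "entry (2 * c - 1) = (c, if fo (c, 0) then 1 else 2)"
    and "entry (2 * c) = (c, if fo (c, 0) then 3 else 0)"
proof -
  show 1: "mark_exit n al outer (2 * c - 1) = (c, if fo (c, 0) then 2 else 1)"
    using mark_arith[OF c] alt_crossing[OF alt_fo c] by (simp add: mark_exit_def Let_def)
  show 2: "mark_exit n al outer (2 * c) = (c, if fo (c, 0) then 0 else 3)"
    using mark_arith[OF c] alt_crossing[OF alt_fo c] by (simp add: mark_exit_def Let_def)
  show "entry (2 * c - 1) = (c, if fo (c, 0) then 1 else 2)" unfolding entry_def 1 by (simp add: smooth_cases)
  show "entry (2 * c) = (c, if fo (c, 0) then 3 else 0)" unfolding entry_def 2 by (simp add: smooth_cases)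
qed

lemma entry_in: "j \<in> M \<Longrightarrow> entry j \<in> N" "j \<in> M \<Longrightarrow> \<not> fo (entry j)" "j \<in> M \<Longrightarrow> arc_mark (entry j) = j"
  by (erule mark_cases; simp add: exits alt_crossing[OF alt_fo] darts_iff arc_mark_def)+

lemma arc_mark_in: "x \<in> N \<Longrightarrow> arc_mark x \<in> M"
  by (erule dart_cases) (auto simp: arc_mark_def)

lemma entry_arc_mark: "x \<in> N \<Longrightarrow> \<not> fo x \<Longrightarrow> entry (arc_mark x) = x"
  by (erule dart_cases) (auto simp: arc_mark_def exits alt_crossing[OF alt_fo])

lemma qs_entry: assumes "j \<in> M" shows "qs Q j = arc_mark (rho Q (entry j))"
  using assms
proof (cases j rule: mark_cases)
  case (1 c)
  then show ?thesis using mark_arith[OF 1(1)] exits[OF 1(1)]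
    by (simp add: qt_sigma_def sigma0_def rho_def smooth_cases)
next
  case (2 c)
  then show ?thesis using mark_arith[OF 2(1)] exits[OF 2(1)]
    by (simp add: qt_sigma_def sigma0_def rho_def smooth_cases)
qed

lemma alt_nfo: "alt (\<lambda>x. \<not> fo x)" using alt_iff[OF alt_fo, of False] by simp

lemma entry_qs: assumes j: "j \<in> M" shows "entry (qs Q j) = rho Q (entry j)"
proof -
  interpret fin_perm "{x \<in> N. \<not> fo x}" "rho Q" by (rule perm_rho[OF alt_nfo])
  have "rho Q (entry j) \<in> {x \<in> N. \<not> fo x}" using into entry_in[OF j] by simp
  then show ?thesis using entry_arc_mark qs_entry[OF j] by simp
qed

lemma perm_qs: "fin_perm M (qs Q)"
proof
  interpret fin_perm "{x \<in> N. \<not> fo x}" "rho Q" by (rule perm_rho[OF alt_nfo])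
  show "finite M" by simp
  show "qs Q j \<in> M" if "j \<in> M" for j
    using qs_entry[OF that] into[of "entry j"] entry_in[OF that] arc_mark_in by simp
  show "inj_on (qs Q) M"
  proof (rule inj_onI)
    fix j k assume jk: "j \<in> M" "k \<in> M" "qs Q j = qs Q k"
    then have "rho Q (entry j) = rho Q (entry k)" using entry_qs by metis
    then have "entry j = entry k" using inj_onD[OF inj] entry_in jk by simp
    then show "j = k" using entry_in(3) jk by metis
  qed
qed

lemma qs_orbit_iff:
  assumes j: "j \<in> M" "k \<in> M"
  shows "perm_orbit (qs Q) j = perm_orbit (qs Q) k \<longleftrightarrow> sc Q (entry j) = sc Q (entry k)"
proof -
  interpret f: fin_perm M "qs Q" by (rule perm_qs)
  interpret r: fin_perm "{x \<in> N. \<not> fo x}" "rho Q" by (rule perm_rho[OF alt_nfo])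
  have pw: "entry ((qs Q ^^ i) k) = (rho Q ^^ i) (entry k)" for i
  proof (induction i)
    case (Suc i)
    then show ?case using entry_qs[OF f.pow_in[OF j(2), of i]] by simp
  qed simp
  have "j \<in> perm_orbit (qs Q) k \<longleftrightarrow> entry j \<in> perm_orbit (rho Q) (entry k)"
  proof
    assume "j \<in> perm_orbit (qs Q) k"
    then show "entry j \<in> perm_orbit (rho Q) (entry k)" using pw by (auto simp: perm_orbit_def)
  next
    assume "entry j \<in> perm_orbit (rho Q) (entry k)"
    then obtain i where "entry j = entry ((qs Q ^^ i) k)" using pw by (auto simp: perm_orbit_def)
    then have "j = (qs Q ^^ i) k" using entry_in(3) j f.pow_in by metis
    then show "j \<in> perm_orbit (qs Q) k" by (auto simp: perm_orbit_def)
  qed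
  moreover have "rep (\<lambda>x. \<not> fo x) (entry i) = entry i" if "i \<in> M" for i using entry_in[OF that] by (simp add: rep_def)
  ultimately show ?thesis
    using f.orbit_eq_iff[OF j(2,1)] sc_eq_iff[OF alt_nfo entry_in(1)[OF j(1)] entry_in(1)[OF j(2)]]
      r.orbit_eq_iff[of "entry k" "entry j"] entry_in j by simp
qed

lemma sc_entry: assumes x: "x \<in> N" obtains j where "j \<in> M" "sc Q x = sc Q (entry j)"
proof (cases "fo x")
  case True
  then have "\<not> fo (al x)" using alt_al[OF alt_fo x] by simp
  then have "entry (arc_mark (al x)) = al x" using entry_arc_mark al(1)[OF x] by blast
  then show ?thesis using that[OF arc_mark_in[OF al(1)[OF x]]] sc_al[OF x] by simp
next
  case False
  then show ?thesis using that[OF arc_mark_in[OF x]] entry_arc_mark[OF x] by simp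
qed

lemma one_mark: "1 \<in> M" using n_pos by simp

text \<open>The faces of the spanning subgraph \<open>Q\<close> are the circles of the state with
  B-smoothings at \<open>Q\<close>.\<close>

lemma quasi_tree_iff: "quasi_tree n al outer Q \<longleftrightarrow> Q \<subseteq> {1..n} \<and> cs.conn 0 Q"
proof -
  let ?O = "perm_orbit (qs Q)"
  have "card (?O ` M) = 1 \<longleftrightarrow> (\<forall>j\<in>M. ?O j = ?O 1)"
  proof
    assume "card (?O ` M) = 1"
    then obtain X where X: "?O ` M = {X}" by (rule card_1_singletonE)
    have "?O j = X" if "j \<in> M" for j using imageI[OF that, of ?O] unfolding X by (rule singletonD)
    then show "\<forall>j\<in>M. ?O j = ?O 1" using one_mark by metis
  next
    assume "\<forall>j\<in>M. ?O j = ?O 1"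
    then have "?O ` M = (\<lambda>_. ?O 1) ` M" by (intro image_cong refl) (erule bspec)
    also have "\<dots> = {?O 1}" by (rule image_constant[OF one_mark])
    finally have "?O ` M = {?O 1}" .
    then show "card (?O ` M) = 1" by simp
  qed
  also have "\<dots> \<longleftrightarrow> (\<forall>j\<in>M. sc Q (entry j) = sc Q (entry 1))" using qs_orbit_iff[OF _ one_mark] by blast
  also have "\<dots> \<longleftrightarrow> (\<forall>x\<in>N. sc Q x = N)"
  proof
    assume h: "\<forall>j\<in>M. sc Q (entry j) = sc Q (entry 1)"
    have e: "sc Q x = sc Q (entry 1)" if "x \<in> N" for x using sc_entry[OF that, of Q] h by metis
    show "\<forall>x\<in>N. sc Q x = N"
    proof
      fix x assume x: "x \<in> N"
      have "y \<in> sc Q x" if "y \<in> N" for y using sc_refl[OF that, of Q] e[OF that] e[OF x] by simp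
      then show "sc Q x = N" using sc_sub[OF x] by blast
    qed
  qed (use entry_in one_mark in metis)
  finally show ?thesis unfolding quasi_tree_def perm_orbits_def cs.conn_0 by simp
qed

lemma sc_entry_pair:
  assumes c: "c \<in> {1..n}"
  shows "sc S (entry (2 * c - 1)) = sc S (entry (2 * c)) \<longleftrightarrow> sc S (c, 0) = sc S (c, 2)"
proof -
  have N: "(c, 1) \<in> N" "(c, 3) \<in> N" using c by (simp_all add: darts_iff)
  show ?thesis using sc_smooth[OF N(1), of S] sc_smooth[OF N(2), of S] unfolding exits[OF c]
    by (auto simp: smooth_cases split: if_splits)
qed

text \<open>Switching \<open>k\<close> exchanges the images of its two half-edges under
  \<open>qs\<close>, which cuts the chord circle at the ends of \<open>k\<close>. Chord
  \<open>i\<close> crosses \<open>k\<close> iff its ends fall on different arcs.\<close>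

lemma chords_intersect_iff:
  assumes Q: "cs.conn 0 Q" and k: "k \<in> {1..n}" and i: "i \<in> {1..n}" and ki: "k \<noteq> i"
  shows "chords_intersect n al outer Q k i \<longleftrightarrow> sc (flip k Q) (i, 0) \<noteq> sc (flip k Q) (i, 2)"
proof -
  interpret f: fin_perm M "qs Q" by (rule perm_qs)
  note mk = mark_arith[OF k] and mi = mark_arith[OF i]
  have one: "perm_orbit (qs Q) 1 = M"
  proof -
    have "j \<in> perm_orbit (qs Q) 1" if "j \<in> M" for j
    proof -
      have "sc Q (entry j) = sc Q (entry 1)" using Q entry_in(1) that one_mark by (simp add: cs.conn_0)
      then have "perm_orbit (qs Q) j = perm_orbit (qs Q) 1" using qs_orbit_iff[OF that one_mark] by simp
      then show ?thesis using f.orbit_self by blast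
    qed
    then show ?thesis using f.orbit_sub[OF one_mark] by blast
  qed
  have f': "qs (flip k Q) x = (if x = 2 * k - 1 then qs Q (2 * k) else if x = 2 * k then qs Q (2 * k - 1) else qs Q x)"
    if "x \<in> M" for x
    using that
  proof (cases x rule: mark_cases)
    case (1 c)
    then show ?thesis using mk mark_arith[OF 1(1)] k by (cases "c = k") (auto simp: qt_sigma_def flip_mem)
  next
    case (2 c)
    then show ?thesis using mk mark_arith[OF 2(1)] k by (cases "c = k") (auto simp: qt_sigma_def flip_mem)
  qed
  have ne: "2 * k - 1 \<noteq> 2 * k" "2 * i - 1 \<noteq> 2 * k - 1" "2 * i - 1 \<noteq> 2 * k" "2 * i \<noteq> 2 * k - 1" "2 * i \<noteq> 2 * k"
    using k i ki by auto
  define p where "p = chord_pos n al outer Q"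
  have arcs: "perm_orbit (qs (flip k Q)) (2 * i - 1) = perm_orbit (qs (flip k Q)) (2 * i) \<longleftrightarrow>
    (min (p (2 * k - 1)) (p (2 * k)) < p (2 * i - 1) \<and> p (2 * i - 1) < max (p (2 * k - 1)) (p (2 * k))) =
    (min (p (2 * k - 1)) (p (2 * k)) < p (2 * i) \<and> p (2 * i) < max (p (2 * k - 1)) (p (2 * k)))"
    unfolding p_def chord_pos_def
    by (rule fin_perm_swap_arcs[OF perm_qs perm_qs mk(4,5) ne(1) _ one one_mark mi(4,5) ne(2-5)]) (rule f')
  have "chords_intersect n al outer Q k i \<longleftrightarrow> perm_orbit (qs (flip k Q)) (2 * i - 1) \<noteq> perm_orbit (qs (flip k Q)) (2 * i)"
    unfolding chords_intersect_def Let_def p_def[symmetric] arcs by blast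
  also have "\<dots> \<longleftrightarrow> sc (flip k Q) (entry (2 * i - 1)) \<noteq> sc (flip k Q) (entry (2 * i))"
    using qs_orbit_iff[OF mi(4,5)] by simp
  finally show ?thesis using sc_entry_pair[OF i] by simp
qed

text \<open>\<open>live\<close> cuts along the lower chord and \<open>lv\<close> along
  \<open>i\<close> itself; \<open>noncrossing_sym\<close> reconciles the two.\<close>

lemma live_iff:
  assumes Q: "cs.conn 0 Q" and i: "i \<in> {1..n}" shows "live n al outer Q i \<longleftrightarrow> cs.lv Q i"
proof -
  have "chords_intersect n al outer Q k i \<longleftrightarrow> sc (flip i Q) (k, 0) \<noteq> sc (flip i Q) (k, 2)" if k: "k \<in> {1..<i}" for k
  proof -
    have kN: "k \<in> {1..n}" "k \<noteq> i" using k i by auto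
    then show ?thesis
      using chords_intersect_iff[OF Q kN(1) i kN(2)] cs.noncrossing_sym[OF Q i kN(1)] cs.noncrossing_sym[OF Q kN(1) i] by blast
  qed
  then show ?thesis unfolding live_def cs.lv_def by blast
qed

text \<open>Raising \<open>i\<close> by one at fixed \<open>j\<close> lowers both coordinates by
  one, so a cohomological differential becomes one of bidegree (-1, -1).\<close>

definition phi :: "int \<times> int \<Rightarrow> int \<times> real" where
  "phi = (\<lambda>(i, j). (j - i - writhe n al + 1,
     real_of_int j / 2 - real_of_int i + (real (rg_V n al outer) - real (c_plus n al)) / 2))"

lemma inj_phi: "inj phi"
proof (rule injI)
  fix x y assume "phi x = phi y"
  then have "snd x - fst x = snd y - fst y" "real_of_int (snd x) / 2 - fst x = real_of_int (snd y) / 2 - fst y"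
    by (auto simp: phi_def split_beta)
  then have "real_of_int (snd x - fst x) = real_of_int (snd y - fst y)"
    "real_of_int (snd x) - 2 * fst x = real_of_int (snd y) - 2 * fst y" by (simp_all add: field_simps)
  then have "real_of_int (fst x) = fst y" "real_of_int (snd x) = snd y" by simp_all
  then show "x = y" by (simp add: prod_eq_iff)
qed

text \<open>In \<open>j - i\<close> the number of B-smoothings cancels, and the live crossings
  outside \<open>Q\<close> minus those in \<open>Q\<close> remain. In \<open>j - 2 i\<close> the
  live crossings cancel, and \<open>card Q\<close> remains, which gives the genus.\<close>

lemma qt_deg_eq:
  assumes Q: "Q \<subseteq> {1..n}" "cs.conn 0 Q" shows "qt_deg n al outer Q = phi (cs.qdeg Q)"
proof -
  define L where "L = cs.lives Q"
  have fin: "finite Q" "finite L" using Q finite_subset by (auto simp: L_def cs.lives_def)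
  have L1: "{i \<in> {1..n}. live n al outer Q i \<and> i \<notin> Q} = L - Q"
    "{i \<in> {1..n}. live n al outer Q i \<and> i \<in> Q} = L \<inter> Q"
    using live_iff[OF Q(2)] unfolding L_def cs.lives_def by blast+
  have cL: "card L = card (L - Q) + card (L \<inter> Q)" using fin by (metis card_Diff_subset_Int card_mono inf_le1 le_add_diff_inverse2 finite_Int)
  have "symd L Q = (Q - (L \<inter> Q)) \<union> (L - Q)" by (auto simp: symd_def)
  then have "card (symd L Q) = card (Q - (L \<inter> Q)) + card (L - Q)" using fin by (simp add: card_Un_disjoint Diff_Int_distrib2 disjoint_iff)
  moreover have "card (Q - (L \<inter> Q)) + card (L \<inter> Q) = card Q"
    using fin card_mono[of Q "L \<inter> Q"] by (simp add: card_Diff_subset)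
  ultimately have cs: "int (card (symd L Q)) = int (card Q) - int (card (L \<inter> Q)) + int (card (L - Q))" by simp
  show ?thesis
    unfolding qt_deg_def qt_u_def qt_v_def qt_genus_def phi_def cs.qdeg_def L_def[symmetric] L1 prod.case cs cL
    by (simp add: writhe_def field_simps)
qed

end

theorem theorem2:
  fixes n :: nat and al :: "nat \<times> nat \<Rightarrow> nat \<times> nat" and outer base :: "nat \<times> nat"
  assumes "knot_diagram n al" and "outer \<in> dg_darts n" and "base \<in> dg_darts n"
  shows "\<exists>dd :: nat set \<Rightarrow> nat set \<Rightarrow> int.
     (\<forall>Q Q'. dd Q Q' \<noteq> 0 \<longrightarrow> Q \<in> qt_gens n al outer \<and> Q' \<in> qt_gens n al outer
          \<and> qt_u n al outer Q' = qt_u n al outer Q - 1 \<and> qt_v n al outer Q' = qt_v n al outer Q - 1)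
   \<and> (\<forall>Q Q''. mat_comp (qt_gens n al outer) dd dd Q Q'' = 0)
   \<and> deformation_retract (kh_gens n al base) (kh_deg n al) (kh_d n al base) (\<lambda>(i, j). (i - 1, j))
        (qt_gens n al outer) (qt_deg n al outer) dd
        (\<lambda>(i, j). (j - i - writhe n al + 1,
                   real_of_int j / 2 - real_of_int i + (real (rg_V n al outer) - real (c_plus n al)) / 2))
   \<and> (\<forall>i j u v :: int.
        u = j - i - writhe n al + 1
        \<and> real_of_int v = real_of_int j / 2 - real_of_int i + (real (rg_V n al outer) - real (c_plus n al)) / 2
        \<longrightarrow> cx_homology (kh_gens n al base) (kh_deg n al) (kh_d n al base) (i, j) (i - 1, j)
            \<cong> cx_homology (qt_gens n al outer) (qt_deg n al outer) dd (u, real_of_int v) (u + 1, real_of_int v + 1))"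
proof -
  interpret knot_pt n al outer base using assms by unfold_locales
  define C where "C = qt_gens n al outer"
  have C: "C = {Q. Q \<subseteq> {1..n} \<and> cs.conn 0 Q}" by (simp add: C_def qt_gens_def quasi_tree_iff)
  have finC: "finite C" by (rule finite_subset[of _ "Pow {1..n}"]) (auto simp: C)
  obtain e where e: "sdr cs.gens cs.deg cs.dK C cs.qdeg e" using cs.gens_sdr[OF conn_start] C by auto
  have cx: "complex C cs.qdeg e" by (rule complex_target[OF cs.complex_dK finC e])
  have deg: "qt_deg n al outer Q = phi (cs.qdeg Q)" if "Q \<in> C" for Q using that qt_deg_eq by (simp add: C)
  have 1: "Q \<in> C \<and> Q' \<in> C \<and> qt_u n al outer Q' = qt_u n al outer Q - 1 \<and> qt_v n al outer Q' = qt_v n al outer Q - 1"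
    if nz: "e Q Q' \<noteq> 0" for Q Q'
  proof -
    have Q: "Q \<in> C" "Q' \<in> C" and d: "cs.qdeg Q' = (fst (cs.qdeg Q) + 1, snd (cs.qdeg Q))"
      using cx nz by (auto simp: complex_def mat_on_def)
    have "qt_u n al outer R = fst (phi (cs.qdeg R))" "qt_v n al outer R = snd (phi (cs.qdeg R))" if "R \<in> C" for R
      using deg[OF that] by (simp_all add: qt_deg_def flip: deg[OF that])
    then show ?thesis using Q d by (simp add: phi_def split_beta)
  qed
  have 2: "mat_comp C e e Q Q'' = 0" for Q Q'' using cx by (simp add: complex_def)
  have 3: "deformation_retract (kh_gens n al base) (kh_deg n al) (kh_d n al base) (\<lambda>(i, j). (i - 1, j))
        C (qt_deg n al outer) e phi"
    unfolding kh_gens_eq kh_deg_eq kh_d_eq by (rule sdr_deformation_retract[OF e]) (rule deg)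
  have 4: "cx_homology (kh_gens n al base) (kh_deg n al) (kh_d n al base) (i, j) (i - 1, j)
            \<cong> cx_homology C (qt_deg n al outer) e (u, real_of_int v) (u + 1, real_of_int v + 1)"
    if uv: "u = j - i - writhe n al + 1"
      "real_of_int v = real_of_int j / 2 - real_of_int i + (real (rg_V n al outer) - real (c_plus n al)) / 2" for i j u v :: int
  proof -
    have p: "(u, real_of_int v) = phi (i, j)" "(u + 1, real_of_int v + 1) = phi (i - 1, j)"
      using uv by (simp_all add: phi_def)
    have r: "cx_homology C (qt_deg n al outer) e (phi k) (phi l) = cx_homology C cs.qdeg e k l" for k l
      by (rule cx_homology_regrade[OF inj_phi]) (rule deg)
    show ?thesis unfolding p kh_gens_eq kh_deg_eq kh_d_eq r
      by (rule sdr_homology_iso[OF cs.complex_dK finC e]) simp_all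
  qed
  show ?thesis
    unfolding C_def[symmetric] phi_def[symmetric]
  proof (rule exI[of _ e], intro conjI)
    show "\<forall>Q Q'. e Q Q' \<noteq> 0 \<longrightarrow> Q \<in> C \<and> Q' \<in> C
        \<and> qt_u n al outer Q' = qt_u n al outer Q - 1 \<and> qt_v n al outer Q' = qt_v n al outer Q - 1"
      using 1 by blast
    show "\<forall>Q Q''. mat_comp C e e Q Q'' = 0" using 2 by blast
  qed (rule 3, intro allI impI, elim conjE, rule 4)
qed

end
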